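(* Let $\mathcal{K}$ be a matroid on the vertex set $[m]=\{1,\dots,m\}$. Then the Tor-module $\mathrm{Tor}_{\mathbb{Z}[v_1,\dots,v_m]}(\mathbb{Z}[\mathcal{K}];\mathbb{Z})$ has no torsion (as an abelian group).
   Context: A finite simplicial complex $\mathcal{K}$ is a matroid if for all simplices $\sigma,\tau\in\mathcal{K}$ with $|\sigma|>|\tau|$ there is $v\in\sigma\setminus\tau$ with $\tau\cup\{v\}\in\mathcal{K}$. The Stanley–Reisner ring is $\mathbb{Z}[\mathcal{K}]=\mathbb{Z}[v_1,\dots,v_m]/(v_{i_1}\cdots v_{i_k} : \{i_1,\dots,i_k\}\notin\mathcal{K})$. The ring $\mathbb{Z}$ is a $\mathbb{Z}[v_1,\dots,v_m]$-module with each $v_i$ acting by $0$. *)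

theory Defs
  imports "HOL-Algebra.Algebra" "HOL-Library.Poly_Mapping"
begin

section \<open>Simplicial complexes and matroids\<close>

text \<open>Some \<open>v \<in> V\<close> may fail to be a vertex, i.e. \<open>{v} \<notin> K\<close> is allowed (``ghost vertices'', loops of a
  matroid).  The empty simplex is always present.\<close>

definition simplicial_complex :: "'v set \<Rightarrow> 'v set set \<Rightarrow> bool" where
  "simplicial_complex V K \<longleftrightarrow>
     finite V \<and> K \<subseteq> Pow V \<and> {} \<in> K \<and> (\<forall>\<sigma>\<in>K. \<forall>\<tau>. \<tau> \<subseteq> \<sigma> \<longrightarrow> \<tau> \<in> K)"

definition matroid :: "'v set \<Rightarrow> 'v set set \<Rightarrow> bool" where
  "matroid V K \<longleftrightarrow> simplicial_complex V K \<and>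
     (\<forall>\<sigma>\<in>K. \<forall>\<tau>\<in>K. card \<sigma> > card \<tau> \<longrightarrow> (\<exists>v\<in>\<sigma> - \<tau>. \<tau> \<union> {v} \<in> K))"


section \<open>Modules over a commutative ring\<close>

definition linear_map ::
    "('r, 's) ring_scheme \<Rightarrow> ('r, 'a) module \<Rightarrow> ('r, 'b) module \<Rightarrow> ('a \<Rightarrow> 'b) \<Rightarrow> bool" where
  "linear_map R M N f \<longleftrightarrow>
     f \<in> carrier M \<rightarrow> carrier N \<and>
     (\<forall>x\<in>carrier M. \<forall>y\<in>carrier M. f (x \<oplus>\<^bsub>M\<^esub> y) = f x \<oplus>\<^bsub>N\<^esub> f y) \<and>
     (\<forall>r\<in>carrier R. \<forall>x\<in>carrier M. f (r \<odot>\<^bsub>M\<^esub> x) = r \<odot>\<^bsub>N\<^esub> f x)"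

text \<open>The ring \<open>S\<close> as a module over the domain of a ring homomorphism \<open>\<phi>\<close> into \<open>S\<close>.\<close>

definition restrict_scalars :: "'b ring \<Rightarrow> ('r \<Rightarrow> 'b) \<Rightarrow> ('r, 'b) module" where
  "restrict_scalars S \<phi> =
     \<lparr>carrier = carrier S, monoid.mult = monoid.mult S, one = one S, ring.zero = ring.zero S, ring.add = ring.add S,
      smult = (\<lambda>r x. \<phi> r \<otimes>\<^bsub>S\<^esub> x)\<rparr>"

text \<open>Coefficient families are functions that vanish outside \<open>B\<close> and have finite support, so that
  uniqueness below is uniqueness of the coefficients.\<close>

definition module_basis :: "('r, 's) ring_scheme \<Rightarrow> ('r, 'a) module \<Rightarrow> 'a set \<Rightarrow> bool" where
  "module_basis R M B \<longleftrightarrow>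
     B \<subseteq> carrier M \<and>
     (\<forall>x\<in>carrier M. \<exists>!c. c \<in> UNIV \<rightarrow> carrier R \<and> {b. c b \<noteq> \<zero>\<^bsub>R\<^esub>} \<subseteq> B \<and> finite {b. c b \<noteq> \<zero>\<^bsub>R\<^esub>} \<and>
        x = (\<Oplus>\<^bsub>M\<^esub>b\<in>{b. c b \<noteq> \<zero>\<^bsub>R\<^esub>}. c b \<odot>\<^bsub>M\<^esub> b))"

definition free_module :: "('r, 's) ring_scheme \<Rightarrow> ('r, 'a) module \<Rightarrow> bool" where
  "free_module R M \<longleftrightarrow> module R M \<and> (\<exists>B. module_basis R M B)"

text \<open>A free resolution \<open>\<dots> \<rightarrow> F 2 \<rightarrow> F 1 \<rightarrow> F 0 \<rightarrow> M \<rightarrow> 0\<close>, where \<open>d n\<close> maps \<open>F (Suc n)\<close> to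
  \<open>F n\<close> and \<open>\<epsilon>\<close> is the augmentation \<open>F 0 \<rightarrow> M\<close>.\<close>

definition free_resolution ::
    "('r, 's) ring_scheme \<Rightarrow> ('r, 'a) module \<Rightarrow>
     (nat \<Rightarrow> ('r, 'f) module) \<Rightarrow> (nat \<Rightarrow> 'f \<Rightarrow> 'f) \<Rightarrow> ('f \<Rightarrow> 'a) \<Rightarrow> bool" where
  "free_resolution R M F d \<epsilon> \<longleftrightarrow>
     (\<forall>n. free_module R (F n)) \<and>
     (\<forall>n. linear_map R (F (Suc n)) (F n) (d n)) \<and>
     linear_map R (F 0) M \<epsilon> \<and>
     \<epsilon> ` carrier (F 0) = carrier M \<and>
     d 0 ` carrier (F 1) = {x \<in> carrier (F 0). \<epsilon> x = \<zero>\<^bsub>M\<^esub>} \<and>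
     (\<forall>n. d (Suc n) ` carrier (F (Suc (Suc n))) = {x \<in> carrier (F (Suc n)). d n x = \<zero>\<^bsub>F n\<^esub>})"


section \<open>Tensor products and Tor\<close>

text \<open>The underlying abelian group of \<open>M \<otimes>\<^sub>R N\<close>, written multiplicatively, as a quotient of the
  free abelian group on the pairs \<open>(x, y)\<close>.\<close>

definition tensor_relators ::
    "('r, 's) ring_scheme \<Rightarrow> ('r, 'a) module \<Rightarrow> ('r, 'b) module \<Rightarrow> ('a \<times> 'b \<Rightarrow>\<^sub>0 int) set" where
  "tensor_relators R M N =
     {frag_of (x \<oplus>\<^bsub>M\<^esub> x', y) - frag_of (x, y) - frag_of (x', y) | x x' y.
        x \<in> carrier M \<and> x' \<in> carrier M \<and> y \<in> carrier N} \<union>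
     {frag_of (x, y \<oplus>\<^bsub>N\<^esub> y') - frag_of (x, y) - frag_of (x, y') | x y y'.
        x \<in> carrier M \<and> y \<in> carrier N \<and> y' \<in> carrier N} \<union>
     {frag_of (r \<odot>\<^bsub>M\<^esub> x, y) - frag_of (x, r \<odot>\<^bsub>N\<^esub> y) | r x y.
        r \<in> carrier R \<and> x \<in> carrier M \<and> y \<in> carrier N}"

definition tensor_null ::
    "('r, 's) ring_scheme \<Rightarrow> ('r, 'a) module \<Rightarrow> ('r, 'b) module \<Rightarrow> ('a \<times> 'b \<Rightarrow>\<^sub>0 int) set" where
  "tensor_null R M N =
     generate (free_Abelian_group (carrier M \<times> carrier N)) (tensor_relators R M N)"

definition tensor ::
    "('r, 's) ring_scheme \<Rightarrow> ('r, 'a) module \<Rightarrow> ('r, 'b) module \<Rightarrow>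
     ('a \<times> 'b \<Rightarrow>\<^sub>0 int) set monoid" where
  "tensor R M N = free_Abelian_group (carrier M \<times> carrier N) Mod tensor_null R M N"

text \<open>The map \<open>f \<otimes> id : M \<otimes>\<^sub>R N \<rightarrow> M' \<otimes>\<^sub>R N\<close> induced by a linear map \<open>f : M \<rightarrow> M'\<close>.  The source
  module \<open>M\<close> is not an argument: a coset is mapped elementwise, and all its elements yield the same
  coset on the right.\<close>

definition tensor_map ::
    "('r, 's) ring_scheme \<Rightarrow> ('r, 'c) module \<Rightarrow> ('r, 'b) module \<Rightarrow> ('a \<Rightarrow> 'c) \<Rightarrow>
     ('a \<times> 'b \<Rightarrow>\<^sub>0 int) set \<Rightarrow> ('c \<times> 'b \<Rightarrow>\<^sub>0 int) set" where
  "tensor_map R M' N f C =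
     (\<Union>c\<in>C. tensor_null R M' N #>\<^bsub>free_Abelian_group (carrier M' \<times> carrier N)\<^esub>
        frag_extend (\<lambda>(x, y). frag_of (f x, y)) c)"

text \<open>Homology of \<open>\<dots> \<rightarrow> F 1 \<otimes>\<^sub>R N \<rightarrow> F 0 \<otimes>\<^sub>R N \<rightarrow> 0\<close>.\<close>

fun Tor_cycles ::
    "('r, 's) ring_scheme \<Rightarrow> (nat \<Rightarrow> ('r, 'f) module) \<Rightarrow> (nat \<Rightarrow> 'f \<Rightarrow> 'f) \<Rightarrow> ('r, 'b) module \<Rightarrow>
     nat \<Rightarrow> ('f \<times> 'b \<Rightarrow>\<^sub>0 int) set set" where
  "Tor_cycles R F d N 0 = carrier (tensor R (F 0) N)"
| "Tor_cycles R F d N (Suc n) =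
     kernel (tensor R (F (Suc n)) N) (tensor R (F n) N) (tensor_map R (F n) N (d n))"

definition Tor_boundaries ::
    "('r, 's) ring_scheme \<Rightarrow> (nat \<Rightarrow> ('r, 'f) module) \<Rightarrow> (nat \<Rightarrow> 'f \<Rightarrow> 'f) \<Rightarrow> ('r, 'b) module \<Rightarrow>
     nat \<Rightarrow> ('f \<times> 'b \<Rightarrow>\<^sub>0 int) set set" where
  "Tor_boundaries R F d N n =
     tensor_map R (F n) N (d n) ` carrier (tensor R (F (Suc n)) N)"

definition Tor_deg ::
    "('r, 's) ring_scheme \<Rightarrow> (nat \<Rightarrow> ('r, 'f) module) \<Rightarrow> (nat \<Rightarrow> 'f \<Rightarrow> 'f) \<Rightarrow> ('r, 'b) module \<Rightarrow>
     nat \<Rightarrow> ('f \<times> 'b \<Rightarrow>\<^sub>0 int) set set monoid" where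
  "Tor_deg R F d N n =
     (tensor R (F n) N)\<lparr>carrier := Tor_cycles R F d N n\<rparr> Mod Tor_boundaries R F d N n"

text \<open>If \<open>(F, d)\<close> is a free resolution of \<open>M\<close>, this is the underlying abelian group of the total
  Tor-module of \<open>(M, N)\<close>, the direct sum over all degrees.  Free resolutions of \<open>M\<close> cannot be chosen
  canonically within one type; as usual, Tor is computed from an arbitrary one, and statements about
  it are quantified over all free resolutions.\<close>

definition Tor ::
    "('r, 's) ring_scheme \<Rightarrow> (nat \<Rightarrow> ('r, 'f) module) \<Rightarrow> (nat \<Rightarrow> 'f \<Rightarrow> 'f) \<Rightarrow> ('r, 'b) module \<Rightarrow>
     (nat \<Rightarrow> ('f \<times> 'b \<Rightarrow>\<^sub>0 int) set set) monoid" where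
  "Tor R F d N = sum_group UNIV (Tor_deg R F d N)"

definition torsion_free :: "('a, 'b) monoid_scheme \<Rightarrow> bool" where
  "torsion_free G \<longleftrightarrow>
     (\<forall>x\<in>carrier G. \<forall>k::nat. k > 0 \<longrightarrow> x [^]\<^bsub>G\<^esub> k = \<one>\<^bsub>G\<^esub> \<longrightarrow> x = \<one>\<^bsub>G\<^esub>)"


section \<open>Stanley--Reisner rings\<close>

text \<open>Integral polynomials in variables indexed by natural numbers: finitely supported maps from
  monomials (finitely supported exponent functions) to coefficients, with the convolution product.\<close>

type_synonym int_mpoly = "(nat \<Rightarrow>\<^sub>0 nat) \<Rightarrow>\<^sub>0 int"

definition pvar :: "nat \<Rightarrow> int_mpoly" where
  "pvar i = Poly_Mapping.single (Poly_Mapping.single i 1) 1"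

definition Zpoly :: "nat \<Rightarrow> int_mpoly ring" where
  "Zpoly m = \<lparr>carrier = {p. \<forall>t\<in>Poly_Mapping.keys p. Poly_Mapping.keys t \<subseteq> {1..m}},
     monoid.mult = (*), one = 1, ring.zero = 0, ring.add = (+)\<rparr>"

definition SR_ideal :: "nat \<Rightarrow> nat set set \<Rightarrow> int_mpoly set" where
  "SR_ideal m K = Idl\<^bsub>Zpoly m\<^esub> {\<Prod>i\<in>I. pvar i | I. I \<subseteq> {1..m} \<and> I \<notin> K}"

definition SR_ring :: "nat \<Rightarrow> nat set set \<Rightarrow> int_mpoly set ring" where
  "SR_ring m K = Zpoly m Quot SR_ideal m K"

definition SR_module :: "nat \<Rightarrow> nat set set \<Rightarrow> (int_mpoly, int_mpoly set) module" where
  "SR_module m K = restrict_scalars (SR_ring m K) (\<lambda>p. SR_ideal m K +>\<^bsub>Zpoly m\<^esub> p)"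

text \<open>A polynomial acts on \<open>\<int>\<close> through its constant term, so every variable acts by \<open>0\<close>.\<close>

definition Z_module :: "(int_mpoly, int) module" where
  "Z_module = restrict_scalars int_ring (\<lambda>p. Poly_Mapping.lookup p 0)"

end

theory Submission
  imports Defs "HOL-Library.Function_Algebras"
begin

text \<open>
  Tor can be computed from the Koszul complex with coefficients in \<open>\<int>[K]\<close> instead of from the given
  resolution: dimension shifting along \<open>F\<close>, whose terms are Koszul acyclic, moves the torsion of the
  \<open>n\<close>-th homology of \<open>F \<otimes> \<int>\<close> into the \<open>n\<close>-th Koszul homology of \<open>\<int>[K]\<close>.  The Koszul complex of
  \<open>\<int>[K]\<close> splits into multigraded pieces, each of which is the reduced cochain complex of a matroid.
  By deletion and contraction such a complex is exact below the top degree and its top cohomology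
  is torsion-free: if the vertex \<open>v\<close> is a coloop, the complex is a cone, and otherwise the deletion
  has one rank more than the link of \<open>v\<close>, so that the long exact sequence only involves extensions
  of torsion-free groups.
\<close>

section \<open>Koszul complexes of matroids\<close>

text \<open>Torsion-freeness is handled elementwise throughout: a chain is a boundary as soon as a
  nonzero multiple of it is one. In this form it passes from module to module without homology
  groups and without a comparison isomorphism between two computations of Tor. The obstacle is that
  the resolution is arbitrary and that its syzygies need not be free. The modules are therefore
  replaced by groups of integer functions on pairs of a basis element and a monomial, where free
  modules, syzygies and \<int>[K] share the single differential \<open>kos\<close>. Each syzygy
  costs one Koszul degree, so torsion-freeness of \<int>[K] is needed in all degrees at once.
  Multidegrees with exponents above 1 do not lead out of matroids: the variables concerned are
  contracted and put back as coloops.\<close>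

text \<open>The Koszul differential on chains \<open>\<Sum>\<^sub>I x I * u\<^sub>I\<close>, where \<open>u\<^sub>I\<close> is the exterior monomial on \<open>I\<close> and
  \<open>V v\<close> is multiplication by \<open>v\<close>.  The order of the list \<open>vs\<close> determines the signs.\<close>

fun kos :: "('v \<Rightarrow> 'a \<Rightarrow> 'a) \<Rightarrow> 'v list \<Rightarrow> ('v set \<Rightarrow> 'a) \<Rightarrow> 'v set \<Rightarrow> 'a::ab_group_add" where
  "kos V [] x I = 0"
| "kos V (v # vs) x I =
     (if v \<in> I then - kos V vs x I else kos V vs x I + V v (x (insert v I)))"

text \<open>Only the values on sets one element larger matter. Chains can therefore be arbitrary
  total functions, with all equations imposed on the sets of one cardinality only.\<close>

lemma kos_cong:
  assumes "\<And>i. i \<in> set vs \<Longrightarrow> i \<notin> I \<Longrightarrow> x (insert i I) = y (insert i I)"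
  shows "kos V vs x I = kos V vs y I"
  using assms by (induction vs) auto

lemma kos_insert:
  assumes "v \<notin> set vs"
  shows "kos V vs x (insert v I) = kos V vs (\<lambda>I. x (insert v I)) I"
  using assms by (induction vs) (auto simp: insert_commute)

text \<open>Commuting additive operators are all that a Koszul differential needs. The locale serves
  both the integral complexes, where every operator is the identity, and the modules, where the
  operators multiply by variables.\<close>

locale koszul =
  fixes V :: "'v \<Rightarrow> 'a::ab_group_add \<Rightarrow> 'a"
  assumes V_add: "V v (a + b) = V v a + V v b"
    and V_comm: "V u (V v a) = V v (V u a)"
begin

lemma V_0: "V v 0 = 0"
  using V_add[of v 0 0] by simp

lemma V_uminus: "V v (- a) = - V v a"
  using V_add[of v a "- a"] by (simp add: V_0 eq_neg_iff_add_eq_0 add.commute)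

lemma kos_add: "kos V vs (\<lambda>I. x I + y I) I = kos V vs x I + kos V vs y I"
  by (induction vs) (auto simp: V_add algebra_simps)

lemma kos_uminus: "kos V vs (\<lambda>I. - x I) I = - kos V vs x I"
  by (induction vs) (auto simp: V_uminus)

lemma kos_diff: "kos V vs (\<lambda>I. x I - y I) I = kos V vs x I - kos V vs y I"
  using kos_add[of vs x "\<lambda>I. - y I" I] by (simp add: kos_uminus)

lemma kos_0: "kos V vs (\<lambda>I. 0) I = 0"
  by (induction vs) (auto simp: V_0)

lemma kos_V: "kos V vs (\<lambda>I. V v (x I)) I = V v (kos V vs x I)"
  by (induction vs) (auto simp: V_uminus V_add V_comm V_0)

lemma kos_kos:
  assumes "distinct vs"
  shows "kos V vs (kos V vs x) I = 0"
  using assms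
proof (induction vs arbitrary: x I)
  case (Cons v vs)
  have v: "v \<notin> set vs" and IH: "\<And>x I. kos V vs (kos V vs x) I = 0"
    using Cons by auto
  show ?case
  proof (cases "v \<in> I")
    case True
    then obtain I0 where I: "I = insert v I0" by blast
    have "kos V vs (kos V (v # vs) x) I = kos V vs (\<lambda>I. - kos V vs (\<lambda>I. x (insert v I)) I) I0"
      unfolding I by (simp add: kos_insert[OF v])
    then show ?thesis
      using True by (subst kos.simps(2)) (simp add: kos_uminus IH del: kos.simps)
  next
    case False
    \<comment> \<open>\<open>vs\<close> never inserts \<open>v\<close>, so only the branch for sets
      without \<open>v\<close> is seen. Its first summand dies by induction; the remaining
      multiplication by \<open>v\<close> cancels against the signed term of the outer
      differential.\<close>
    have "kos V vs (kos V (v # vs) x) I =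
        kos V vs (\<lambda>I. kos V vs x I + V v (x (insert v I))) I"
      by (rule kos_cong) (use False v in auto)
    also have "\<dots> = V v (kos V vs (\<lambda>I. x (insert v I)) I)"
      by (simp add: kos_add IH kos_V)
    finally show ?thesis
      using False by (subst kos.simps(2)) (simp add: kos_insert[OF v] V_uminus)
  qed
qed simp

end

section \<open>Extension, deletion, link and corank in matroids\<close>

lemma matroid_extend:
  assumes "matroid V K" "\<sigma> \<in> K" "\<tau> \<in> K"
  obtains \<rho> where "\<rho> \<in> K" "\<sigma> \<subseteq> \<rho>" "card \<tau> \<le> card \<rho>"
proof -
  have fin: "finite K"
    using assms(1) by (meson finite_Pow_iff finite_subset matroid_def simplicial_complex_def)
  define S where "S = {\<rho> \<in> K. \<sigma> \<subseteq> \<rho>}"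
  have "finite (card ` S)" "card ` S \<noteq> {}"
    using fin assms(2) by (auto simp: S_def)
  then have "Max (card ` S) \<in> card ` S" by (rule Max_in)
  then obtain \<rho> where \<rho>: "\<rho> \<in> S" "card \<rho> = Max (card ` S)" by auto
  have "card \<tau> \<le> card \<rho>"
  proof (rule ccontr)
    assume "\<not> card \<tau> \<le> card \<rho>"
    then obtain v where v: "v \<in> \<tau> - \<rho>" "\<rho> \<union> {v} \<in> K"
      using assms \<rho>(1) unfolding matroid_def S_def by (metis (lifting) mem_Collect_eq not_le)
    then have "\<rho> \<union> {v} \<in> S" using \<rho>(1) by (auto simp: S_def)
    then have "card (\<rho> \<union> {v}) \<le> card \<rho>"
      using \<open>finite (card ` S)\<close> \<rho>(2) by simp
    moreover have "finite \<rho>"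
      using \<rho>(1) assms(1) by (auto simp: S_def matroid_def simplicial_complex_def intro: finite_subset)
    ultimately show False using v(1) by simp
  qed
  with \<rho>(1) that show ?thesis by (auto simp: S_def)
qed

text \<open>The least size of the complement of a simplex, hence the lowest Koszul degree in which
  the complex of \<open>K\<close> is nonzero. The additive form avoids truncated
  subtraction.\<close>

definition corank :: "'v set \<Rightarrow> 'v set set \<Rightarrow> nat \<Rightarrow> bool" where
  "corank V K c \<longleftrightarrow> (\<exists>\<sigma>\<in>K. card \<sigma> + c = card V) \<and> (\<forall>\<sigma>\<in>K. card \<sigma> + c \<le> card V)"

lemma corank_exists:
  assumes "simplicial_complex V K"
  obtains c where "corank V K c"
proof -
  have fin: "finite V" "finite K" "K \<noteq> {}" "K \<subseteq> Pow V"
    using assms by (auto simp: simplicial_complex_def intro: finite_subset)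
  then have "Max (card ` K) \<in> card ` K" by (intro Max_in) auto
  then obtain \<sigma> where \<sigma>: "\<sigma> \<in> K" "card \<sigma> = Max (card ` K)" by auto
  have le: "card \<tau> \<le> card \<sigma>" if "\<tau> \<in> K" for \<tau>
    using that fin \<sigma>(2) by simp
  have "card \<sigma> \<le> card V"
    using \<sigma>(1) fin by (intro card_mono) auto
  moreover have "card \<tau> + (card V - card \<sigma>) \<le> card V" if "\<tau> \<in> K" for \<tau>
    using le[OF that] \<open>card \<sigma> \<le> card V\<close> by linarith
  ultimately have "corank V K (card V - card \<sigma>)"
    unfolding corank_def using \<sigma>(1) by (intro conjI bexI[of _ \<sigma>] ballI) auto
  then show ?thesis by (rule that)
qed

definition deletion :: "'v \<Rightarrow> 'v set set \<Rightarrow> 'v set set" where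
  "deletion v K = {\<sigma> \<in> K. v \<notin> \<sigma>}"

text \<open>For a ghost vertex \<open>v\<close> this is the empty family, which lacks even the empty
  simplex and is no simplicial complex; hence the premise \<open>{v} \<in> K\<close> in the lemmas
  on links of matroids.\<close>

definition link :: "'v \<Rightarrow> 'v set set \<Rightarrow> 'v set set" where
  "link v K = {\<sigma>. v \<notin> \<sigma> \<and> insert v \<sigma> \<in> K}"

lemma matroid_deletion:
  assumes "matroid V K"
  shows "matroid (V - {v}) (deletion v K)"
  unfolding matroid_def
proof (intro conjI ballI impI)
  show "simplicial_complex (V - {v}) (deletion v K)"
    using assms unfolding matroid_def simplicial_complex_def deletion_def by blast
  fix \<sigma> \<tau> assume *: "\<sigma> \<in> deletion v K" "\<tau> \<in> deletion v K" "card \<tau> < card \<sigma>"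
  then obtain u where "u \<in> \<sigma> - \<tau>" "\<tau> \<union> {u} \<in> K"
    using assms unfolding matroid_def deletion_def by blast
  then show "\<exists>u\<in>\<sigma> - \<tau>. \<tau> \<union> {u} \<in> deletion v K"
    using * by (auto simp: deletion_def)
qed

lemma link_subset_deletion:
  assumes "simplicial_complex V K"
  shows "link v K \<subseteq> deletion v K"
  using assms by (auto simp: simplicial_complex_def link_def deletion_def)

lemma matroid_link:
  assumes "matroid V K" "{v} \<in> K"
  shows "matroid (V - {v}) (link v K)"
  unfolding matroid_def
proof (intro conjI ballI impI)
  have sc: "simplicial_complex V K" using assms by (simp add: matroid_def)
  show "simplicial_complex (V - {v}) (link v K)"
    unfolding simplicial_complex_def
  proof (intro conjI ballI allI impI)
    show "finite (V - {v})" "{} \<in> link v K" "link v K \<subseteq> Pow (V - {v})"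
      using sc assms(2) by (auto simp: simplicial_complex_def link_def)
    fix \<sigma> \<tau> assume "\<sigma> \<in> link v K" "\<tau> \<subseteq> \<sigma>"
    then show "\<tau> \<in> link v K"
      using sc unfolding simplicial_complex_def link_def
      by (metis (lifting) insert_mono mem_Collect_eq subsetD)
  qed
  fix \<sigma> \<tau> assume *: "\<sigma> \<in> link v K" "\<tau> \<in> link v K" "card \<tau> < card \<sigma>"
  have "finite \<sigma>" "finite \<tau>"
    using * sc by (auto simp: simplicial_complex_def link_def intro: finite_subset)
  then have "card (insert v \<tau>) < card (insert v \<sigma>)"
    using * by (simp add: link_def)
  then obtain u where "u \<in> insert v \<sigma> - insert v \<tau>" "insert v \<tau> \<union> {u} \<in> K"
    using assms(1) * unfolding matroid_def link_def by (metis (no_types, lifting) mem_Collect_eq)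
  then show "\<exists>u\<in>\<sigma> - \<tau>. \<tau> \<union> {u} \<in> link v K"
    using * by (intro bexI[of _ u]) (auto simp: link_def insert_commute)
qed

text \<open>A simplex of the deletion that does not extend by \<open>v\<close> can be enlarged to
  the size of any simplex through \<open>v\<close>, and the result still avoids \<open>v\<close>; so
  the deletion has at least one rank more than the link. Conversely, a largest simplex of the
  deletion is matched in size by one through \<open>v\<close>, whose remaining vertices lie in the
  link.\<close>

lemma corank_link_deletion:
  assumes "matroid V K" "{v} \<in> K" "link v K \<noteq> deletion v K"
    "corank (V - {v}) (link v K) c" "corank (V - {v}) (deletion v K) c'"
  shows "c = Suc c'"
proof -
  have sc: "simplicial_complex V K" using assms by (simp add: matroid_def)
  then have fin: "\<And>\<sigma>. \<sigma> \<in> K \<Longrightarrow> finite \<sigma>" and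
    down: "\<And>\<sigma> \<tau>. \<sigma> \<in> K \<Longrightarrow> \<tau> \<subseteq> \<sigma> \<Longrightarrow> \<tau> \<in> K"
    by (auto simp: simplicial_complex_def intro: finite_subset)
  obtain \<tau> where \<tau>: "\<tau> \<in> link v K" "card \<tau> + c = card (V - {v})"
    using assms(4) by (auto simp: corank_def)
  obtain \<rho> where \<rho>: "\<rho> \<in> deletion v K" "card \<rho> + c' = card (V - {v})"
    using assms(5) by (auto simp: corank_def)
  obtain \<sigma> where \<sigma>: "\<sigma> \<in> K" "v \<notin> \<sigma>" "insert v \<sigma> \<notin> K"
    using assms(3) link_subset_deletion[OF sc, of v] by (auto simp: link_def deletion_def)
  obtain \<sigma>' where \<sigma>': "\<sigma>' \<in> K" "\<sigma> \<subseteq> \<sigma>'" "card (insert v \<tau>) \<le> card \<sigma>'"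
    using matroid_extend[OF assms(1) \<sigma>(1), of "insert v \<tau>"] \<tau>(1) by (auto simp: link_def)
  have "v \<notin> \<sigma>'"
    using \<sigma> \<sigma>' down by (metis insert_subset)
  then have "card \<sigma>' + c' \<le> card (V - {v})"
    using \<sigma>'(1) assms(5) by (auto simp: corank_def deletion_def)
  moreover have "Suc (card \<tau>) \<le> card \<sigma>'"
    using \<sigma>'(3) \<tau>(1) fin[of "insert v \<tau>"] by (simp add: link_def)
  moreover obtain \<rho>' where \<rho>': "\<rho>' \<in> K" "{v} \<subseteq> \<rho>'" "card \<rho> \<le> card \<rho>'"
    using matroid_extend[OF assms(1,2), of \<rho>] \<rho>(1) by (auto simp: deletion_def)
  then have "\<rho>' - {v} \<in> link v K"
    by (simp add: link_def insert_absorb)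
  then have "card (\<rho>' - {v}) + c \<le> card (V - {v})"
    using assms(4) by (auto simp: corank_def)
  moreover have "card \<rho>' = Suc (card (\<rho>' - {v}))"
    using \<rho>' card_Suc_Diff1[OF fin[OF \<rho>'(1)]] by simp
  ultimately show ?thesis using \<tau> \<rho> \<rho>'(3) by linarith
qed

section \<open>Integral Koszul complexes: exactness and purity\<close>

abbreviation kosZ :: "'v list \<Rightarrow> ('v set \<Rightarrow> int) \<Rightarrow> 'v set \<Rightarrow> int" where
  "kosZ \<equiv> kos (\<lambda>v z. z)"

interpretation kosZ: koszul "\<lambda>v z. z :: int"
  by standard auto

lemma kosZ_mult: "kosZ vs (\<lambda>I. k * x I) I = k * kosZ vs x I"
  by (induction vs) (auto simp: distrib_left)

text \<open>The exterior monomial on \<open>I\<close> stands for the simplex \<open>V - I\<close>, which turns the Koszul differential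
  into the simplicial coboundary of \<open>K\<close>.\<close>

definition cofaces :: "'v set \<Rightarrow> 'v set set \<Rightarrow> nat \<Rightarrow> 'v set set" where
  "cofaces V K j = {I. I \<subseteq> V \<and> V - I \<in> K \<and> card I = j}"

text \<open>The simplex is the complement of the set: a set without \<open>v\<close> stands for a
  simplex through \<open>v\<close>, hence for one of the link; a set with \<open>v\<close> stands
  for one of the deletion and loses an element when \<open>v\<close> is dropped. This shift by one
  matches the difference of the coranks.\<close>

lemma cofaces_Cons:
  assumes "v \<notin> set vs" "v \<notin> I"
  shows "insert v I \<in> cofaces (set (v # vs)) K (Suc j) \<longleftrightarrow> I \<in> cofaces (set vs) (deletion v K) j"
    and "I \<in> cofaces (set (v # vs)) K j \<longleftrightarrow> I \<in> cofaces (set vs) (link v K) j"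
proof -
  have eq: "set (v # vs) - insert v I = set vs - I" "set (v # vs) - I = insert v (set vs - I)"
    using assms by auto
  have fin: "I \<subseteq> set vs \<Longrightarrow> finite I"
    by (rule finite_subset) auto
  have s: "insert v I \<subseteq> set (v # vs) \<longleftrightarrow> I \<subseteq> set vs" "I \<subseteq> set (v # vs) \<longleftrightarrow> I \<subseteq> set vs"
    using assms by auto
  show "insert v I \<in> cofaces (set (v # vs)) K (Suc j) \<longleftrightarrow> I \<in> cofaces (set vs) (deletion v K) j"
    unfolding cofaces_def mem_Collect_eq eq s deletion_def using assms fin by auto
  show "I \<in> cofaces (set (v # vs)) K j \<longleftrightarrow> I \<in> cofaces (set vs) (link v K) j"
    unfolding cofaces_def mem_Collect_eq eq s link_def using assms by auto
qed

text \<open>Exactness at degree \<open>Suc j\<close>; the index names the degree in which the cycle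
  condition is tested.\<close>

definition kos_exact :: "'v list \<Rightarrow> 'v set set \<Rightarrow> nat \<Rightarrow> bool" where
  "kos_exact vs K j \<longleftrightarrow> (\<forall>x. (\<forall>I\<in>cofaces (set vs) K j. kosZ vs x I = 0) \<longrightarrow>
     (\<exists>y. \<forall>I\<in>cofaces (set vs) K (Suc j). x I = kosZ vs y I))"

text \<open>Torsion-freeness of the chains modulo the boundaries. All chains are allowed, not only
  cycles: in a simplicial complex, a chain with a nonzero multiple that is a boundary is a cycle
  anyway, because the integers have no torsion.\<close>

definition kos_pure :: "'v list \<Rightarrow> 'v set set \<Rightarrow> nat \<Rightarrow> bool" where
  "kos_pure vs K j \<longleftrightarrow> (\<forall>k x y. k \<noteq> 0 \<longrightarrow>
     (\<forall>I\<in>cofaces (set vs) K j. k * x I = kosZ vs y I) \<longrightarrow>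
     (\<exists>y. \<forall>I\<in>cofaces (set vs) K j. x I = kosZ vs y I))"


lemma kos_exactD:
  assumes "kos_exact vs K j" "\<And>I. I \<in> cofaces (set vs) K j \<Longrightarrow> kosZ vs x I = 0"
  shows "\<exists>y. \<forall>I\<in>cofaces (set vs) K (Suc j). x I = kosZ vs y I"
  using assms(1)[unfolded kos_exact_def, rule_format, of x] assms(2) by simp

lemma kos_pureD:
  assumes "kos_pure vs K j" "k \<noteq> 0"
    and "\<And>I. I \<in> cofaces (set vs) K j \<Longrightarrow> k * x I = kosZ vs y I"
  shows "\<exists>y. \<forall>I\<in>cofaces (set vs) K j. x I = kosZ vs y I"
  using assms(1)[unfolded kos_pure_def, rule_format, OF assms(2), of x y] assms(3) by simp

text \<open>By the exchange property \<open>v\<close> lies in a largest simplex; taking it away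
  lowers both the rank and the number of vertices by one.\<close>

lemma corank_link:
  assumes "matroid V K" "{v} \<in> K" "corank V K c"
  shows "corank (V - {v}) (link v K) c"
proof -
  have sc: "finite V" "\<And>\<sigma>. \<sigma> \<in> K \<Longrightarrow> \<sigma> \<subseteq> V"
    using assms by (auto simp: matroid_def simplicial_complex_def)
  then have fin: "\<And>\<sigma>. \<sigma> \<in> K \<Longrightarrow> finite \<sigma>"
    by (meson finite_subset)
  have v: "v \<in> V"
    using sc(2) assms(2) by blast
  have V: "card V = Suc (card (V - {v}))"
    using card_Suc_Diff1[OF sc(1) v] by simp
  obtain \<sigma> where \<sigma>: "\<sigma> \<in> K" "card \<sigma> + c = card V"
    using assms(3) by (auto simp: corank_def)
  obtain \<rho> where \<rho>: "\<rho> \<in> K" "{v} \<subseteq> \<rho>" "card \<sigma> \<le> card \<rho>"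
    using matroid_extend[OF assms(1,2) \<sigma>(1)] by auto
  have "card \<rho> + c = card V"
    using \<rho> \<sigma> assms(3) unfolding corank_def by (metis add_le_mono1 le_antisym)
  moreover have "card \<rho> = Suc (card (\<rho> - {v}))"
    using \<rho> card_Suc_Diff1[OF fin[OF \<rho>(1)]] by simp
  moreover have "\<rho> - {v} \<in> link v K"
    using \<rho> by (simp add: link_def insert_absorb)
  moreover have "card \<tau> + c \<le> card (V - {v})" if "\<tau> \<in> link v K" for \<tau>
  proof -
    have "card (insert v \<tau>) + c \<le> card V" "finite \<tau>" "v \<notin> \<tau>"
      using that assms(3) fin[of "insert v \<tau>"] by (auto simp: corank_def link_def)
    then show ?thesis using V by simp
  qed
  ultimately show ?thesis
    using V unfolding corank_def by (intro conjI bexI[of _ "\<rho> - {v}"] ballI) auto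
qed

lemma cofaces_insert:
  assumes "simplicial_complex V K" "I \<in> cofaces V K j" "i \<in> V" "i \<notin> I"
  shows "insert i I \<in> cofaces V K (Suc j)"
proof -
  have "finite I" using assms by (auto simp: cofaces_def simplicial_complex_def intro: finite_subset)
  moreover have "V - insert i I \<subseteq> V - I" by auto
  ultimately show ?thesis
    using assms unfolding cofaces_def simplicial_complex_def by (auto simp del: Diff_insert)
qed

text \<open>If a nonzero multiple of a chain is a boundary, a nonzero integer kills the differential
  of the chain. So the chain is a cycle, and exactness applies.\<close>

lemma kos_pure_Suc:
  assumes "distinct vs" "simplicial_complex (set vs) K" "kos_exact vs K j"
  shows "kos_pure vs K (Suc j)"
  unfolding kos_pure_def
proof (intro allI impI)
  fix k :: int and x y
  assume k: "k \<noteq> 0" and eq: "\<forall>I\<in>cofaces (set vs) K (Suc j). k * x I = kosZ vs y I"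
  have "kosZ vs x I = 0" if I: "I \<in> cofaces (set vs) K j" for I
  proof -
    have "k * kosZ vs x I = kosZ vs (kosZ vs y) I"
      unfolding kosZ_mult[symmetric]
      by (rule kos_cong) (use eq cofaces_insert[OF assms(2) I] in auto)
    then have "k * kosZ vs x I = 0" unfolding kosZ.kos_kos[OF assms(1)] .
    then show ?thesis using k by simp
  qed
  then show "\<exists>y. \<forall>I\<in>cofaces (set vs) K (Suc j). x I = kosZ vs y I"
    using assms(3) by (simp add: kos_exact_def)
qed

lemma kosZ_Cons:
  assumes "v \<notin> set vs" "v \<notin> I"
  shows "kosZ (v # vs) x I = kosZ vs x I + x (insert v I)"
    and "kosZ (v # vs) x (insert v I) = - kosZ vs (\<lambda>I. x (insert v I)) I"
  using assms by (auto simp: kos_insert)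

definition glue :: "'v \<Rightarrow> ('v set \<Rightarrow> 'a) \<Rightarrow> ('v set \<Rightarrow> 'a) \<Rightarrow> 'v set \<Rightarrow> 'a" where
  "glue v x\<^sub>0 x\<^sub>1 I = (if v \<in> I then x\<^sub>1 (I - {v}) else x\<^sub>0 I)"

lemma kosZ_glue:
  assumes "v \<notin> set vs" "v \<notin> I"
  shows "kosZ (v # vs) (glue v x\<^sub>0 x\<^sub>1) I = kosZ vs x\<^sub>0 I + x\<^sub>1 I"
    and "kosZ (v # vs) (glue v x\<^sub>0 x\<^sub>1) (insert v I) = - kosZ vs x\<^sub>1 I"
proof -
  have "kosZ vs (glue v x\<^sub>0 x\<^sub>1) I = kosZ vs x\<^sub>0 I"
    "kosZ vs (\<lambda>I. glue v x\<^sub>0 x\<^sub>1 (insert v I)) I = kosZ vs x\<^sub>1 I"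
    by (intro kos_cong; use assms in \<open>auto simp: glue_def intro!: arg_cong[of _ _ x\<^sub>1]\<close>)+
  then show "kosZ (v # vs) (glue v x\<^sub>0 x\<^sub>1) I = kosZ vs x\<^sub>0 I + x\<^sub>1 I"
    "kosZ (v # vs) (glue v x\<^sub>0 x\<^sub>1) (insert v I) = - kosZ vs x\<^sub>1 I"
    using assms unfolding kosZ_Cons[OF assms] by (auto simp: glue_def)
qed

lemma cofaces_Cons_cases:
  assumes "v \<notin> set vs" "I \<in> cofaces (set (v # vs)) K j"
  obtains (link) "v \<notin> I" "I \<in> cofaces (set vs) (link v K) j"
  | (deletion) I' j' where "v \<notin> I'" "I = insert v I'" "j = Suc j'"
      "I' \<in> cofaces (set vs) (deletion v K) j'"
proof (cases "v \<in> I")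
  case True
  have "finite I"
    using assms(2) by (auto simp: cofaces_def intro: finite_subset)
  then have "j = Suc (card (I - {v}))"
    using card_Suc_Diff1[OF _ True] assms(2) by (simp add: cofaces_def)
  moreover have "I = insert v (I - {v})"
    using True by auto
  ultimately show ?thesis
    using cofaces_Cons(1)[OF assms(1), of "I - {v}"] assms(2) deletion by (metis Diff_iff singletonI)
qed (use cofaces_Cons(2)[OF assms(1)] assms(2) link in blast)

text \<open>The complex of \<open>K\<close> is the mapping cone of the restriction from the deletion
  to the link. Write a cycle as a pair \<open>(x\<^sub>0, x\<^sub>1)\<close> of its parts without
  and with \<open>v\<close>, with differential
  \<open>(d x\<^sub>0 + x\<^sub>1, - d x\<^sub>1)\<close>. If \<open>x\<^sub>1 = d z\<close>, then
  \<open>x\<^sub>0 + z\<close> is a cycle of the link, and if that is \<open>d w\<close>, the pair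
  is the boundary of \<open>(w, - z)\<close>.\<close>

lemma kos_exact_Cons:
  assumes v: "v \<notin> set vs" and LD: "link v K \<subseteq> deletion v K"
    and ex: "kos_exact vs (link v K) (Suc j)" "kos_exact vs (deletion v K) j"
  shows "kos_exact (v # vs) K (Suc j)"
  unfolding kos_exact_def
proof (intro allI impI)
  fix x assume x: "\<forall>I\<in>cofaces (set (v # vs)) K (Suc j). kosZ (v # vs) x I = 0"
  let ?x\<^sub>1 = "\<lambda>I. x (insert v I)"
  have nv: "v \<notin> I" if "I \<in> cofaces (set vs) L j" for I L j
    using that v by (auto simp: cofaces_def)
  have "kosZ vs ?x\<^sub>1 I = 0" if I: "I \<in> cofaces (set vs) (deletion v K) j" for I
  proof -
    have "kosZ (v # vs) x (insert v I) = 0"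
      using x I cofaces_Cons(1)[OF v nv[OF I]] by blast
    then show ?thesis unfolding kosZ_Cons(2)[OF v nv[OF I]] by simp
  qed
  then have "\<exists>z. \<forall>I\<in>cofaces (set vs) (deletion v K) (Suc j). ?x\<^sub>1 I = kosZ vs z I"
    by (rule kos_exactD[OF ex(2)])
  then obtain z where z: "\<And>I. I \<in> cofaces (set vs) (deletion v K) (Suc j) \<Longrightarrow> ?x\<^sub>1 I = kosZ vs z I"
    by blast
  have "kosZ vs (\<lambda>I. x I + z I) I = 0" if I: "I \<in> cofaces (set vs) (link v K) (Suc j)" for I
  proof -
    have "kosZ (v # vs) x I = 0"
      using x I cofaces_Cons(2)[OF v nv[OF I]] by blast
    moreover have "?x\<^sub>1 I = kosZ vs z I"
      by (rule z) (use I LD in \<open>auto simp: cofaces_def\<close>)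
    ultimately show ?thesis
      unfolding kosZ_Cons(1)[OF v nv[OF I]] kosZ.kos_add by simp
  qed
  then have "\<exists>w. \<forall>I\<in>cofaces (set vs) (link v K) (Suc (Suc j)). x I + z I = kosZ vs w I"
    by (rule kos_exactD[OF ex(1)])
  then obtain w where w: "\<And>I. I \<in> cofaces (set vs) (link v K) (Suc (Suc j)) \<Longrightarrow> x I + z I = kosZ vs w I"
    by blast
  have "x I = kosZ (v # vs) (glue v w (\<lambda>I. - z I)) I"
    if "I \<in> cofaces (set (v # vs)) K (Suc (Suc j))" for I
    using v that
  proof (cases rule: cofaces_Cons_cases)
    case link
    show ?thesis using w[OF link(2)] unfolding kosZ_glue(1)[OF v link(1)] by linarith
  next
    case (deletion I' j')
    have "x I = kosZ vs z I'" using z deletion by simp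
    then show ?thesis
      unfolding deletion(2) kosZ_glue(2)[OF v deletion(1)] kosZ.kos_uminus by simp
  qed
  then show "\<exists>y. \<forall>I\<in>cofaces (set (v # vs)) K (Suc (Suc j)). x I = kosZ (v # vs) y I"
    by blast
qed

text \<open>The same mapping cone argument, now without a cycle condition. Purity of the deletion
  gives \<open>x\<^sub>1 = d z\<close>, which makes \<open>y\<^sub>1 + k * z\<close> a cycle of the
  deletion. Exactness there writes it as \<open>d u\<close>, and on the link
  \<open>k * (x\<^sub>0 + z) = d (y\<^sub>0 + u)\<close>, so that purity of the link
  finishes.\<close>

lemma kos_pure_Cons:
  assumes v: "v \<notin> set vs" and LD: "link v K \<subseteq> deletion v K"
    and pure: "kos_pure vs (link v K) (Suc j)" "kos_pure vs (deletion v K) j"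
    and ex: "kos_exact vs (deletion v K) j"
  shows "kos_pure (v # vs) K (Suc j)"
  unfolding kos_pure_def
proof (intro allI impI)
  fix k :: int and x y
  assume k: "k \<noteq> 0"
    and eq: "\<forall>I\<in>cofaces (set (v # vs)) K (Suc j). k * x I = kosZ (v # vs) y I"
  let ?x\<^sub>1 = "\<lambda>I. x (insert v I)" and ?y\<^sub>1 = "\<lambda>I. y (insert v I)"
  have nv: "v \<notin> I" if "I \<in> cofaces (set vs) L j" for I L j
    using that v by (auto simp: cofaces_def)
  have x\<^sub>1: "k * ?x\<^sub>1 I = kosZ vs (\<lambda>I. - ?y\<^sub>1 I) I" if I: "I \<in> cofaces (set vs) (deletion v K) j" for I
  proof -
    have "k * ?x\<^sub>1 I = kosZ (v # vs) y (insert v I)"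
      using eq I cofaces_Cons(1)[OF v nv[OF I]] by blast
    then show ?thesis unfolding kosZ_Cons(2)[OF v nv[OF I]] kosZ.kos_uminus .
  qed
  then have "\<exists>z. \<forall>I\<in>cofaces (set vs) (deletion v K) j. ?x\<^sub>1 I = kosZ vs z I"
    by (rule kos_pureD[OF pure(2) k])
  then obtain z where z: "\<And>I. I \<in> cofaces (set vs) (deletion v K) j \<Longrightarrow> ?x\<^sub>1 I = kosZ vs z I"
    by blast
  have "kosZ vs (\<lambda>I. ?y\<^sub>1 I + k * z I) I = 0" if "I \<in> cofaces (set vs) (deletion v K) j" for I
    using x\<^sub>1[OF that] z[OF that] unfolding kosZ.kos_add kosZ_mult kosZ.kos_uminus by simp
  then obtain u where u:
    "\<And>I. I \<in> cofaces (set vs) (deletion v K) (Suc j) \<Longrightarrow> ?y\<^sub>1 I + k * z I = kosZ vs u I"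
    using kos_exactD[OF ex] by (metis (no_types, lifting))
  have "k * (x I + z I) = kosZ vs (\<lambda>I. y I + u I) I"
    if I: "I \<in> cofaces (set vs) (link v K) (Suc j)" for I
  proof -
    have "k * x I = kosZ (v # vs) y I"
      using eq I cofaces_Cons(2)[OF v nv[OF I]] by blast
    moreover have "?y\<^sub>1 I + k * z I = kosZ vs u I"
      by (rule u) (use I LD in \<open>auto simp: cofaces_def\<close>)
    ultimately show ?thesis
      unfolding kosZ_Cons(1)[OF v nv[OF I]] kosZ.kos_add by (simp add: algebra_simps)
  qed
  then have "\<exists>w. \<forall>I\<in>cofaces (set vs) (link v K) (Suc j). x I + z I = kosZ vs w I"
    by (rule kos_pureD[OF pure(1) k])
  then obtain w where w: "\<And>I. I \<in> cofaces (set vs) (link v K) (Suc j) \<Longrightarrow> x I + z I = kosZ vs w I"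
    by blast
  have "x I = kosZ (v # vs) (glue v w (\<lambda>I. - z I)) I"
    if "I \<in> cofaces (set (v # vs)) K (Suc j)" for I
    using v that
  proof (cases rule: cofaces_Cons_cases)
    case link
    show ?thesis using w[OF link(2)] unfolding kosZ_glue(1)[OF v link(1)] by linarith
  next
    case (deletion I' j')
    have "x I = kosZ vs z I'" using z deletion by simp
    then show ?thesis
      unfolding deletion(2) kosZ_glue(2)[OF v deletion(1)] kosZ.kos_uminus by simp
  qed
  then show "\<exists>y. \<forall>I\<in>cofaces (set (v # vs)) K (Suc j). x I = kosZ (v # vs) y I"
    by blast
qed

text \<open>The coloop case. Moving the part without \<open>v\<close> to the sets with
  \<open>v\<close> contracts the complex: the cycle equation expresses the values on sets with
  \<open>v\<close> by the other ones, and it is available on all of them since the link is the whole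
  deletion.\<close>

lemma kos_exact_cone:
  assumes v: "v \<notin> set vs" and LD: "link v K = deletion v K"
  shows "kos_exact (v # vs) K j"
  unfolding kos_exact_def
proof (intro allI impI)
  fix x assume x: "\<forall>I\<in>cofaces (set (v # vs)) K j. kosZ (v # vs) x I = 0"
  have "x I = kosZ (v # vs) (glue v (\<lambda>I. 0) x) I"
    if "I \<in> cofaces (set (v # vs)) K (Suc j)" for I
    using v that
  proof (cases rule: cofaces_Cons_cases)
    case link
    show ?thesis unfolding kosZ_glue(1)[OF v link(1)] kosZ.kos_0 by simp
  next
    case (deletion I' j')
    have "I' \<in> cofaces (set vs) (link v K) j"
      using deletion LD by simp
    then have "kosZ (v # vs) x I' = 0"
      using x cofaces_Cons(2)[OF v deletion(1)] by blast
    then show ?thesis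
      unfolding deletion(2) kosZ_glue(2)[OF v deletion(1)] kosZ_Cons(1)[OF v deletion(1)] by linarith
  qed
  then show "\<exists>y. \<forall>I\<in>cofaces (set (v # vs)) K (Suc j). x I = kosZ (v # vs) y I"
    by blast
qed

lemma kos_pure_cone:
  assumes "distinct (v # vs)" "simplicial_complex (set (v # vs)) K" "link v K = deletion v K"
  shows "kos_pure (v # vs) K j"
proof (cases j)
  case 0
  have v: "v \<notin> set vs" using assms by simp
  \<comment> \<open>Degree 0 is out of reach of exactness. There no set contains \<open>v\<close>,
    and every chain is the boundary of its own shift to the sets with \<open>v\<close>.\<close>
  have "\<exists>y. \<forall>I\<in>cofaces (set (v # vs)) K j. x I = kosZ (v # vs) y I" for x
  proof (intro exI ballI)
    fix I assume "I \<in> cofaces (set (v # vs)) K j"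
    with v show "x I = kosZ (v # vs) (glue v (\<lambda>I. 0) x) I"
    proof (cases rule: cofaces_Cons_cases)
      case link
      show ?thesis unfolding kosZ_glue(1)[OF v link(1)] kosZ.kos_0 by simp
    qed (use 0 in simp)
  qed
  then show ?thesis by (simp add: kos_pure_def)
next
  case (Suc j')
  then show ?thesis
    using assms by (auto intro!: kos_pure_Suc kos_exact_cone simp del: set_simps)
qed

text \<open>Degrees above the corank are the dimensions below the top, and degree \<open>c\<close>
  carries the top cohomology. The two claims belong in one induction because purity in the lowest
  degree relies on exactness of the deletion.\<close>

lemma kos_matroid:
  assumes "distinct vs" "matroid (set vs) K" "corank (set vs) K c"
  shows "(\<forall>j\<ge>c. kos_exact vs K j) \<and> kos_pure vs K c"
  using assms
proof (induction vs arbitrary: K c)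
  case Nil
  then have "K = {{}}" by (auto simp: matroid_def simplicial_complex_def)
  then have "cofaces {} K (Suc j) = {}" for j
    by (auto simp: cofaces_def)
  then show ?case
    by (auto simp: kos_exact_def kos_pure_def)
next
  case (Cons v vs)
  let ?L = "link v K" and ?D = "deletion v K"
  have v: "v \<notin> set vs" and dist: "distinct vs" using Cons.prems by auto
  have sc: "simplicial_complex (set (v # vs)) K" using Cons.prems by (simp add: matroid_def)
  have vs: "set (v # vs) - {v} = set vs" using v by auto
  have D: "matroid (set vs) ?D"
    using matroid_deletion[OF Cons.prems(2), of v] vs by simp
  have LD: "?L \<subseteq> ?D" by (rule link_subset_deletion[OF sc])
  obtain c' where c': "corank (set vs) ?D c'"
    using corank_exists D by (metis matroid_def)
  have IH_D: "\<forall>j\<ge>c'. kos_exact vs ?D j" "kos_pure vs ?D c'"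
    using Cons.IH[OF dist D c'] by auto
  show ?case
  proof (cases "?L = ?D")
    case True
    then show ?thesis
      using kos_exact_cone[OF v True] kos_pure_cone[OF Cons.prems(1) sc True] by simp
  next
    case False
    have "(\<forall>j\<ge>c. kos_exact vs ?L j) \<and> kos_pure vs ?L c \<and> c = Suc c'"
    proof (cases "{v} \<in> K")
      case True
      have "corank (set vs) ?L c" "matroid (set vs) ?L"
        using corank_link[OF Cons.prems(2) True Cons.prems(3)] matroid_link[OF Cons.prems(2) True] vs
        by simp_all
      then show ?thesis
        using Cons.IH[OF dist] corank_link_deletion[OF Cons.prems(2) True False] c' vs by auto
    next
      case False
      \<comment> \<open>A ghost vertex: the link is empty and its claims hold vacuously, while
        \<open>c = Suc c'\<close> holds because the ground set loses an element and the simplices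
        stay the same.\<close>
      have nv: "v \<notin> \<sigma>" if "\<sigma> \<in> K" for \<sigma>
        using that False sc by (auto simp: simplicial_complex_def)
      then have L: "?L = {}" and "?D = K"
        by (auto simp: link_def deletion_def)
      obtain \<sigma> \<tau> where "\<sigma> \<in> K" "card \<sigma> + c = card (set (v # vs))"
        "\<tau> \<in> K" "card \<tau> + c' = card (set vs)"
        using c' Cons.prems(3) unfolding corank_def \<open>?D = K\<close> by blast
      moreover from this have "card \<tau> + c \<le> card (set (v # vs))" "card \<sigma> + c' \<le> card (set vs)"
        using c' Cons.prems(3) unfolding corank_def \<open>?D = K\<close> by blast+
      moreover have "card (set (v # vs)) = Suc (card (set vs))"
        using v by simp
      ultimately have "c = Suc c'"
        by linarith
      then show ?thesis
        by (simp add: L kos_exact_def kos_pure_def cofaces_def)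
    qed
    then have L: "\<forall>j\<ge>Suc c'. kos_exact vs ?L j" "kos_pure vs ?L (Suc c')" and c: "c = Suc c'"
      by auto
    have "kos_exact (v # vs) K j" if j: "j \<ge> Suc c'" for j
    proof -
      obtain i where "j = Suc i" "i \<ge> c'" using j Suc_le_D by fastforce
      then show ?thesis
        using kos_exact_Cons[OF v LD, of i] L(1) IH_D(1) by simp
    qed
    then show ?thesis
      using kos_pure_Cons[OF v LD L(2) IH_D(2)] IH_D(1) c by simp
  qed
qed

section \<open>Koszul complexes of Stanley--Reisner modules\<close>

lemma kos_pure_matroid:
  assumes "distinct vs" "matroid (set vs) K"
  shows "kos_pure vs K j"
proof -
  have sc: "simplicial_complex (set vs) K" using assms by (simp add: matroid_def)
  obtain c where c: "corank (set vs) K c" using corank_exists[OF sc] .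
  note H = kos_matroid[OF assms c]
  consider "j < c" | "j = c" | i where "j = Suc i" "c \<le> i"
    by (cases j) force+
  then show ?thesis
  proof cases
    case 1
    have "card (set vs - I) + card I = card (set vs)" if "I \<subseteq> set vs" for I
      using that by (simp add: card_Diff_subset card_mono finite_subset)
    then have le: "c \<le> card I" if "I \<subseteq> set vs" "set vs - I \<in> K" for I
      using that c unfolding corank_def by (metis add_le_cancel_left)
    have "I \<notin> cofaces (set vs) K j" for I
      using 1 le[of I] by (auto simp: cofaces_def)
    then have "cofaces (set vs) K j = {}"
      by blast
    then show ?thesis by (simp add: kos_pure_def)
  qed (use H kos_pure_Suc[OF assms(1) sc] in auto)
qed

text \<open>The full simplex is a matroid of corank 0. Multidegree by multidegree, this is the
  acyclicity of the Koszul complex of a polynomial ring in positive degrees.\<close>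

lemma kos_exact_Pow:
  assumes "distinct vs"
  shows "kos_exact vs (Pow (set vs)) j"
proof -
  have "card \<sigma> < card \<tau> \<Longrightarrow> \<exists>v\<in>\<tau> - \<sigma>. v \<in> set vs" if "\<sigma> \<subseteq> set vs" "\<tau> \<subseteq> set vs" for \<sigma> \<tau>
    using that by (metis Diff_iff card_mono finite_set finite_subset leD subsetD subsetI)
  then have "matroid (set vs) (Pow (set vs))"
    by (auto simp: matroid_def simplicial_complex_def)
  moreover have "corank (set vs) (Pow (set vs)) 0"
    by (auto simp: corank_def card_mono)
  ultimately show ?thesis
    using kos_matroid[OF assms] by blast
qed

section \<open>Koszul chains graded by multidegree\<close>

type_synonym monomial = "nat \<Rightarrow>\<^sub>0 nat"

abbreviation keys where "keys \<equiv> Poly_Mapping.keys"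
abbreviation lookup where "lookup \<equiv> Poly_Mapping.lookup"

definition sqfree_monomial :: "nat set \<Rightarrow> monomial" where
  "sqfree_monomial I = (\<Sum>i\<in>I. Poly_Mapping.single i 1)"

lemma lookup_sqfree_monomial:
  assumes "finite I"
  shows "lookup (sqfree_monomial I) i = (if i \<in> I then 1 else 0)"
  using assms unfolding sqfree_monomial_def
  by (induction I) (auto simp: lookup_add lookup_single when_def)

lemma keys_sqfree_monomial: "finite I \<Longrightarrow> keys (sqfree_monomial I) = I"
  by (intro Set.set_eqI) (simp add: in_keys_iff lookup_sqfree_monomial)

lemma keys_minus_subset: "keys (a - b :: monomial) \<subseteq> keys a"
  by (auto simp: in_keys_iff lookup_minus)

lemma keys_plus_monomial: "keys (a + b :: monomial) = keys a \<union> keys b"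
  by (auto simp: in_keys_iff lookup_add)

text \<open>The direct sum of copies of \<int>[K] indexed by \<open>B\<close>, in the \<int>-basis
  of monomials whose support is a simplex. With the full power set of the variables as
  \<open>K\<close>, this is a free module over the polynomial ring.\<close>

definition monfun :: "'b set \<Rightarrow> nat set set \<Rightarrow> ('b \<times> monomial \<Rightarrow> int) set" where
  "monfun B K = {f. finite {p. f p \<noteq> 0} \<and> (\<forall>b t. f (b, t) \<noteq> 0 \<longrightarrow> b \<in> B \<and> keys t \<in> K)}"

text \<open>Multiplication by a variable, read on coefficients. The test on \<open>keys t\<close>
  discards the products that fall into the Stanley--Reisner ideal; the test on \<open>i\<close>
  guards against the truncated subtraction of exponents.\<close>

definition mulvar :: "nat set set \<Rightarrow> nat \<Rightarrow> ('b \<times> monomial \<Rightarrow> int) \<Rightarrow> 'b \<times> monomial \<Rightarrow> int" where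
  "mulvar K i f = (\<lambda>(b, t). if i \<in> keys t \<and> keys t \<in> K then f (b, t - Poly_Mapping.single i 1) else 0)"

definition subset_closed :: "'v set set \<Rightarrow> bool" where
  "subset_closed K \<longleftrightarrow> (\<forall>\<sigma>\<in>K. \<forall>\<tau>\<subseteq>\<sigma>. \<tau> \<in> K)"

lemma subset_closedD: "subset_closed K \<Longrightarrow> \<sigma> \<in> K \<Longrightarrow> \<tau> \<subseteq> \<sigma> \<Longrightarrow> \<tau> \<in> K"
  by (auto simp: subset_closed_def)

lemma koszul_mulvar:
  assumes "subset_closed K"
  shows "koszul (mulvar K :: nat \<Rightarrow> ('b \<times> monomial \<Rightarrow> int) \<Rightarrow> _)"
proof
  fix u v and f g :: "'b \<times> monomial \<Rightarrow> int"
  show "mulvar K v (f + g) = mulvar K v f + mulvar K v g"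
    by (auto simp: mulvar_def fun_eq_iff)
  show "mulvar K u (mulvar K v f) = mulvar K v (mulvar K u f)"
  proof (cases "u = v")
    case False
    then have "u \<in> keys (t - Poly_Mapping.single v 1) \<longleftrightarrow> u \<in> keys t"
      "v \<in> keys (t - Poly_Mapping.single u 1) \<longleftrightarrow> v \<in> keys t" for t :: monomial
      by (auto simp: in_keys_iff lookup_minus lookup_single when_def)
    moreover have "t - Poly_Mapping.single u 1 - Poly_Mapping.single v 1 =
        t - Poly_Mapping.single v 1 - Poly_Mapping.single u 1" for t :: monomial
      by (intro poly_mapping_eqI) (simp add: lookup_minus)
    ultimately show ?thesis
      using subset_closedD[OF assms _ keys_minus_subset] by (auto simp: mulvar_def fun_eq_iff)
  qed simp
qed

lemma monfun_outside: "f \<in> monfun B K \<Longrightarrow> \<not> (b \<in> B \<and> keys t \<in> K) \<Longrightarrow> f (b, t) = 0"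
  by (auto simp: monfun_def)

lemma monfun_0: "0 \<in> monfun B K"
  by (simp add: monfun_def)

lemma monfun_add:
  assumes "f \<in> monfun B K" "g \<in> monfun B K"
  shows "f + g \<in> monfun B K"
proof -
  have "{p. (f + g) p \<noteq> 0} \<subseteq> {p. f p \<noteq> 0} \<union> {p. g p \<noteq> 0}" by auto
  then have "finite {p. (f + g) p \<noteq> 0}"
    using assms finite_subset unfolding monfun_def by fastforce
  moreover have "f p = 0 \<Longrightarrow> g p = 0 \<Longrightarrow> (f + g) p = 0" for p
    by simp
  ultimately show ?thesis
    using assms unfolding monfun_def by blast
qed

lemma monfun_uminus: "f \<in> monfun B K \<Longrightarrow> - f \<in> monfun B K"
  by (simp add: monfun_def)

lemma monfun_mulvar:
  assumes "f \<in> monfun B K"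
  shows "mulvar L i f \<in> monfun B L"
proof -
  have "{p. mulvar L i f p \<noteq> 0} \<subseteq> (\<lambda>(b, t). (b, t + Poly_Mapping.single i 1)) ` {p. f p \<noteq> 0}"
  proof
    fix p assume "p \<in> {p. mulvar L i f p \<noteq> 0}"
    moreover obtain b t where p: "p = (b, t)" by (cases p)
    ultimately have *: "i \<in> keys t" "f (b, t - Poly_Mapping.single i 1) \<noteq> 0"
      by (auto simp: mulvar_def split: if_splits)
    from *(1) have "t - Poly_Mapping.single i 1 + Poly_Mapping.single i 1 = t"
      by (intro poly_mapping_eqI) (auto simp: lookup_add lookup_minus lookup_single when_def in_keys_iff)
    with *(2) p show "p \<in> (\<lambda>(b, t). (b, t + Poly_Mapping.single i 1)) ` {p. f p \<noteq> 0}"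
      by (intro image_eqI[of _ _ "(b, t - Poly_Mapping.single i 1)"]) simp_all
  qed
  then have "finite {p. mulvar L i f p \<noteq> 0}"
    by (rule finite_subset) (use assms in \<open>simp add: monfun_def\<close>)
  then show ?thesis
    using assms by (auto simp: monfun_def mulvar_def split: if_splits)
qed

lemma monfun_kos:
  assumes "\<And>I. x I \<in> monfun B K"
  shows "kos (mulvar K) vs x I \<in> monfun B K"
proof (induction vs)
  case Nil then show ?case using monfun_0[of B K] by (simp add: zero_fun_def)
next
  case (Cons v vs)
  then show ?case
    using assms by (auto intro!: monfun_add monfun_uminus monfun_mulvar)
qed

text \<open>In multidegree \<open>a\<close> the generator on \<open>I\<close> carries the monomial
  \<open>a - sqfree_monomial I\<close>. Multiplication by \<open>v\<close> only relabels that
  coefficient, and variables that do not divide \<open>a\<close> contribute nothing.\<close>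

lemma kos_mulvar_at:
  assumes I: "I \<subseteq> keys a" and t: "keys (a - sqfree_monomial I) \<in> K"
  shows "kos (mulvar K) vs x I (b, a - sqfree_monomial I) =
    kosZ (filter (\<lambda>v. v \<in> keys a) vs) (\<lambda>I. x I (b, a - sqfree_monomial I)) I"
proof (induction vs)
  case (Cons v vs)
  have fin: "finite I" using I by (rule finite_subset) simp
  have "mulvar K v (x (insert v I)) (b, a - sqfree_monomial I) =
      (if v \<in> keys a then x (insert v I) (b, a - sqfree_monomial (insert v I)) else 0)" if "v \<notin> I"
  proof -
    have "v \<in> keys (a - sqfree_monomial I) \<longleftrightarrow> v \<in> keys a"
      using that fin by (simp add: in_keys_iff lookup_minus lookup_sqfree_monomial)
    moreover have "a - sqfree_monomial I - Poly_Mapping.single v 1 = a - sqfree_monomial (insert v I)"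
      using that fin by (simp add: sqfree_monomial_def diff_diff_eq add.commute)
    ultimately show ?thesis using t by (simp add: mulvar_def)
  qed
  then show ?case
    using Cons I by auto
qed simp

text \<open>The complements in \<open>keys a\<close> of the sets \<open>I\<close> that occur in
  multidegree \<open>a\<close>: a variable with exponent at least 2 stays in the support of
  \<open>a - sqfree_monomial I\<close> even if it lies in \<open>I\<close>. If nonempty, this is the
  link of these variables, restricted to the other variables of \<open>a\<close> and joined with the
  full simplex on them.\<close>

definition slice :: "nat set set \<Rightarrow> monomial \<Rightarrow> nat set set" where
  "slice K a = {\<sigma>. \<sigma> \<subseteq> keys a \<and> \<sigma> \<union> {i. 2 \<le> lookup a i} \<in> K}"

lemma keys_minus_sqfree:
  assumes "I \<subseteq> keys a"
  shows "keys (a - sqfree_monomial I) = keys a - I \<union> {i. 2 \<le> lookup a i}"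
proof -
  have "finite I" using assms by (rule finite_subset) simp
  then show ?thesis
    by (auto simp: in_keys_iff lookup_minus lookup_sqfree_monomial split: if_splits)
qed

lemma matroid_slice:
  assumes K: "matroid V K" and ne: "slice K a \<noteq> {}"
  shows "matroid (keys a) (slice K a)"
  unfolding matroid_def
proof (intro conjI ballI impI)
  let ?J = "{i. 2 \<le> lookup a i}"
  have down: "\<And>\<sigma> \<tau>. \<sigma> \<in> K \<Longrightarrow> \<tau> \<subseteq> \<sigma> \<Longrightarrow> \<tau> \<in> K"
    using K by (auto simp: matroid_def simplicial_complex_def)
  have J: "?J \<subseteq> keys a" by (auto simp: in_keys_iff)
  then have finJ: "finite ?J" by (rule finite_subset) simp
  show "simplicial_complex (keys a) (slice K a)"
    unfolding simplicial_complex_def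
  proof (intro conjI ballI allI impI)
    show "slice K a \<subseteq> Pow (keys a)" by (auto simp: slice_def)
    show *: "\<tau> \<in> slice K a" if "\<sigma> \<in> slice K a" "\<tau> \<subseteq> \<sigma>" for \<sigma> \<tau>
      using that down[of "\<sigma> \<union> ?J" "\<tau> \<union> ?J"] by (auto simp: slice_def)
    show "{} \<in> slice K a" using ne * by blast
  qed simp
  fix \<sigma> \<tau> assume *: "\<sigma> \<in> slice K a" "\<tau> \<in> slice K a" "card \<tau> < card \<sigma>"
  then have fin: "finite \<sigma>" "finite \<tau>"
    using finite_subset[of _ "keys a"] by (simp_all add: slice_def)
  show "\<exists>v\<in>\<sigma> - \<tau>. \<tau> \<union> {v} \<in> slice K a"
  \<comment> \<open>An element of \<open>?J\<close> can be added at no cost. If none is on offer,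
    uniting with \<open>?J\<close> enlarges \<open>\<tau>\<close> by no more than
    \<open>\<sigma>\<close>, so the exchange in \<open>K\<close> still applies.\<close>
  proof (cases "\<exists>v. v \<in> ?J \<inter> (\<sigma> - \<tau>)")
    case True
    then obtain v where "v \<in> ?J" "v \<in> \<sigma> - \<tau>" by blast
    moreover from this have "\<tau> \<union> {v} \<union> ?J = \<tau> \<union> ?J" by auto
    ultimately show ?thesis using * by (intro bexI[of _ v]) (auto simp: slice_def)
  next
    case False
    then have "card (?J - \<tau>) \<le> card (?J - \<sigma>)"
      using finJ by (intro card_mono) auto
    moreover have "card (\<rho> \<union> ?J) = card \<rho> + card (?J - \<rho>)" if "finite \<rho>" for \<rho>
      using card_Un_disjoint[of \<rho> "?J - \<rho>"] that finJ by simp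
    ultimately have "card (\<tau> \<union> ?J) < card (\<sigma> \<union> ?J)"
      using *(3) fin by simp
    then obtain v where "v \<in> \<sigma> \<union> ?J - (\<tau> \<union> ?J)" "\<tau> \<union> ?J \<union> {v} \<in> K"
      using K * unfolding matroid_def slice_def by blast
    then show ?thesis
      using * by (intro bexI[of _ v]) (auto simp: slice_def insert_commute)
  qed
qed

locale monfun_koszul =
  fixes K :: "nat set set" and vs :: "nat list"
  assumes K: "subset_closed K" "K \<subseteq> Pow (set vs)" and dist: "distinct vs"
begin

sublocale koszul "mulvar K"
  by (rule koszul_mulvar[OF K(1)])

abbreviation restr :: "monomial \<Rightarrow> nat list" where
  "restr a \<equiv> filter (\<lambda>v. v \<in> keys a) vs"

lemma set_restr: "keys a \<subseteq> set vs \<Longrightarrow> set (restr a) = keys a"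
  by auto

lemma cofaces_slice:
  assumes "I \<in> cofaces (keys a) (slice K a) j"
  shows "I \<subseteq> keys a" "keys (a - sqfree_monomial I) \<in> K" "card I = j"
proof -
  show "I \<subseteq> keys a" using assms by (simp add: cofaces_def)
  then show "keys (a - sqfree_monomial I) \<in> K" "card I = j"
    using assms by (auto simp: cofaces_def keys_minus_sqfree slice_def)
qed

text \<open>The Koszul complex decomposes as a direct sum over the basis elements \<open>b\<close> and the
  multidegrees \<open>a\<close> (the degree of the variables in \<open>I\<close> included).\<close>

lemma boundary_if_graded_boundary:
  assumes x: "\<And>I. x I \<in> monfun B K"
    and graded: "\<And>a b. keys a \<subseteq> set vs \<Longrightarrow>
      \<exists>z. \<forall>I\<in>cofaces (keys a) (slice K a) j. x I (b, a - sqfree_monomial I) = kosZ (restr a) z I"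
  shows "\<exists>z. (\<forall>I. z I \<in> monfun B K) \<and>
    (\<forall>I\<subseteq>set vs. card I = j \<longrightarrow> x I = kos (mulvar K) vs z I)"
proof -
  define good where "good b a z \<longleftrightarrow>
    (\<forall>I\<in>cofaces (keys a) (slice K a) j. x I (b, a - sqfree_monomial I) = kosZ (restr a) z I)" for b a z
  \<comment> \<open>The solutions chosen in the single multidegrees may be nonzero infinitely often.
    They are cut off to zero where \<open>x\<close> vanishes, which keeps the equations and yields
    finite support.\<close>
  define nz where "nz b a \<longleftrightarrow>
    (\<exists>I\<in>cofaces (keys a) (slice K a) j. x I (b, a - sqfree_monomial I) \<noteq> 0)" for b a
  have "\<forall>a b. \<exists>z. keys a \<subseteq> set vs \<longrightarrow> good b a z"
    using graded unfolding good_def by blast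
  then obtain Z where Z: "\<And>a b. keys a \<subseteq> set vs \<Longrightarrow> good b a (Z a b)"
    by metis
  define z where "z I = (\<lambda>(b, t). if I \<subseteq> set vs \<and> b \<in> B \<and> keys t \<in> K \<and> nz b (t + sqfree_monomial I)
    then Z (t + sqfree_monomial I) b I else 0)" for I
  have z: "z I \<in> monfun B K" for I
  proof -
    have "{p. z I p \<noteq> 0} \<subseteq> (\<Union>I'\<in>Pow (set vs).
        (\<lambda>(b, t). (b, t + sqfree_monomial I' - sqfree_monomial I)) ` {p. x I' p \<noteq> 0})"
    proof
      fix p assume p: "p \<in> {p. z I p \<noteq> 0}"
      obtain b t where [simp]: "p = (b, t)" by (cases p)
      let ?a = "t + sqfree_monomial I"
      have *: "I \<subseteq> set vs" "keys t \<in> K" "nz b ?a"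
        using p by (auto simp: z_def split: if_splits)
      then obtain I' where I': "I' \<in> cofaces (keys ?a) (slice K ?a) j"
          "x I' (b, ?a - sqfree_monomial I') \<noteq> 0"
        by (auto simp: nz_def)
      have fin: "finite I" "finite I'"
        by (auto intro: finite_subset[OF *(1)] finite_subset[OF cofaces_slice(1)[OF I'(1)]])
      have sub: "I' \<subseteq> set vs"
        using cofaces_slice(1)[OF I'(1)] * K(2) fin
        by (auto simp: keys_plus_monomial keys_sqfree_monomial)
      have "?a - sqfree_monomial I' + sqfree_monomial I' = ?a"
        using cofaces_slice(1)[OF I'(1)] fin
        by (intro poly_mapping_eqI)
          (auto simp: lookup_add lookup_minus lookup_sqfree_monomial in_keys_iff keys_plus_monomial)
      then have "t = ?a - sqfree_monomial I' + sqfree_monomial I' - sqfree_monomial I"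
        by simp
      then show "p \<in> (\<Union>I'\<in>Pow (set vs).
          (\<lambda>(b, t). (b, t + sqfree_monomial I' - sqfree_monomial I)) ` {p. x I' p \<noteq> 0})"
        using sub I'(2) by (intro UN_I[of I'] image_eqI[of _ _ "(b, ?a - sqfree_monomial I')"]) auto
    qed
    then have "finite {p. z I p \<noteq> 0}"
      by (rule finite_subset) (use x in \<open>simp add: monfun_def\<close>)
    then show ?thesis by (auto simp: monfun_def z_def split: if_splits)
  qed
  have "x I (b, t) = kos (mulvar K) vs z I (b, t)" if I: "I \<subseteq> set vs" "card I = j" for I b t
  proof (cases "b \<in> B \<and> keys t \<in> K")
    case False
    then show ?thesis
      using monfun_outside[OF x] monfun_outside[OF monfun_kos[of z B K vs I, OF z]] by simp
  next
    case True
    let ?a = "t + sqfree_monomial I"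
    have fin: "finite I" using I(1) by (rule finite_subset) simp
    have a: "keys ?a = keys t \<union> I" "?a - sqfree_monomial I = t"
      using fin by (auto simp: keys_plus_monomial keys_sqfree_monomial)
    have keys_a: "keys ?a \<subseteq> set vs" using a True K(2) I(1) by auto
    have Ia: "I \<subseteq> keys ?a" using a by simp
    have cof: "I \<in> cofaces (keys ?a) (slice K ?a) j"
      using Ia I(2) keys_minus_sqfree[OF Ia] True by (simp add: cofaces_def slice_def a(2))
    have "kos (mulvar K) vs z I (b, t) = kosZ (restr ?a) (\<lambda>I. z I (b, ?a - sqfree_monomial I)) I"
      using kos_mulvar_at[OF Ia, of K vs z b] True by (simp add: a(2))
    also have "\<dots> = kosZ (restr ?a) (\<lambda>I. if nz b ?a then Z ?a b I else 0) I"
    proof (rule kos_cong)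
      fix i assume i: "i \<in> set (restr ?a)" "i \<notin> I"
      then have sub: "insert i I \<subseteq> keys ?a" "insert i I \<subseteq> set vs" using Ia I by auto
      have "?a - sqfree_monomial (insert i I) + sqfree_monomial (insert i I) = ?a"
        using sub(1) fin
        by (intro poly_mapping_eqI)
          (auto simp: lookup_add lookup_minus lookup_sqfree_monomial in_keys_iff keys_plus_monomial)
      moreover have "keys (?a - sqfree_monomial (insert i I)) \<subseteq> keys t"
        unfolding keys_minus_sqfree[OF sub(1)] using keys_minus_sqfree[OF Ia] a(2) by auto
      then have "keys (?a - sqfree_monomial (insert i I)) \<in> K"
        using True subset_closedD[OF K(1)] by blast
      ultimately show "z (insert i I) (b, ?a - sqfree_monomial (insert i I)) =
          (if nz b ?a then Z ?a b (insert i I) else 0)"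
        using sub(2) True by (simp add: z_def)
    qed
    also have "\<dots> = x I (b, t)"
    proof (cases "nz b ?a")
      case True
      then show ?thesis using bspec[OF Z[OF keys_a, of b, unfolded good_def] cof] a(2) by simp
    next
      case False
      then have "x I (b, ?a - sqfree_monomial I) = 0" using cof unfolding nz_def by blast
      then show ?thesis using False a(2) by (simp add: kosZ.kos_0)
    qed
    finally show ?thesis by simp
  qed
  then have "\<forall>I\<subseteq>set vs. card I = j \<longrightarrow> x I = kos (mulvar K) vs z I"
    by (auto simp: fun_eq_iff)
  with z show ?thesis by blast
qed

theorem torsion_free_koszul:
  assumes "matroid V K" "k \<noteq> 0" and x: "\<And>I. x I \<in> monfun B K"
    and eq: "\<And>I p. I \<subseteq> set vs \<Longrightarrow> card I = j \<Longrightarrow> k * x I p = kos (mulvar K) vs y I p"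
  shows "\<exists>z. (\<forall>I. z I \<in> monfun B K) \<and>
    (\<forall>I\<subseteq>set vs. card I = j \<longrightarrow> x I = kos (mulvar K) vs z I)"
proof (rule boundary_if_graded_boundary[OF x])
  fix a :: monomial and b :: 'a
  assume a: "keys a \<subseteq> set vs"
  show "\<exists>z. \<forall>I\<in>cofaces (keys a) (slice K a) j. x I (b, a - sqfree_monomial I) = kosZ (restr a) z I"
  proof (cases "slice K a = {}")
    case True
    then show ?thesis by (simp add: cofaces_def)
  next
    case False
    have "kos_pure (restr a) (slice K a) j"
      using kos_pure_matroid[of "restr a" "slice K a" j] matroid_slice[OF assms(1) False]
        set_restr[OF a] dist by simp
    moreover have "k * x I (b, a - sqfree_monomial I) =
        kosZ (restr a) (\<lambda>I. y I (b, a - sqfree_monomial I)) I"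
      if "I \<in> cofaces (set (restr a)) (slice K a) j" for I
    proof -
      have I: "I \<in> cofaces (keys a) (slice K a) j" using that unfolding set_restr[OF a] .
      have "I \<subseteq> set vs" using cofaces_slice(1)[OF I] a by (rule subset_trans)
      from eq[OF this cofaces_slice(3)[OF I]] show ?thesis
        using kos_mulvar_at[OF cofaces_slice(1,2)[OF I], of vs y b] by simp
    qed
    ultimately show ?thesis
      using kos_pureD[OF _ assms(2), of "restr a" "slice K a" j
          "\<lambda>I. x I (b, a - sqfree_monomial I)" "\<lambda>I. y I (b, a - sqfree_monomial I)"]
      unfolding set_restr[OF a] by blast
  qed
qed

theorem exact_koszul:
  assumes "K = Pow (set vs)" and x: "\<And>I. x I \<in> monfun B K"
    and cycle: "\<And>I. I \<subseteq> set vs \<Longrightarrow> card I = j \<Longrightarrow> kos (mulvar K) vs x I = 0"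
  shows "\<exists>z. (\<forall>I. z I \<in> monfun B K) \<and>
    (\<forall>I\<subseteq>set vs. card I = Suc j \<longrightarrow> x I = kos (mulvar K) vs z I)"
proof (rule boundary_if_graded_boundary[OF x])
  fix a :: monomial and b :: 'a
  assume a: "keys a \<subseteq> set vs"
  have "{i. 2 \<le> lookup a i} \<subseteq> keys a" by (auto simp: in_keys_iff)
  then have s: "slice K a = Pow (keys a)" using a by (auto simp: slice_def assms(1))
  have "kos_exact (restr a) (slice K a) j"
    using kos_exact_Pow[of "restr a"] set_restr[OF a] dist by (simp add: s)
  moreover have "kosZ (restr a) (\<lambda>I. x I (b, a - sqfree_monomial I)) I = 0"
    if "I \<in> cofaces (set (restr a)) (slice K a) j" for I
  proof -
    have I: "I \<in> cofaces (keys a) (slice K a) j" using that unfolding set_restr[OF a] .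
    have "I \<subseteq> set vs" using cofaces_slice(1)[OF I] a by (rule subset_trans)
    then show ?thesis
      using kos_mulvar_at[OF cofaces_slice(1,2)[OF I], of vs x b] cycle[OF _ cofaces_slice(3)[OF I]]
      by simp
  qed
  ultimately show "\<exists>z. \<forall>I\<in>cofaces (keys a) (slice K a) (Suc j).
      x I (b, a - sqfree_monomial I) = kosZ (restr a) z I"
    using kos_exactD[of "restr a" "slice K a" j "\<lambda>I. x I (b, a - sqfree_monomial I)"]
    unfolding set_restr[OF a] by blast
qed

text \<open>A monomial other than 1 is divisible by some variable. Together with
  \<open>constant_term_kos\<close>, this identifies the elements without constant terms with the
  degree 0 boundaries, that is, with the sums of multiples of variables.\<close>

lemma boundary_if_constant_term_0:
  assumes "f \<in> monfun B K" "\<And>b. f (b, 0) = 0"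
  shows "\<exists>z. (\<forall>I. z I \<in> monfun B K) \<and> f = kos (mulvar K) vs z {}"
proof -
  have "\<exists>z. (\<forall>I. z I \<in> monfun B K) \<and>
      (\<forall>I\<subseteq>set vs. card I = 0 \<longrightarrow> f = kos (mulvar K) vs z I)"
  proof (rule boundary_if_graded_boundary[of "\<lambda>_. f"])
    fix a :: monomial and b :: 'a
    assume a: "keys a \<subseteq> set vs"
    have "\<exists>z. f (b, a) = kosZ (restr a) z {}"
    proof (cases "restr a")
      case Nil
      then have "keys a = {}" using set_restr[OF a] by simp
      then have "a = 0" by simp
      then show ?thesis using assms(2) Nil by simp
    next
      case (Cons u us)
      \<comment> \<open>\<open>u\<close> is the first variable that divides the multidegree; it
        takes the entire coefficient.\<close>
      have "u \<notin> set us" using dist Cons by (metis distinct.simps(2) distinct_filter)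
      then have "kosZ us (\<lambda>I. if I = {u} then f (b, a) else 0) {} = kosZ us (\<lambda>I. 0) {}"
        by (intro kos_cong) auto
      then show ?thesis unfolding Cons
        by (intro exI[of _ "\<lambda>I. if I = {u} then f (b, a) else 0"]) (simp add: kosZ.kos_0)
    qed
    then obtain z where z: "f (b, a) = kosZ (restr a) z {}" ..
    have "f (b, a - sqfree_monomial I) = kosZ (restr a) z I"
      if I: "I \<in> cofaces (keys a) (slice K a) 0" for I
    proof -
      have "finite I" using cofaces_slice(1)[OF I] by (rule finite_subset) simp
      then have "I = {}" using cofaces_slice(3)[OF I] by simp
      then show ?thesis using z by (simp add: sqfree_monomial_def)
    qed
    then show "\<exists>z. \<forall>I\<in>cofaces (keys a) (slice K a) 0.
        f (b, a - sqfree_monomial I) = kosZ (restr a) z I" by blast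
  qed (use assms in simp)
  then show ?thesis by force
qed

end

lemma constant_term_kos: "kos (mulvar K) vs x {} (b, 0) = 0"
  by (induction vs) (auto simp: mulvar_def)

section \<open>Dimension shifting\<close>

text \<open>Natural multiples, to match the powers in \<open>torsion_free\<close> and to allow
  induction on \<open>k\<close>.\<close>

definition scale :: "nat \<Rightarrow> ('x \<Rightarrow> int) \<Rightarrow> 'x \<Rightarrow> int" where
  "scale k f = (\<lambda>p. int k * f p)"

lemmas fun_arith_apply = plus_fun_apply zero_fun_apply uminus_apply minus_apply

text \<open>Applied to eta-expanded terms, these simp rules would turn \<open>a + b\<close> into a lambda abstraction.\<close>

declare fun_arith_apply [simp del]

lemma scale_0: "scale k 0 = 0" "scale 0 f = 0"
  by (simp_all add: scale_def zero_fun_def)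

lemma scale_Suc: "scale (Suc k) f = f + scale k f"
  by (simp add: scale_def fun_eq_iff fun_arith_apply algebra_simps)

lemma scale_eq_0: "k > 0 \<Longrightarrow> scale k f = 0 \<Longrightarrow> f = 0"
  by (simp add: scale_def fun_eq_iff fun_arith_apply)

lemma kos_scale: "kos (mulvar K) vs (\<lambda>I. scale k (x I)) I = scale k (kos (mulvar K) vs x I)"
  by (induction vs) (auto simp: scale_def mulvar_def fun_eq_iff fun_arith_apply algebra_simps)

definition submod :: "nat set set \<Rightarrow> ('b \<times> monomial \<Rightarrow> int) set \<Rightarrow> bool" where
  "submod K A \<longleftrightarrow> 0 \<in> A \<and> (\<forall>a\<in>A. \<forall>b\<in>A. a + b \<in> A) \<and> (\<forall>a\<in>A. - a \<in> A) \<and>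
     (\<forall>v. \<forall>a\<in>A. mulvar K v a \<in> A)"

lemma submodD:
  assumes "submod K A"
  shows "0 \<in> A" "a \<in> A \<Longrightarrow> b \<in> A \<Longrightarrow> a + b \<in> A" "a \<in> A \<Longrightarrow> - a \<in> A"
    "a \<in> A \<Longrightarrow> b \<in> A \<Longrightarrow> a - b \<in> A" "a \<in> A \<Longrightarrow> mulvar K v a \<in> A"
  using assms unfolding submod_def by (auto simp: diff_conv_add_uminus simp del: add_uminus_conv_diff)

lemma submod_scale: "submod K A \<Longrightarrow> a \<in> A \<Longrightarrow> scale k a \<in> A"
  by (induction k) (auto simp: scale_0 scale_Suc submodD)

lemma submod_kos:
  assumes "submod K A" "\<And>I. x I \<in> A"
  shows "kos (mulvar K) vs x I \<in> A"
  using assms by (induction vs) (auto simp: submodD)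

lemma submod_monfun: "submod K (monfun B K)"
  by (simp add: submod_def monfun_0 monfun_add monfun_uminus monfun_mulvar)

definition lin ::
    "nat list \<Rightarrow> nat set set \<Rightarrow> ('b \<times> monomial \<Rightarrow> int) set \<Rightarrow> nat set set \<Rightarrow>
     (('b \<times> monomial \<Rightarrow> int) \<Rightarrow> 'c \<times> monomial \<Rightarrow> int) \<Rightarrow> bool" where
  "lin vs K A L f \<longleftrightarrow> (\<forall>a\<in>A. \<forall>b\<in>A. f (a + b) = f a + f b) \<and>
     (\<forall>v\<in>set vs. \<forall>a\<in>A. f (mulvar K v a) = mulvar L v (f a))"

lemma lin_zero:
  assumes "submod K A" "lin vs K A L f" shows "f 0 = 0"
proof -
  have "f (0 + 0) = f 0 + f 0"
    using assms submodD(1)[OF assms(1)] unfolding lin_def by blast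
  then show ?thesis by simp
qed

lemma lin_add: "lin vs K A L f \<Longrightarrow> a \<in> A \<Longrightarrow> b \<in> A \<Longrightarrow> f (a + b) = f a + f b"
  by (simp add: lin_def)

lemma lin_uminus:
  assumes "submod K A" "lin vs K A L f" "a \<in> A" shows "f (- a) = - f a"
proof -
  have "f (a + - a) = f a + f (- a)"
    using assms by (intro lin_add) (auto simp: submodD)
  then show ?thesis using lin_zero[OF assms(1,2)] by (simp add: eq_neg_iff_add_eq_0 add.commute)
qed

lemma lin_diff:
  assumes "submod K A" "lin vs K A L f" "a \<in> A" "b \<in> A" shows "f (a - b) = f a - f b"
  using lin_add[OF assms(2,3), of "- b"] lin_uminus[OF assms(1,2,4)] submodD(3)[OF assms(1,4)] by simp

lemma lin_scale:
  assumes "submod K A" "lin vs K A L f" "a \<in> A" shows "f (scale k a) = scale k (f a)"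
  by (induction k)
    (simp_all add: scale_0 scale_Suc lin_zero[OF assms(1,2)] lin_add[OF assms(2)] assms(3)
      submod_scale[OF assms(1)])

lemma lin_kos:
  assumes "submod K A" "lin vs K A L f" "\<And>I. x I \<in> A" "set us \<subseteq> set vs"
  shows "f (kos (mulvar K) us x I) = kos (mulvar L) us (\<lambda>I. f (x I)) I"
  using assms(4)
proof (induction us)
  case Nil
  then show ?case using lin_zero[OF assms(1,2)] by simp
next
  case (Cons u us)
  have k: "kos (mulvar K) us x I \<in> A" by (rule submod_kos[OF assms(1,3)])
  have "f (mulvar K u (x (insert u I))) = mulvar L u (f (x (insert u I)))"
    using assms(2,3) Cons.prems by (simp add: lin_def)
  then show ?case
    using Cons k assms(3) by (auto simp: lin_uminus[OF assms(1,2)] lin_add[OF assms(2)] submodD[OF assms(1)])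
qed

text \<open>The sums of multiples of variables by elements of \<open>A\<close>, written as degree 0
  boundaries. The quotient of \<open>A\<close> by them is \<open>A\<close> tensored with
  \<int>.\<close>

definition mult_by_vars ::
    "nat set set \<Rightarrow> nat list \<Rightarrow> ('b \<times> monomial \<Rightarrow> int) set \<Rightarrow> ('b \<times> monomial \<Rightarrow> int) set" where
  "mult_by_vars K vs A = {kos (mulvar K) vs z {} | z. \<forall>I. z I \<in> A}"

text \<open>Unlike in \<open>kos_pure\<close>, chains must take values in \<open>A\<close>: for a
  module of syzygies, a solution in the surrounding free module is not enough.\<close>

definition koszul_torsion_free ::
    "nat set set \<Rightarrow> nat list \<Rightarrow> ('b \<times> monomial \<Rightarrow> int) set \<Rightarrow> nat \<Rightarrow> bool" where
  "koszul_torsion_free K vs A j \<longleftrightarrow> (\<forall>k>0. \<forall>x y. (\<forall>I. x I \<in> A) \<longrightarrow> (\<forall>I. y I \<in> A) \<longrightarrow>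
     (\<forall>I\<subseteq>set vs. card I = j \<longrightarrow> scale k (x I) = kos (mulvar K) vs y I) \<longrightarrow>
     (\<exists>z. (\<forall>I. z I \<in> A) \<and> (\<forall>I\<subseteq>set vs. card I = j \<longrightarrow> x I = kos (mulvar K) vs z I)))"

lemma koszul_torsion_freeD:
  assumes "koszul_torsion_free K vs A j" "k > 0" "\<And>I. x I \<in> A" "\<And>I. y I \<in> A"
    "\<And>I. I \<subseteq> set vs \<Longrightarrow> card I = j \<Longrightarrow> scale k (x I) = kos (mulvar K) vs y I"
  shows "\<exists>z. (\<forall>I. z I \<in> A) \<and> (\<forall>I\<subseteq>set vs. card I = j \<longrightarrow> x I = kos (mulvar K) vs z I)"
  using assms(1)[unfolded koszul_torsion_free_def, rule_format, OF assms(2), of x y] assms(3-5)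
  by blast

definition koszul_acyclic ::
    "nat set set \<Rightarrow> nat list \<Rightarrow> ('b \<times> monomial \<Rightarrow> int) set \<Rightarrow> bool" where
  "koszul_acyclic K vs A \<longleftrightarrow> (\<forall>j x. (\<forall>I. x I \<in> A) \<longrightarrow>
     (\<forall>I\<subseteq>set vs. card I = j \<longrightarrow> kos (mulvar K) vs x I = 0) \<longrightarrow>
     (\<exists>z. (\<forall>I. z I \<in> A) \<and> (\<forall>I\<subseteq>set vs. card I = Suc j \<longrightarrow> x I = kos (mulvar K) vs z I)))"

lemma koszul_acyclicD:
  assumes "koszul_acyclic K vs A" "\<And>I. x I \<in> A"
    "\<And>I. I \<subseteq> set vs \<Longrightarrow> card I = j \<Longrightarrow> kos (mulvar K) vs x I = 0"
  shows "\<exists>z. (\<forall>I. z I \<in> A) \<and> (\<forall>I\<subseteq>set vs. card I = Suc j \<longrightarrow> x I = kos (mulvar K) vs z I)"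
  using assms(1)[unfolded koszul_acyclic_def, rule_format, of x j] assms(2,3)
  by blast

lemma card_insert_subset:
  "I \<subseteq> set vs \<Longrightarrow> card I = j \<Longrightarrow> i \<in> set vs \<Longrightarrow> i \<notin> I \<Longrightarrow> insert i I \<subseteq> set vs \<and> card (insert i I) = Suc j"
  using finite_subset[of I "set vs"] by simp

text \<open>The long exact sequence of Koszul homology for \<open>0 \<rightarrow> ker f \<rightarrow> A \<rightarrow> f ` A \<rightarrow> 0\<close> identifies the classes
  of degree \<open>j\<close> in \<open>ker f\<close> that die in \<open>A\<close> with the homology of \<open>f ` A\<close> in degree \<open>Suc j\<close>.\<close>

lemma dimension_shift:
  fixes f :: "('b \<times> monomial \<Rightarrow> int) \<Rightarrow> 'c \<times> monomial \<Rightarrow> int"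
  assumes K: "subset_closed K" and dist: "distinct vs" and A: "submod K A" and f: "lin vs K A L f"
    and acyclic: "koszul_acyclic K vs A" and tf: "koszul_torsion_free L vs (f ` A) (Suc j)"
    and k: "k > 0" and xyz: "\<And>I. x I \<in> A" "\<And>I. y I \<in> A" "\<And>I. f (y I) = 0" "\<And>I. z I \<in> A"
    and ky: "\<And>I. I \<subseteq> set vs \<Longrightarrow> card I = j \<Longrightarrow> scale k (x I) = kos (mulvar K) vs y I"
    and xz: "\<And>I. I \<subseteq> set vs \<Longrightarrow> card I = j \<Longrightarrow> x I = kos (mulvar K) vs z I"
  shows "\<exists>y'. (\<forall>I. y' I \<in> A \<and> f (y' I) = 0) \<and>
    (\<forall>I\<subseteq>set vs. card I = j \<longrightarrow> x I = kos (mulvar K) vs y' I)"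
proof -
  interpret V: koszul "mulvar K :: nat \<Rightarrow> ('b \<times> monomial \<Rightarrow> int) \<Rightarrow> _" by (rule koszul_mulvar[OF K])
  \<comment> \<open>The chains \<open>k z\<close> and \<open>y\<close> both bound
    \<open>k x\<close>, so their difference is a cycle of \<open>A\<close>. As \<open>f\<close>
    kills \<open>y\<close>, a chain that bounds this cycle shows \<open>k f(z)\<close> to be a
    boundary in the image.\<close>
  have "kos (mulvar K) vs (\<lambda>I. scale k (z I) - y I) I = 0" if "I \<subseteq> set vs" "card I = j" for I
    using ky[OF that] xz[OF that] by (simp add: V.kos_diff kos_scale)
  then have "\<exists>w. (\<forall>I. w I \<in> A) \<and>
      (\<forall>I\<subseteq>set vs. card I = Suc j \<longrightarrow> scale k (z I) - y I = kos (mulvar K) vs w I)"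
    by (intro koszul_acyclicD[OF acyclic] submodD[OF A] submod_scale[OF A] xyz)
  then obtain w where w: "\<And>I. w I \<in> A"
    "\<And>I. I \<subseteq> set vs \<Longrightarrow> card I = Suc j \<Longrightarrow> scale k (z I) - y I = kos (mulvar K) vs w I"
    by blast
  have "scale k (f (z I)) = kos (mulvar L) vs (\<lambda>I. f (w I)) I" if "I \<subseteq> set vs" "card I = Suc j" for I
  proof -
    have "scale k (f (z I)) = f (scale k (z I) - y I)"
      using xyz by (simp add: lin_diff[OF A f] lin_scale[OF A f] submod_scale[OF A])
    then show ?thesis
      using w(2)[OF that] lin_kos[OF A f w(1)] by simp
  qed
  then have "\<exists>u'. (\<forall>I. u' I \<in> f ` A) \<and>
      (\<forall>I\<subseteq>set vs. card I = Suc j \<longrightarrow> f (z I) = kos (mulvar L) vs u' I)"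
    by (intro koszul_torsion_freeD[OF tf k, of _ "\<lambda>I. f (w I)"] imageI xyz w)
  then obtain u' where u': "\<And>I. u' I \<in> f ` A"
    "\<And>I. I \<subseteq> set vs \<Longrightarrow> card I = Suc j \<Longrightarrow> f (z I) = kos (mulvar L) vs u' I"
    by blast
  define u where "u I = (SOME a. a \<in> A \<and> u' I = f a)" for I
  have u: "u I \<in> A \<and> u' I = f (u I)" for I
    unfolding u_def by (rule someI_ex[of "\<lambda>a. a \<in> A \<and> u' I = f a"]) (use u'(1)[of I] in blast)
  \<comment> \<open>Subtracting the boundary of a lift of \<open>u'\<close> moves \<open>z\<close>
    into the kernel without changing its own boundary. The default 0 is there because values in the
    kernel are demanded on all sets.\<close>
  define y' where "y' I = (if I \<subseteq> set vs \<and> card I = Suc j then z I - kos (mulvar K) vs u I else 0)" for I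
  have u_kos: "kos (mulvar K) vs u I \<in> A" for I
    using u by (intro submod_kos[OF A]) blast
  show ?thesis
  proof (intro exI[of _ y'] conjI allI impI)
    show "y' I \<in> A" for I
      using u_kos xyz(4) by (simp add: y'_def submodD[OF A])
    show "f (y' I) = 0" for I
    proof (cases "I \<subseteq> set vs \<and> card I = Suc j")
      case True
      have "f (kos (mulvar K) vs u I) = kos (mulvar L) vs (\<lambda>I. f (u I)) I"
        using u by (intro lin_kos[OF A f]) auto
      also have "(\<lambda>I. f (u I)) = u'" using u by auto
      finally show ?thesis
        using True u'(2)[of I] xyz(4) u_kos by (simp add: y'_def lin_diff[OF A f])
    qed (auto simp: y'_def lin_zero[OF A f])
    fix I assume I: "I \<subseteq> set vs" "card I = j"
    have "kos (mulvar K) vs y' I = kos (mulvar K) vs (\<lambda>I. z I - kos (mulvar K) vs u I) I"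
      by (rule kos_cong) (use card_insert_subset[OF I] in \<open>simp add: y'_def\<close>)
    then show "x I = kos (mulvar K) vs y' I"
      using xz[OF I] by (simp add: V.kos_diff V.kos_kos[OF dist])
  qed
qed

text \<open>A chain of the kernel with a multiple that is a boundary is a cycle, so it bounds in
  \<open>A\<close> by acyclicity, and \<open>dimension_shift\<close> moves the bounding chain into
  the kernel. Acyclicity confines this to positive degrees.\<close>

lemma koszul_torsion_free_kernel:
  fixes f :: "('b \<times> monomial \<Rightarrow> int) \<Rightarrow> 'c \<times> monomial \<Rightarrow> int"
  assumes K: "subset_closed K" and dist: "distinct vs" and A: "submod K A" and f: "lin vs K A L f"
    and acyclic: "koszul_acyclic K vs A" and tf: "koszul_torsion_free L vs (f ` A) (Suc (Suc j))"
  shows "koszul_torsion_free K vs {a \<in> A. f a = 0} (Suc j)"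
  unfolding koszul_torsion_free_def
proof (intro allI impI)
  interpret V: koszul "mulvar K :: nat \<Rightarrow> ('b \<times> monomial \<Rightarrow> int) \<Rightarrow> _" by (rule koszul_mulvar[OF K])
  fix k :: nat and x y
  assume k: "k > 0" and x: "\<forall>I. x I \<in> {a \<in> A. f a = 0}" and y: "\<forall>I. y I \<in> {a \<in> A. f a = 0}"
    and eq: "\<forall>I\<subseteq>set vs. card I = Suc j \<longrightarrow> scale k (x I) = kos (mulvar K) vs y I"
  have "kos (mulvar K) vs x I = 0" if I: "I \<subseteq> set vs" "card I = j" for I
  proof -
    have "scale k (kos (mulvar K) vs x I) = kos (mulvar K) vs (\<lambda>I. scale k (x I)) I"
      by (simp add: kos_scale)
    also have "\<dots> = kos (mulvar K) vs (kos (mulvar K) vs y) I"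
      by (rule kos_cong) (use card_insert_subset[OF I] eq in blast)
    finally show ?thesis using V.kos_kos[OF dist] scale_eq_0[OF k] by metis
  qed
  moreover have xy: "\<And>I. x I \<in> A" "\<And>I. y I \<in> A" "\<And>I. f (y I) = 0" using x y by auto
  ultimately have "\<exists>z. (\<forall>I. z I \<in> A) \<and>
      (\<forall>I\<subseteq>set vs. card I = Suc j \<longrightarrow> x I = kos (mulvar K) vs z I)"
    by (intro koszul_acyclicD[OF acyclic])
  then obtain z where z: "\<And>I. z I \<in> A"
    "\<And>I. I \<subseteq> set vs \<Longrightarrow> card I = Suc j \<Longrightarrow> x I = kos (mulvar K) vs z I"
    by blast
  have "\<exists>y'. (\<forall>I. y' I \<in> A \<and> f (y' I) = 0) \<and>
      (\<forall>I\<subseteq>set vs. card I = Suc j \<longrightarrow> x I = kos (mulvar K) vs y' I)"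
    by (rule dimension_shift[OF K dist A f acyclic tf k xy z(1) _ z(2)]) (use eq in auto)
  then show "\<exists>z. (\<forall>I. z I \<in> {a \<in> A. f a = 0}) \<and>
      (\<forall>I\<subseteq>set vs. card I = Suc j \<longrightarrow> x I = kos (mulvar K) vs z I)"
    by blast
qed

text \<open>Right exactness of tensoring with \<int>: the coefficients \<open>u'\<close> have
  preimages in \<open>A\<close>, and the boundary of these preimages is the correction
  \<open>w\<close>.\<close>

lemma lift_boundary:
  assumes A: "submod K A" and f: "lin vs K A L f" and x: "x \<in> A"
    and u': "\<And>I. u' I \<in> f ` A" "f x = kos (mulvar L) vs u' {}"
  obtains w where "w \<in> mult_by_vars K vs A" "x - w \<in> {a \<in> A. f a = 0}"
proof -
  define u where "u I = (SOME a. a \<in> A \<and> u' I = f a)" for I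
  have u: "u I \<in> A \<and> u' I = f (u I)" for I
    unfolding u_def by (rule someI_ex[of "\<lambda>a. a \<in> A \<and> u' I = f a"]) (use u'(1)[of I] in blast)
  let ?w = "kos (mulvar K) vs u {}"
  have w: "?w \<in> A" using u by (intro submod_kos[OF A]) blast
  have "f ?w = kos (mulvar L) vs (\<lambda>I. f (u I)) {}"
    using u by (intro lin_kos[OF A f]) auto
  also have "(\<lambda>I. f (u I)) = u'" using u by auto
  finally have "f (x - ?w) = 0"
    using u'(2) by (simp add: lin_diff[OF A f x w])
  moreover have "x - ?w \<in> A" by (rule submodD(4)[OF A x w])
  moreover have "?w \<in> mult_by_vars K vs A" using u by (auto simp: mult_by_vars_def)
  ultimately show ?thesis using that by blast
qed

lemma scale_image_boundary:
  assumes A: "submod K A" and f: "lin vs K A L f" and x: "x \<in> A"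
    and y: "y \<in> {a \<in> A. f a = 0}" and z: "\<And>I. z I \<in> A"
    and eq: "scale k x = y + kos (mulvar K) vs z {}"
  shows "scale k (f x) = kos (mulvar L) vs (\<lambda>I. f (z I)) {}"
proof -
  have w: "kos (mulvar K) vs z {} \<in> A" by (rule submod_kos[OF A z])
  have "scale k (f x) = f (scale k x)"
    by (simp add: lin_scale[OF A f x])
  also have "\<dots> = f y + f (kos (mulvar K) vs z {})"
    unfolding eq using y w by (intro lin_add[OF f]) auto
  finally show ?thesis
    using lin_kos[OF A f z] y by simp
qed

text \<open>The resolution in coordinates, with neither bases nor tensor products. Of freeness only
  Koszul acyclicity is kept, and the resolved module enters as the image of
  \<open>E\<close>.\<close>

locale concrete_resolution =
  fixes K L :: "nat set set" and vs :: "nat list"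
    and A :: "nat \<Rightarrow> ('b \<times> monomial \<Rightarrow> int) set"
    and D :: "nat \<Rightarrow> ('b \<times> monomial \<Rightarrow> int) \<Rightarrow> 'b \<times> monomial \<Rightarrow> int"
    and E :: "('b \<times> monomial \<Rightarrow> int) \<Rightarrow> 'c \<times> monomial \<Rightarrow> int"
  assumes K: "subset_closed K" and dist: "distinct vs"
    and A: "\<And>n. submod K (A n)" and acyclic: "\<And>n. koszul_acyclic K vs (A n)"
    and D: "\<And>n. lin vs K (A (Suc n)) K (D n)" and E: "lin vs K (A 0) L E"
    and exact_0: "D 0 ` A (Suc 0) = {a \<in> A 0. E a = 0}"
    and exact: "\<And>n. D (Suc n) ` A (Suc (Suc n)) = {a \<in> A (Suc n). D n a = 0}"
    and tf: "\<And>j. koszul_torsion_free L vs (E ` A 0) j"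
begin

sublocale V: koszul "mulvar K :: nat \<Rightarrow> ('b \<times> monomial \<Rightarrow> int) \<Rightarrow> _"
  by (rule koszul_mulvar[OF K])

text \<open>Passing to a kernel trades Koszul degree \<open>Suc (Suc j)\<close> for
  \<open>Suc j\<close>, which is why the resolved module is assumed torsion-free in all
  degrees.\<close>

lemma koszul_torsion_free_image: "koszul_torsion_free K vs (D n ` A (Suc n)) (Suc j)"
proof (induction n arbitrary: j)
  case 0
  then show ?case
    unfolding exact_0 by (rule koszul_torsion_free_kernel[OF K dist A E acyclic tf])
next
  case (Suc n)
  then show ?case
    unfolding exact by (intro koszul_torsion_free_kernel[OF K dist A D acyclic])
qed

lemma in_image: "a \<in> D n ` A (Suc n) \<Longrightarrow> a \<in> A n"
  using exact_0 exact by (cases n) auto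

text \<open>The zeroth homology is the image of \<open>E\<close> modulo multiples of variables, that
  is, its Koszul homology in degree 0.\<close>

lemma torsion_0:
  assumes "k > 0" "x \<in> A 0" "y \<in> A (Suc 0)" "w \<in> mult_by_vars K vs (A 0)"
    "scale k x = D 0 y + w"
  obtains y' w' where "y' \<in> A (Suc 0)" "w' \<in> mult_by_vars K vs (A 0)" "x = D 0 y' + w'"
proof -
  obtain z where z: "w = kos (mulvar K) vs z {}" "\<And>I. z I \<in> A 0"
    using assms(4) by (auto simp: mult_by_vars_def)
  have eq: "scale k (E x) = kos (mulvar L) vs (\<lambda>I. E (z I)) {}"
    by (rule scale_image_boundary[OF A E assms(2) _ z(2) assms(5)[unfolded z(1)]])
      (use exact_0 assms(3) in blast)
  have "\<exists>u'. (\<forall>I. u' I \<in> E ` A 0) \<and>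
    (\<forall>I\<subseteq>set vs. card I = 0 \<longrightarrow> E x = kos (mulvar L) vs u' I)"
  proof (rule koszul_torsion_freeD[OF tf assms(1), of "\<lambda>_. E x" "\<lambda>I. E (z I)" 0])
    fix I assume "I \<subseteq> set vs" "card I = 0"
    then show "scale k (E x) = kos (mulvar L) vs (\<lambda>I. E (z I)) I"
      using eq finite_subset[of I "set vs"] by simp
  qed (use z(2) assms(2) in auto)
  then obtain u' where "\<forall>I. u' I \<in> E ` A 0"
    "\<forall>I\<subseteq>set vs. card I = 0 \<longrightarrow> E x = kos (mulvar L) vs u' I"
    by blast
  then have u': "\<And>I. u' I \<in> E ` A 0" "E x = kos (mulvar L) vs u' {}"
    by simp_all
  obtain w' where w': "w' \<in> mult_by_vars K vs (A 0)" "x - w' \<in> {a \<in> A 0. E a = 0}"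
    by (rule lift_boundary[OF A E assms(2) u'])
  then obtain y' where "y' \<in> A (Suc 0)" "x - w' = D 0 y'" using exact_0 by blast
  then show ?thesis using that[of y' w'] w' by (simp add: diff_eq_eq)
qed

text \<open>The cycle condition says that \<open>D n x\<close> bounds in \<open>A n\<close>, and the
  torsion relation that its \<open>k\<close>-fold bounds in the kernel of the next map. The
  dimension shift in degree 0 lets \<open>D n x\<close> itself bound with coefficients in the image
  of \<open>D n\<close>. Lifting these coefficients corrects \<open>x\<close> by multiples of
  variables to an element of the kernel of \<open>D n\<close>, where exactness takes over.\<close>

lemma torsion_Suc:
  assumes "k > 0" "x \<in> A (Suc n)" "y \<in> A (Suc (Suc n))" "w \<in> mult_by_vars K vs (A (Suc n))"
    "D n x \<in> mult_by_vars K vs (A n)" "scale k x = D (Suc n) y + w"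
  obtains y' w' where "y' \<in> A (Suc (Suc n))" "w' \<in> mult_by_vars K vs (A (Suc n))"
    "x = D (Suc n) y' + w'"
proof -
  obtain z where z: "w = kos (mulvar K) vs z {}" "\<And>I. z I \<in> A (Suc n)"
    using assms(4) by (auto simp: mult_by_vars_def)
  obtain z' where z': "D n x = kos (mulvar K) vs z' {}" "\<And>I. z' I \<in> A n"
    using assms(5) by (auto simp: mult_by_vars_def)
  have "scale k (D n x) = kos (mulvar K) vs (\<lambda>I. D n (z I)) {}"
    by (rule scale_image_boundary[OF A D assms(2) _ z(2) assms(6)[unfolded z(1)]])
      (use exact assms(3) in blast)
  then have eq: "scale k (D n x) = kos (mulvar K) vs (\<lambda>I. D n (z I)) I"
    "D n x = kos (mulvar K) vs z' I" if "I \<subseteq> set vs" "card I = 0" for I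
    using z'(1) that finite_subset[of I "set vs"] by simp_all
  have Dx: "D n x \<in> A n" by (rule in_image) (use assms(2) in blast)
  have Dz: "D n (z I) \<in> A n" for I by (rule in_image) (use z(2) in blast)
  have "\<exists>u'. (\<forall>I. u' I \<in> D n ` A (Suc n)) \<and> D n x = kos (mulvar K) vs u' {}"
  \<comment> \<open>The map after \<open>D n\<close> is \<open>E\<close> for \<open>n = 0\<close>
    and an earlier \<open>D\<close> otherwise, so torsion-freeness of its image in Koszul degree 1
    has two sources.\<close>
  proof (cases n)
    case 0
    have ker: "E (D n (z I)) = 0" for I using exact_0 z(2)[of I] 0 by blast
    have E_n: "lin vs K (A n) L E" "koszul_torsion_free L vs (E ` A n) (Suc 0)"
      using E tf 0 by simp_all
    obtain u' where u': "\<forall>I. u' I \<in> A n \<and> E (u' I) = 0"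
      "\<forall>I\<subseteq>set vs. card I = 0 \<longrightarrow> D n x = kos (mulvar K) vs u' I"
      using dimension_shift[OF K dist A E_n(1) acyclic E_n(2) assms(1) Dx Dz ker z'(2) eq]
      by blast
    have "u' I \<in> D n ` A (Suc n)" for I using u'(1) exact_0 0 by simp
    then show ?thesis using u'(2) by (intro exI[of _ u']) simp
  next
    case (Suc i)
    have ker: "D i (D n (z I)) = 0" for I using exact[of i] z(2)[of I] Suc by blast
    have D_n: "lin vs K (A n) K (D i)" "koszul_torsion_free K vs (D i ` A n) (Suc 0)"
      using D koszul_torsion_free_image Suc by simp_all
    obtain u' where u': "\<forall>I. u' I \<in> A n \<and> D i (u' I) = 0"
      "\<forall>I\<subseteq>set vs. card I = 0 \<longrightarrow> D n x = kos (mulvar K) vs u' I"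
      using dimension_shift[OF K dist A D_n(1) acyclic D_n(2) assms(1) Dx Dz ker z'(2) eq]
      by blast
    have "u' I \<in> D n ` A (Suc n)" for I using u'(1) exact[of i] Suc by simp
    then show ?thesis using u'(2) by (intro exI[of _ u']) simp
  qed
  then obtain u' where u': "\<And>I. u' I \<in> D n ` A (Suc n)" "D n x = kos (mulvar K) vs u' {}"
    by blast
  obtain w' where w': "w' \<in> mult_by_vars K vs (A (Suc n))"
      "x - w' \<in> {a \<in> A (Suc n). D n a = 0}"
    by (rule lift_boundary[OF A D assms(2) u'])
  then obtain y' where "y' \<in> A (Suc (Suc n))" "x - w' = D (Suc n) y'" using exact by blast
  then show ?thesis using that[of y' w'] w' by (simp add: diff_eq_eq)
qed

end

section \<open>Coordinates on Stanley--Reisner rings and free modules\<close>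

lemma Zpoly_simps [simp]:
  "monoid.mult (Zpoly m) = (*)" "monoid.one (Zpoly m) = 1" "ring.zero (Zpoly m) = 0" "ring.add (Zpoly m) = (+)"
  by (simp_all add: Zpoly_def)

lemma Zpoly_carrier_iff: "p \<in> carrier (Zpoly m) \<longleftrightarrow> (\<forall>t. lookup p t \<noteq> 0 \<longrightarrow> keys t \<subseteq> {1..m})"
  by (auto simp: Zpoly_def in_keys_iff)

lemma monfun_finite_fibre:
  assumes "f \<in> monfun B K"
  shows "finite {t. f (b, t) \<noteq> 0}"
proof -
  have "finite (Pair b -` {p. f p \<noteq> 0})"
    by (rule finite_vimageI) (use assms in \<open>simp_all add: monfun_def inj_def\<close>)
  then show ?thesis by (simp add: vimage_def)
qed

lemma keys_mult_monomial:
  assumes "t \<in> keys (p * q :: int_mpoly)"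
  obtains a b where "t = a + b" "a \<in> keys p" "b \<in> keys q" "keys t = keys a \<union> keys b"
  using assms keys_mult[of p q] keys_plus_monomial by blast

lemma Zpoly_mult_closed:
  assumes "p \<in> carrier (Zpoly m)" "q \<in> carrier (Zpoly m)"
  shows "p * q \<in> carrier (Zpoly m)"
proof -
  have "keys t \<subseteq> {1..m}" if "t \<in> keys (p * q)" for t
    using keys_mult_monomial[OF that] assms by (metis (no_types, lifting) Un_least Zpoly_carrier_iff in_keys_iff)
  then show ?thesis by (simp add: Zpoly_carrier_iff in_keys_iff)
qed

lemma Zpoly_add_closed:
  assumes "p \<in> carrier (Zpoly m)" "q \<in> carrier (Zpoly m)"
  shows "p + q \<in> carrier (Zpoly m)"
  using assms by (simp add: Zpoly_carrier_iff lookup_add) (metis add_0)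

lemma Zpoly_uminus_closed: "p \<in> carrier (Zpoly m) \<Longrightarrow> - p \<in> carrier (Zpoly m)"
  by (simp add: Zpoly_carrier_iff)

lemma cring_Zpoly: "cring (Zpoly m)"
proof (rule cringI)
  show "abelian_group (Zpoly m)"
  proof (rule abelian_groupI)
    fix p assume p: "p \<in> carrier (Zpoly m)"
    show "\<exists>q\<in>carrier (Zpoly m). q \<oplus>\<^bsub>Zpoly m\<^esub> p = \<zero>\<^bsub>Zpoly m\<^esub>"
      by (rule bexI[OF _ Zpoly_uminus_closed[OF p]]) simp
  qed (auto simp: Zpoly_add_closed add.assoc add.commute, simp add: Zpoly_carrier_iff)
  show "Group.comm_monoid (Zpoly m)"
    by (rule comm_monoidI)
      (auto simp: Zpoly_mult_closed mult.assoc mult.commute, simp add: Zpoly_carrier_iff lookup_one when_def)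
qed (simp add: distrib_right)

lemma pvar_closed: "i \<in> {1..m} \<Longrightarrow> pvar i \<in> carrier (Zpoly m)"
  by (simp add: Zpoly_carrier_iff pvar_def lookup_single when_def)

lemma lookup_pvar_mult:
  "lookup (pvar i * q) t = (if i \<in> keys t then lookup q (t - Poly_Mapping.single i 1) else 0)"
proof -
  have "lookup (pvar i) s * c = (c when s = Poly_Mapping.single i 1)" for s c
    by (simp add: pvar_def lookup_single when_def)
  then have "lookup (pvar i * q) t = (\<Sum>u. lookup q u when t = Poly_Mapping.single i 1 + u)"
    by (simp only: lookup_mult Sum_any_when_equal)
  also have "\<dots> = (if i \<in> keys t then lookup q (t - Poly_Mapping.single i 1) else 0)"
  proof (cases "i \<in> keys t")
    case True
    then have "Poly_Mapping.single i 1 + (t - Poly_Mapping.single i 1) = t"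
      by (intro poly_mapping_eqI) (auto simp: lookup_add lookup_minus lookup_single when_def in_keys_iff)
    then have "t = Poly_Mapping.single i 1 + u \<longleftrightarrow> u = t - Poly_Mapping.single i 1" for u
      by (metis add_diff_cancel_left')
    then show ?thesis using True by simp
  next
    case False
    then have "t \<noteq> Poly_Mapping.single i 1 + u" for u
      by (auto simp: keys_plus_monomial)
    then show ?thesis using False by simp
  qed
  finally show ?thesis .
qed

lemma prod_pvar:
  assumes "finite I"
  shows "(\<Prod>i\<in>I. pvar i) = Poly_Mapping.single (sqfree_monomial I) 1"
  using assms unfolding sqfree_monomial_def
  by (induction I) (simp_all add: pvar_def mult_single)

definition monomial_ideal :: "nat \<Rightarrow> nat set set \<Rightarrow> int_mpoly set" where
  "monomial_ideal m K = {p \<in> carrier (Zpoly m). \<forall>t. keys t \<in> K \<longrightarrow> lookup p t = 0}"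

lemma ideal_monomial_ideal:
  assumes "subset_closed K"
  shows "ideal (monomial_ideal m K) (Zpoly m)"
proof -
  interpret R: cring "Zpoly m" by (rule cring_Zpoly)
  have uminus: "\<ominus>\<^bsub>Zpoly m\<^esub> p = - p" if "p \<in> carrier (Zpoly m)" for p
    using R.minus_equality[of "- p" p] that Zpoly_uminus_closed[OF that] by simp
  have mult: "q * p \<in> monomial_ideal m K"
    if "p \<in> monomial_ideal m K" "q \<in> carrier (Zpoly m)" for p q
  proof -
    have "t \<notin> keys (q * p)" if t: "keys t \<in> K" for t
    proof
      assume "t \<in> keys (q * p)"
      then obtain a b where *: "t = a + b" "a \<in> keys q" "b \<in> keys p" "keys t = keys a \<union> keys b"
        by (rule keys_mult_monomial)
      then have "keys b \<in> K" using subset_closedD[OF assms t] by simp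
      then show False using * \<open>p \<in> monomial_ideal m K\<close> by (simp add: monomial_ideal_def in_keys_iff)
    qed
    then show ?thesis
      using that by (simp add: monomial_ideal_def Zpoly_mult_closed in_keys_iff)
  qed
  show ?thesis
  proof (rule idealI)
    show "subgroup (monomial_ideal m K) (add_monoid (Zpoly m))"
    proof (rule R.add.subgroupI)
      show "monomial_ideal m K \<noteq> {}"
        using R.zero_closed by (auto simp: monomial_ideal_def)
      show "\<ominus>\<^bsub>Zpoly m\<^esub> p \<in> monomial_ideal m K" if "p \<in> monomial_ideal m K" for p
        using that uminus[of p] by (simp add: monomial_ideal_def Zpoly_uminus_closed)
    qed (auto simp: monomial_ideal_def lookup_add Zpoly_add_closed)
  qed (use mult in \<open>simp_all add: R.ring_axioms mult.commute\<close>)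
qed

lemma SR_ideal_eq:
  assumes "subset_closed K"
  shows "SR_ideal m K = monomial_ideal m K"
proof
  interpret R: cring "Zpoly m" by (rule cring_Zpoly)
  let ?S = "{\<Prod>i\<in>I. pvar i | I. I \<subseteq> {1..m} \<and> I \<notin> K}"
  have gen: "(\<Prod>i\<in>I. pvar i) \<in> monomial_ideal m K" if "I \<subseteq> {1..m}" "I \<notin> K" for I
  proof -
    have "finite I" using that(1) by (rule finite_subset) simp
    then show ?thesis
      using that
      by (auto simp: prod_pvar monomial_ideal_def Zpoly_carrier_iff lookup_single when_def keys_sqfree_monomial)
  qed
  then show "SR_ideal m K \<subseteq> monomial_ideal m K"
    unfolding SR_ideal_def by (intro R.genideal_minimal ideal_monomial_ideal[OF assms]) auto
  have S: "?S \<subseteq> carrier (Zpoly m)"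
    using gen by (auto simp: monomial_ideal_def)
  then interpret I: ideal "SR_ideal m K" "Zpoly m"
    unfolding SR_ideal_def by (rule R.genideal_ideal)
  have "p \<in> monomial_ideal m K \<longrightarrow> p \<in> SR_ideal m K" for p
  proof (induction p rule: update_induct)
    case const
    then show ?case using I.zero_closed by simp
  next
    case (update p t c)
    have upd: "Poly_Mapping.update t c p = Poly_Mapping.single t c + p"
      using update(1) by (intro poly_mapping_eqI) (auto simp: lookup_update lookup_add lookup_single when_def in_keys_iff)
    show ?case
    proof
      assume q: "Poly_Mapping.update t c p \<in> monomial_ideal m K"
      have "lookup p u \<noteq> 0 \<Longrightarrow> lookup (Poly_Mapping.update t c p) u \<noteq> 0" for u
        using update(2) by (auto simp: lookup_update)
      then have "p \<in> monomial_ideal m K"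
        using q by (simp add: monomial_ideal_def Zpoly_carrier_iff) blast
      then have p: "p \<in> SR_ideal m K" using update by simp
      have t: "keys t \<subseteq> {1..m}" "keys t \<notin> K"
        using q update(2) by (auto simp: monomial_ideal_def Zpoly_carrier_iff lookup_update)
      \<comment> \<open>A monomial whose support is no simplex is \<open>?u\<close> times the
        squarefree generator on its support.\<close>
      let ?u = "t - sqfree_monomial (keys t)"
      have "?u + sqfree_monomial (keys t) = t"
        by (intro poly_mapping_eqI) (auto simp: lookup_add lookup_minus lookup_sqfree_monomial in_keys_iff)
      then have "Poly_Mapping.single ?u c * (\<Prod>i\<in>keys t. pvar i) = Poly_Mapping.single t c"
        by (simp add: prod_pvar mult_single)
      moreover have "(\<Prod>i\<in>keys t. pvar i) \<in> SR_ideal m K"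
        using R.genideal_self[OF S] t unfolding SR_ideal_def by blast
      moreover have "Poly_Mapping.single ?u c \<in> carrier (Zpoly m)"
        using t(1) keys_minus_subset[of t] by (auto simp: Zpoly_carrier_iff lookup_single when_def)
      ultimately have "Poly_Mapping.single t c \<in> SR_ideal m K"
        using I.I_l_closed by fastforce
      then show "Poly_Mapping.update t c p \<in> SR_ideal m K"
        unfolding upd using I.a_closed[OF _ p] by simp
    qed
  qed
  then show "monomial_ideal m K \<subseteq> SR_ideal m K" by blast
qed

text \<open>Any representative will do, since elements of the ideal have zero coefficients at
  monomials supported on simplices. The dummy index of type \<open>unit\<close> gives \<int>[K] the
  coordinates of a module with one generator, the shape that the Koszul lemmas expect.\<close>

definition SR_coords :: "nat set set \<Rightarrow> int_mpoly set \<Rightarrow> unit \<times> monomial \<Rightarrow> int" where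
  "SR_coords K C = (\<lambda>(u, t). if keys t \<in> K then lookup (SOME p. p \<in> C) t else 0)"

context
  fixes m :: nat and K :: "nat set set"
  assumes K: "subset_closed K" "K \<subseteq> Pow {1..m}"
begin

lemma ideal_SR: "ideal (SR_ideal m K) (Zpoly m)"
  unfolding SR_ideal_eq[OF K(1)] by (rule ideal_monomial_ideal[OF K(1)])

lemma SR_coords_coset:
  assumes "p \<in> carrier (Zpoly m)"
  shows "SR_coords K (SR_ideal m K +>\<^bsub>Zpoly m\<^esub> p) = (\<lambda>(u, t). if keys t \<in> K then lookup p t else 0)"
proof -
  interpret I: ideal "SR_ideal m K" "Zpoly m" by (rule ideal_SR)
  let ?C = "SR_ideal m K +>\<^bsub>Zpoly m\<^esub> p"
  define q where "q = (SOME p. p \<in> ?C)"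
  have "q \<in> ?C"
    unfolding q_def by (rule someI[of "\<lambda>p. p \<in> ?C"]) (rule I.a_rcos_self[OF assms])
  then have "\<exists>h\<in>SR_ideal m K. q = h + p"
    unfolding a_r_coset_def' Zpoly_simps by blast
  then obtain h where h: "h \<in> SR_ideal m K" "q = h + p"
    by blast
  have "lookup h t = 0" if "keys t \<in> K" for t
    using h(1) that unfolding SR_ideal_eq[OF K(1)] monomial_ideal_def by blast
  then show ?thesis
    unfolding SR_coords_def q_def[symmetric] h(2) by (simp add: fun_eq_iff lookup_add)
qed

lemma SR_module_carrier:
  assumes "C \<in> carrier (SR_module m K)"
  obtains p where "p \<in> carrier (Zpoly m)" "C = SR_ideal m K +>\<^bsub>Zpoly m\<^esub> p"
  using assms by (auto simp: SR_module_def restrict_scalars_def SR_ring_def FactRing_def A_RCOSETS_def')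

lemma SR_coset_closed:
  assumes "p \<in> carrier (Zpoly m)"
  shows "SR_ideal m K +>\<^bsub>Zpoly m\<^esub> p \<in> carrier (SR_module m K)"
  using assms by (auto simp: SR_module_def restrict_scalars_def SR_ring_def FactRing_def A_RCOSETS_def')

lemma SR_module_add:
  assumes "p \<in> carrier (Zpoly m)" "q \<in> carrier (Zpoly m)"
  shows "(SR_ideal m K +>\<^bsub>Zpoly m\<^esub> p) \<oplus>\<^bsub>SR_module m K\<^esub> (SR_ideal m K +>\<^bsub>Zpoly m\<^esub> q) =
    SR_ideal m K +>\<^bsub>Zpoly m\<^esub> (p + q)"
  using ideal.a_rcos_sum[OF ideal_SR assms]
  by (simp add: SR_module_def restrict_scalars_def SR_ring_def FactRing_def)

lemma SR_module_smult:
  assumes "p \<in> carrier (Zpoly m)" "q \<in> carrier (Zpoly m)"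
  shows "p \<odot>\<^bsub>SR_module m K\<^esub> (SR_ideal m K +>\<^bsub>Zpoly m\<^esub> q) = SR_ideal m K +>\<^bsub>Zpoly m\<^esub> (p * q)"
  using ideal.rcoset_mult_add[OF ideal_SR assms]
  by (simp add: SR_module_def restrict_scalars_def SR_ring_def FactRing_def)

lemma SR_module_zero: "\<zero>\<^bsub>SR_module m K\<^esub> = SR_ideal m K"
  by (simp add: SR_module_def restrict_scalars_def SR_ring_def FactRing_def)

lemma SR_coords_add:
  assumes "C \<in> carrier (SR_module m K)" "C' \<in> carrier (SR_module m K)"
  shows "SR_coords K (C \<oplus>\<^bsub>SR_module m K\<^esub> C') = SR_coords K C + SR_coords K C'"
proof -
  obtain p q where *: "p \<in> carrier (Zpoly m)" "C = SR_ideal m K +>\<^bsub>Zpoly m\<^esub> p"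
      "q \<in> carrier (Zpoly m)" "C' = SR_ideal m K +>\<^bsub>Zpoly m\<^esub> q"
    using assms by (elim SR_module_carrier)
  show ?thesis
    using * by (auto simp: SR_module_add SR_coords_coset Zpoly_add_closed fun_eq_iff
        fun_arith_apply lookup_add)
qed

lemma SR_coords_pvar:
  assumes "C \<in> carrier (SR_module m K)" "i \<in> {1..m}"
  shows "SR_coords K (pvar i \<odot>\<^bsub>SR_module m K\<^esub> C) = mulvar K i (SR_coords K C)"
proof -
  obtain p where p: "p \<in> carrier (Zpoly m)" "C = SR_ideal m K +>\<^bsub>Zpoly m\<^esub> p"
    using assms(1) by (elim SR_module_carrier)
  have down: "keys (t - Poly_Mapping.single i 1) \<in> K" if "keys t \<in> K" for t :: monomial
    using subset_closedD[OF K(1) that keys_minus_subset] .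
  show ?thesis
    unfolding p(2) SR_module_smult[OF pvar_closed[OF assms(2)] p(1)] SR_coords_coset[OF p(1)]
      SR_coords_coset[OF Zpoly_mult_closed[OF pvar_closed[OF assms(2)] p(1)]]
    using down by (simp add: mulvar_def fun_eq_iff lookup_pvar_mult)
qed

lemma SR_coords_image: "SR_coords K ` carrier (SR_module m K) = monfun UNIV K"
proof
  show "SR_coords K ` carrier (SR_module m K) \<subseteq> monfun UNIV K"
  proof safe
    fix C assume "C \<in> carrier (SR_module m K)"
    then obtain p where p: "p \<in> carrier (Zpoly m)" "C = SR_ideal m K +>\<^bsub>Zpoly m\<^esub> p"
      by (elim SR_module_carrier)
    have "{x. SR_coords K C x \<noteq> 0} \<subseteq> UNIV \<times> keys p"
      unfolding p(2) SR_coords_coset[OF p(1)] by (auto simp: in_keys_iff)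
    then have "finite {x. SR_coords K C x \<noteq> 0}" by (rule finite_subset) simp
    then show "SR_coords K C \<in> monfun UNIV K"
      unfolding monfun_def p(2) SR_coords_coset[OF p(1)] by auto
  qed
  show "monfun UNIV K \<subseteq> SR_coords K ` carrier (SR_module m K)"
  proof
    fix f :: "unit \<times> monomial \<Rightarrow> int" assume f: "f \<in> monfun UNIV K"
    have lookup: "lookup (Abs_poly_mapping (\<lambda>t. f ((), t))) t = f ((), t)" for t
      using monfun_finite_fibre[OF f] by (simp add: Abs_poly_mapping_inverse)
    have p: "Abs_poly_mapping (\<lambda>t. f ((), t)) \<in> carrier (Zpoly m)"
      using f K(2) unfolding Zpoly_carrier_iff lookup monfun_def by blast
    show "f \<in> SR_coords K ` carrier (SR_module m K)"
    proof (rule image_eqI[OF _ SR_coset_closed[OF p]])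
      show "f = SR_coords K (SR_ideal m K +>\<^bsub>Zpoly m\<^esub> Abs_poly_mapping (\<lambda>t. f ((), t)))"
        unfolding SR_coords_coset[OF p] using f by (auto simp: lookup monfun_def fun_eq_iff)
    qed
  qed
qed

lemma SR_coords_eq_0_iff:
  assumes "C \<in> carrier (SR_module m K)"
  shows "SR_coords K C = 0 \<longleftrightarrow> C = \<zero>\<^bsub>SR_module m K\<^esub>"
proof -
  obtain p where p: "p \<in> carrier (Zpoly m)" "C = SR_ideal m K +>\<^bsub>Zpoly m\<^esub> p"
    using assms(1) by (elim SR_module_carrier)
  have "SR_coords K C = 0 \<longleftrightarrow> (\<forall>t. keys t \<in> K \<longrightarrow> lookup p t = 0)"
    unfolding p(2) SR_coords_coset[OF p(1)] by (simp add: fun_eq_iff fun_arith_apply)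
  also have "\<dots> \<longleftrightarrow> p \<in> SR_ideal m K"
    unfolding SR_ideal_eq[OF K(1)] monomial_ideal_def using p(1) by blast
  also have "\<dots> \<longleftrightarrow> C = SR_ideal m K"
  proof -
    interpret I: ideal "SR_ideal m K" "Zpoly m" by (rule ideal_SR)
    show ?thesis
      unfolding p(2) using I.a_rcos_const I.a_rcos_self[OF p(1)] by metis
  qed
  finally show ?thesis unfolding SR_module_zero .
qed

end

section \<open>Coordinates on a free module with a chosen basis\<close>

locale based_module =
  fixes m :: nat and M :: "(int_mpoly, 'f) module" and B :: "'f set"
  assumes mod: "module (Zpoly m) M" and basis: "module_basis (Zpoly m) M B"
begin

sublocale M: module "Zpoly m" M by (rule mod)

definition coeffs_on :: "('f \<Rightarrow> int_mpoly) \<Rightarrow> bool" where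
  "coeffs_on c \<longleftrightarrow> c \<in> UNIV \<rightarrow> carrier (Zpoly m) \<and> {b. c b \<noteq> 0} \<subseteq> B \<and> finite {b. c b \<noteq> 0}"

definition comb :: "('f \<Rightarrow> int_mpoly) \<Rightarrow> 'f" where
  "comb c = (\<Oplus>\<^bsub>M\<^esub>b\<in>{b. c b \<noteq> 0}. c b \<odot>\<^bsub>M\<^esub> b)"

lemma ex1_coeffs: "x \<in> carrier M \<Longrightarrow> \<exists>!c. coeffs_on c \<and> x = comb c"
  using basis unfolding module_basis_def coeffs_on_def comb_def by (simp add: conj_assoc)

lemma coeffs_onD: "coeffs_on c \<Longrightarrow> c b \<in> carrier (Zpoly m)" "coeffs_on c \<Longrightarrow> c b \<noteq> 0 \<Longrightarrow> b \<in> carrier M"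
  using basis by (auto simp: coeffs_on_def module_basis_def)

lemma comb_superset:
  assumes "coeffs_on c" "finite T" "{b. c b \<noteq> 0} \<subseteq> T" "T \<subseteq> B"
  shows "comb c = (\<Oplus>\<^bsub>M\<^esub>b\<in>T. c b \<odot>\<^bsub>M\<^esub> b)"
  unfolding comb_def
proof (rule M.add.finprod_mono_neutral_cong_left[OF assms(2,3)])
  have T: "T \<subseteq> carrier M" using assms(4) basis by (auto simp: module_basis_def)
  show "(\<lambda>b. c b \<odot>\<^bsub>M\<^esub> b) \<in> T \<rightarrow> carrier M"
    using T coeffs_onD(1)[OF assms(1)] by auto
  show "c b \<odot>\<^bsub>M\<^esub> b = \<zero>\<^bsub>M\<^esub>" if "b \<in> T - {b. c b \<noteq> 0}" for b
    using that T M.smult_l_null[of b] by auto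
qed simp

lemma comb_closed: "coeffs_on c \<Longrightarrow> comb c \<in> carrier M"
  unfolding comb_def by (rule M.finsum_closed) (auto intro: coeffs_onD)

lemma coeffs_on_add:
  assumes "coeffs_on c" "coeffs_on c'"
  shows "coeffs_on (\<lambda>b. c b + c' b)" "comb (\<lambda>b. c b + c' b) = comb c \<oplus>\<^bsub>M\<^esub> comb c'"
proof -
  let ?T = "{b. c b \<noteq> 0} \<union> {b. c' b \<noteq> 0}"
  have T: "finite ?T" "?T \<subseteq> B" using assms by (auto simp: coeffs_on_def)
  have sub: "{b. c b + c' b \<noteq> 0} \<subseteq> ?T" by auto
  show *: "coeffs_on (\<lambda>b. c b + c' b)"
    using assms T finite_subset[OF sub T(1)] sub
    by (auto simp: coeffs_on_def Zpoly_add_closed Pi_iff)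
  have carr: "b \<in> carrier M" if "b \<in> ?T" for b
    using that assms by (auto intro: coeffs_onD)
  have "comb (\<lambda>b. c b + c' b) = (\<Oplus>\<^bsub>M\<^esub>b\<in>?T. (c b + c' b) \<odot>\<^bsub>M\<^esub> b)"
    by (rule comb_superset[OF * T(1) sub T(2)])
  also have "\<dots> = (\<Oplus>\<^bsub>M\<^esub>b\<in>?T. c b \<odot>\<^bsub>M\<^esub> b \<oplus>\<^bsub>M\<^esub> c' b \<odot>\<^bsub>M\<^esub> b)"
  proof (rule M.finsum_cong'[OF refl])
    fix b assume "b \<in> ?T"
    then show "(c b + c' b) \<odot>\<^bsub>M\<^esub> b = c b \<odot>\<^bsub>M\<^esub> b \<oplus>\<^bsub>M\<^esub> c' b \<odot>\<^bsub>M\<^esub> b"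
      using M.smult_l_distr[of "c b" "c' b" b] carr assms by (simp add: coeffs_onD(1))
  qed (use carr assms in \<open>auto simp: coeffs_onD(1)\<close>)
  also have "\<dots> = comb c \<oplus>\<^bsub>M\<^esub> comb c'"
    using comb_superset[OF assms(1) T(1) _ T(2)] comb_superset[OF assms(2) T(1) _ T(2)] carr assms
    by (simp add: M.finsum_addf Pi_iff coeffs_onD(1))
  finally show "comb (\<lambda>b. c b + c' b) = comb c \<oplus>\<^bsub>M\<^esub> comb c'" .
qed

lemma coeffs_on_smult:
  assumes "coeffs_on c" "p \<in> carrier (Zpoly m)"
  shows "coeffs_on (\<lambda>b. p * c b)" "comb (\<lambda>b. p * c b) = p \<odot>\<^bsub>M\<^esub> comb c"
proof -
  let ?T = "{b. c b \<noteq> 0}"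
  have T: "finite ?T" "?T \<subseteq> B" using assms by (auto simp: coeffs_on_def)
  have sub: "{b. p * c b \<noteq> 0} \<subseteq> ?T" by auto
  show *: "coeffs_on (\<lambda>b. p * c b)"
    using assms T finite_subset[OF sub T(1)] sub
    by (auto simp: coeffs_on_def Zpoly_mult_closed Pi_iff)
  have carr: "b \<in> carrier M" if "b \<in> ?T" for b
    using that assms by (auto intro: coeffs_onD)
  have "comb (\<lambda>b. p * c b) = (\<Oplus>\<^bsub>M\<^esub>b\<in>?T. (p * c b) \<odot>\<^bsub>M\<^esub> b)"
    by (rule comb_superset[OF * T(1) sub T(2)])
  also have "\<dots> = (\<Oplus>\<^bsub>M\<^esub>b\<in>?T. p \<odot>\<^bsub>M\<^esub> (c b \<odot>\<^bsub>M\<^esub> b))"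
  proof (rule M.finsum_cong'[OF refl])
    fix b assume "b \<in> ?T"
    then show "(p * c b) \<odot>\<^bsub>M\<^esub> b = p \<odot>\<^bsub>M\<^esub> (c b \<odot>\<^bsub>M\<^esub> b)"
      using M.smult_assoc1[of p "c b" b] carr assms by (simp add: coeffs_onD(1))
  qed (use carr assms in \<open>auto simp: coeffs_onD(1)\<close>)
  also have "\<dots> = p \<odot>\<^bsub>M\<^esub> comb c"
    unfolding comb_def using carr assms
    by (intro M.finsum_smult_ldistr[OF T(1), symmetric]) (auto simp: coeffs_onD(1))
  finally show "comb (\<lambda>b. p * c b) = p \<odot>\<^bsub>M\<^esub> comb c" .
qed

definition coeffs :: "'f \<Rightarrow> 'f \<Rightarrow> int_mpoly" where
  "coeffs x = (THE c. coeffs_on c \<and> x = comb c)"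

lemma coeffs: assumes "x \<in> carrier M" shows "coeffs_on (coeffs x)" "comb (coeffs x) = x"
  using theI'[OF ex1_coeffs[OF assms]] unfolding coeffs_def by auto

lemma coeffs_comb: "coeffs_on c \<Longrightarrow> coeffs (comb c) = c"
  using ex1_coeffs[OF comb_closed] coeffs[OF comb_closed] by blast

definition coords :: "'f \<Rightarrow> 'f \<times> monomial \<Rightarrow> int" where
  "coords x = (\<lambda>(b, t). lookup (coeffs x b) t)"

definition of_coords :: "('f \<times> monomial \<Rightarrow> int) \<Rightarrow> 'f" where
  "of_coords f = comb (\<lambda>b. Abs_poly_mapping (\<lambda>t. f (b, t)))"

abbreviation coord_space :: "('f \<times> monomial \<Rightarrow> int) set" where
  "coord_space \<equiv> monfun B (Pow {1..m})"

lemma coords_closed: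
  assumes "x \<in> carrier M" shows "coords x \<in> coord_space"
proof -
  note c = coeffs(1)[OF assms]
  have "{p. coords x p \<noteq> 0} = (SIGMA b:{b. coeffs x b \<noteq> 0}. keys (coeffs x b))"
    by (auto simp: coords_def in_keys_iff)
  then have "finite {p. coords x p \<noteq> 0}"
    using c by (auto simp: coeffs_on_def)
  then show ?thesis
    using c coeffs_onD(1)[OF c] unfolding monfun_def
    by (auto simp: coords_def coeffs_on_def Zpoly_carrier_iff)
qed

lemma lookup_Abs_coords:
  assumes "f \<in> coord_space"
  shows "lookup (Abs_poly_mapping (\<lambda>t. f (b, t))) t = f (b, t)"
  using monfun_finite_fibre[OF assms] by (simp add: Abs_poly_mapping_inverse)

lemma coeffs_on_coords:
  assumes "f \<in> coord_space"
  shows "coeffs_on (\<lambda>b. Abs_poly_mapping (\<lambda>t. f (b, t)))"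
proof -
  have nz: "Abs_poly_mapping (\<lambda>t. f (b, t)) \<noteq> 0 \<longleftrightarrow> (\<exists>t. f (b, t) \<noteq> 0)" for b
    using lookup_Abs_coords[OF assms, of b] by (metis lookup_zero poly_mapping_eqI)
  have "{b. \<exists>t. f (b, t) \<noteq> 0} = fst ` {x. f x \<noteq> 0}"
    by (auto simp: image_iff)
  then show ?thesis
    using assms unfolding coeffs_on_def nz
    by (auto simp: Zpoly_carrier_iff lookup_Abs_coords[OF assms] monfun_def)
qed

lemma of_coords_closed: "f \<in> coord_space \<Longrightarrow> of_coords f \<in> carrier M"
  unfolding of_coords_def by (intro comb_closed coeffs_on_coords)

lemma coords_of_coords:
  assumes "f \<in> coord_space" shows "coords (of_coords f) = f"
  unfolding coords_def of_coords_def coeffs_comb[OF coeffs_on_coords[OF assms]]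
  by (auto simp: fun_eq_iff lookup_Abs_coords[OF assms])

lemma of_coords_coords:
  assumes "x \<in> carrier M" shows "of_coords (coords x) = x"
  using coeffs(2)[OF assms] by (simp add: of_coords_def coords_def)

lemma coords_add:
  assumes "x \<in> carrier M" "y \<in> carrier M"
  shows "coords (x \<oplus>\<^bsub>M\<^esub> y) = coords x + coords y"
proof -
  have "coeffs (x \<oplus>\<^bsub>M\<^esub> y) = (\<lambda>b. coeffs x b + coeffs y b)"
    using coeffs_comb coeffs_on_add[OF coeffs(1)[OF assms(1)] coeffs(1)[OF assms(2)]] assms
    by (metis coeffs(2))
  then show ?thesis by (auto simp: coords_def fun_eq_iff fun_arith_apply lookup_add)
qed

lemma coords_pvar:
  assumes "x \<in> carrier M" "i \<in> {1..m}"
  shows "coords (pvar i \<odot>\<^bsub>M\<^esub> x) = mulvar (Pow {1..m}) i (coords x)"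
proof -
  have p: "pvar i \<in> carrier (Zpoly m)" by (rule pvar_closed[OF assms(2)])
  have eq: "coeffs (pvar i \<odot>\<^bsub>M\<^esub> x) = (\<lambda>b. pvar i * coeffs x b)"
    using coeffs_comb coeffs_on_smult[OF coeffs(1)[OF assms(1)] p] assms by (metis coeffs(2))
  have "lookup (pvar i * coeffs x b) t = mulvar (Pow {1..m}) i (coords x) (b, t)" for b t
  proof (cases "keys t \<subseteq> {1..m}")
    case True
    then show ?thesis by (simp add: coords_def mulvar_def lookup_pvar_mult del: atLeastAtMost_iff)
  next
    case False
    then have "lookup (pvar i * coeffs x b) t = 0"
      using Zpoly_mult_closed[OF p coeffs_onD(1)[OF coeffs(1)[OF assms(1)], of b]]
      unfolding Zpoly_carrier_iff by blast
    then show ?thesis using False by (simp add: mulvar_def)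
  qed
  then show ?thesis
    by (simp add: fun_eq_iff coords_def eq)
qed

lemma of_coords_add:
  assumes "f \<in> coord_space" "g \<in> coord_space"
  shows "of_coords (f + g) = of_coords f \<oplus>\<^bsub>M\<^esub> of_coords g"
  using of_coords_coords[of "of_coords f \<oplus>\<^bsub>M\<^esub> of_coords g"] coords_add[of "of_coords f" "of_coords g"] assms
  by (simp add: of_coords_closed coords_of_coords)

lemma of_coords_mulvar:
  assumes "f \<in> coord_space" "i \<in> {1..m}"
  shows "of_coords (mulvar (Pow {1..m}) i f) = pvar i \<odot>\<^bsub>M\<^esub> of_coords f"
  using of_coords_coords[of "pvar i \<odot>\<^bsub>M\<^esub> of_coords f"] coords_pvar[of "of_coords f" i] assms
    M.smult_closed[OF pvar_closed[OF assms(2)]]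
  by (simp add: of_coords_closed coords_of_coords)

lemma coords_zero: "coords \<zero>\<^bsub>M\<^esub> = 0"
  using coords_add[of "\<zero>\<^bsub>M\<^esub>" "\<zero>\<^bsub>M\<^esub>"] by simp

lemma coords_eq_0_iff: "x \<in> carrier M \<Longrightarrow> coords x = 0 \<longleftrightarrow> x = \<zero>\<^bsub>M\<^esub>"
  using of_coords_coords[of x] of_coords_coords[of "\<zero>\<^bsub>M\<^esub>"] coords_zero by auto

end

section \<open>Tensoring with the integers\<close>

lemma (in comm_group) torsion_free_FactGroup:
  assumes H: "subgroup H G"
    and tf: "\<And>x k. x \<in> carrier G \<Longrightarrow> (k::nat) > 0 \<Longrightarrow> x [^] k \<in> H \<Longrightarrow> x \<in> H"
  shows "torsion_free (G Mod H)"
  unfolding torsion_free_def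
proof (intro ballI allI impI)
  interpret N: normal H G by (rule subgroup_imp_normal[OF H])
  fix C k assume C: "C \<in> carrier (G Mod H)" and k: "k > (0::nat)"
    and pow: "C [^]\<^bsub>G Mod H\<^esub> k = \<one>\<^bsub>G Mod H\<^esub>"
  obtain x where x: "x \<in> carrier G" "C = H #> x"
    using C by (auto simp: carrier_FactGroup)
  have "(H #> x) [^]\<^bsub>G Mod H\<^esub> k = H #> (x [^] k)"
  proof (induction k)
    case 0
    then show ?case using coset_join2[OF one_closed H N.one_closed] by (simp add: nat_pow_def)
  next
    case (Suc k)
    have "(H #> x) [^]\<^bsub>G Mod H\<^esub> Suc k = (H #> x) [^]\<^bsub>G Mod H\<^esub> k <#> (H #> x)"
      by (simp add: nat_pow_def)
    then show ?case
      using x(1) by (simp add: Suc.IH N.rcos_sum)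
  qed
  then have "H #> (x [^] k) = H" using pow x(2) by simp
  then have "x [^] k \<in> H" using nat_pow_closed[OF x(1)] H by (rule coset_join1)
  then have "x \<in> H" using tf x(1) k by blast
  then show "C = \<one>\<^bsub>G Mod H\<^esub>"
    using x H by (simp add: coset_join2)
qed

lemma torsion_free_sum_group:
  assumes G: "\<And>i. group (G i)" "\<And>i. torsion_free (G i)"
  shows "torsion_free (sum_group UNIV G)"
  unfolding torsion_free_def
proof (intro ballI allI impI)
  fix x k assume x: "x \<in> carrier (sum_group UNIV G)" and k: "k > (0::nat)"
    and pow: "x [^]\<^bsub>sum_group UNIV G\<^esub> k = \<one>\<^bsub>sum_group UNIV G\<^esub>"
  have "(x [^]\<^bsub>sum_group UNIV G\<^esub> k) i = x i [^]\<^bsub>G i\<^esub> k" for i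
    by (induction k) (simp_all add: nat_pow_def)
  then have "x i [^]\<^bsub>G i\<^esub> k = \<one>\<^bsub>G i\<^esub>" for i
    using pow by (metis UNIV_I one_sum_group restrict_apply)
  moreover have "x i \<in> carrier (G i)" for i
    using x G(1) by (auto simp: carrier_sum_group)
  ultimately have "x i = \<one>\<^bsub>G i\<^esub>" for i
    using G(2) k unfolding torsion_free_def by blast
  then show "x = \<one>\<^bsub>sum_group UNIV G\<^esub>"
    by (simp add: fun_eq_iff)
qed

lemma Z_module_simps [simp]:
  "carrier Z_module = UNIV" "z \<oplus>\<^bsub>Z_module\<^esub> z' = z + z'" "p \<odot>\<^bsub>Z_module\<^esub> z = lookup p 0 * z"
  by (simp_all add: Z_module_def restrict_scalars_def)

context based_module
begin

abbreviation pairs :: "('f \<times> int) set" where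
  "pairs \<equiv> carrier M \<times> carrier Z_module"

abbreviation tnull :: "('f \<times> int \<Rightarrow>\<^sub>0 int) set" where
  "tnull \<equiv> tensor_null (Zpoly m) M Z_module"

text \<open>These integers are the coordinates of \<open>x \<otimes> 1\<close> in the tensor product
  with \<int>, as \<open>cls_eq_iff\<close> shows: variables act by 0 there, so only constant
  coefficients survive.\<close>

definition constant_term :: "'f \<Rightarrow> 'f \<Rightarrow> int" where
  "constant_term x b = coords x (b, 0)"

lemma constant_term_add:
  "x \<in> carrier M \<Longrightarrow> y \<in> carrier M \<Longrightarrow> constant_term (x \<oplus>\<^bsub>M\<^esub> y) b = constant_term x b + constant_term y b"
  by (simp add: constant_term_def coords_add fun_arith_apply)

lemma constant_term_smult:
  assumes "p \<in> carrier (Zpoly m)" "x \<in> carrier M"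
  shows "constant_term (p \<odot>\<^bsub>M\<^esub> x) b = lookup p 0 * constant_term x b"
proof -
  have "coeffs (p \<odot>\<^bsub>M\<^esub> x) = (\<lambda>b. p * coeffs x b)"
    using coeffs_comb coeffs_on_smult[OF coeffs(1)[OF assms(2)] assms(1)] assms by (metis coeffs(2))
  moreover have "lookup (p * q) 0 = lookup p 0 * lookup q 0" for q :: int_mpoly
  proof -
    have "0 = s + t \<longleftrightarrow> s = 0 \<and> t = 0" for s t :: monomial
    proof
      assume "0 = s + t"
      then have "keys (s + t) = {}" by simp
      then show "s = 0 \<and> t = 0" unfolding keys_plus_monomial by simp
    qed simp
    then have "(\<Sum>u. lookup q u when 0 = s + u) = (lookup q 0 when s = 0)" for s
      by (cases "s = 0") simp_all
    then show ?thesis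
      by (simp add: lookup_mult mult_when)
  qed
  ultimately show ?thesis by (simp add: constant_term_def coords_def)
qed

text \<open>\<open>M \<otimes> \<int> \<rightarrow> \<int>, x \<otimes> z \<mapsto> z * constant_term x b\<close>; the detour through \<open>unit\<close> gives access
  to the library on homomorphisms of free abelian groups.\<close>

definition tensor_eval :: "'f \<Rightarrow> ('f \<times> int \<Rightarrow>\<^sub>0 int) \<Rightarrow> int" where
  "tensor_eval b c = lookup (frag_extend (\<lambda>(x, z). frag_cmul (z * constant_term x b) (frag_of ())) c) ()"

lemma tensor_eval_simps:
  "tensor_eval b 0 = 0" "tensor_eval b (c + c') = tensor_eval b c + tensor_eval b c'"
  "tensor_eval b (c - c') = tensor_eval b c - tensor_eval b c'" "tensor_eval b (- c) = - tensor_eval b c"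
  "tensor_eval b (frag_of (x, z)) = z * constant_term x b"
  by (simp_all add: tensor_eval_def frag_extend_add frag_extend_diff frag_extend_minus lookup_add lookup_minus)

lemma relators_closed:
  assumes "r \<in> tensor_relators (Zpoly m) M Z_module"
  shows "keys r \<subseteq> pairs"
proof -
  have two: "keys (frag_of a - frag_of b) \<subseteq> pairs" if "a \<in> pairs" "b \<in> pairs"
    for a b :: "'f \<times> int"
    using that keys_diff[of "frag_of a" "frag_of b"] by (auto simp: keys_frag_of)
  have three: "keys (frag_of a - frag_of b - frag_of c) \<subseteq> pairs"
    if "a \<in> pairs" "b \<in> pairs" "c \<in> pairs" for a b c :: "'f \<times> int"
    using that keys_diff[of "frag_of a - frag_of b" "frag_of c"] two[of a b] by (auto simp: keys_frag_of)
  show ?thesis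
    using assms unfolding tensor_relators_def
    by (elim UnE CollectE exE conjE; simp only:; intro two three; simp)
qed

lemma tnull_subgroup: "subgroup tnull (free_Abelian_group pairs)"
  unfolding tensor_null_def using relators_closed
  by (intro group.generate_is_subgroup) auto

lemma tnull_simps:
  "0 \<in> tnull" "c \<in> tnull \<Longrightarrow> c' \<in> tnull \<Longrightarrow> c + c' \<in> tnull" "c \<in> tnull \<Longrightarrow> - c \<in> tnull"
  "c \<in> tnull \<Longrightarrow> c' \<in> tnull \<Longrightarrow> c - c' \<in> tnull" "c \<in> tnull \<Longrightarrow> keys c \<subseteq> pairs"
proof -
  note s = tnull_subgroup
  show "0 \<in> tnull" using subgroup.one_closed[OF s] by simp
  show add: "c \<in> tnull \<Longrightarrow> c' \<in> tnull \<Longrightarrow> c + c' \<in> tnull" for c c'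
    using subgroup.m_closed[OF s] by simp
  show keys: "c \<in> tnull \<Longrightarrow> keys c \<subseteq> pairs" for c
    using subgroup.mem_carrier[OF s] by simp
  show uminus: "c \<in> tnull \<Longrightarrow> - c \<in> tnull" for c
    using subgroup.m_inv_closed[OF s, of c] keys[of c] by simp
  show "c \<in> tnull \<Longrightarrow> c' \<in> tnull \<Longrightarrow> c - c' \<in> tnull"
    using add[of c "- c'"] uminus[of c'] by simp
qed

lemma tnull_relators:
  "x \<in> carrier M \<Longrightarrow> x' \<in> carrier M \<Longrightarrow>
    frag_of (x \<oplus>\<^bsub>M\<^esub> x', z) - frag_of (x, z) - frag_of (x', z) \<in> tnull"
  "x \<in> carrier M \<Longrightarrow> frag_of (x, z + z') - frag_of (x, z) - frag_of (x, z') \<in> tnull"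
  "p \<in> carrier (Zpoly m) \<Longrightarrow> x \<in> carrier M \<Longrightarrow>
    frag_of (p \<odot>\<^bsub>M\<^esub> x, z) - frag_of (x, lookup p 0 * z) \<in> tnull"
proof -
  have incl: "r \<in> tensor_relators (Zpoly m) M Z_module \<Longrightarrow> r \<in> tnull" for r
    unfolding tensor_null_def by (rule generate.incl)
  show "frag_of (x \<oplus>\<^bsub>M\<^esub> x', z) - frag_of (x, z) - frag_of (x', z) \<in> tnull"
    if "x \<in> carrier M" "x' \<in> carrier M"
    using that by (intro incl) (force simp: tensor_relators_def)
  show "frag_of (x, z + z') - frag_of (x, z) - frag_of (x, z') \<in> tnull" if "x \<in> carrier M"
    using that by (intro incl) (force simp: tensor_relators_def)
  show "frag_of (p \<odot>\<^bsub>M\<^esub> x, z) - frag_of (x, lookup p 0 * z) \<in> tnull"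
    if "p \<in> carrier (Zpoly m)" "x \<in> carrier M"
    using that by (intro incl) (force simp: tensor_relators_def)
qed

text \<open>Moving a polynomial across the tensor sign is respected because it acts on \<int>
  through its constant term and taking constant terms is multiplicative.\<close>

lemma tensor_eval_tnull:
  assumes "c \<in> tnull" shows "tensor_eval b c = 0"
proof -
  have rel: "tensor_eval b r = 0" if "r \<in> tensor_relators (Zpoly m) M Z_module" for r
    using that unfolding tensor_relators_def
    by (elim UnE CollectE exE conjE)
      (simp_all add: tensor_eval_simps constant_term_add constant_term_smult distrib_left
        distrib_right mult_ac)
  show ?thesis
    using assms unfolding tensor_null_def
  proof (induction rule: generate.induct)
    case (inv h)
    then show ?case using rel[OF inv] relators_closed[OF inv] by (simp add: tensor_eval_simps)
  qed (simp_all add: tensor_eval_simps rel)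
qed

lemma frag_of_zero_in_tnull: "frag_of (\<zero>\<^bsub>M\<^esub>, z) \<in> tnull" "x \<in> carrier M \<Longrightarrow> frag_of (x, 0) \<in> tnull"
proof -
  have "- frag_of (\<zero>\<^bsub>M\<^esub>, z) \<in> tnull"
    using tnull_relators(1)[of "\<zero>\<^bsub>M\<^esub>" "\<zero>\<^bsub>M\<^esub>" z] by simp
  then show "frag_of (\<zero>\<^bsub>M\<^esub>, z) \<in> tnull" using tnull_simps(3) by fastforce
  assume "x \<in> carrier M"
  then have "- frag_of (x, 0) \<in> tnull"
    using tnull_relators(2)[of x 0 0] by simp
  then show "frag_of (x, 0) \<in> tnull" using tnull_simps(3) by fastforce
qed

lemma frag_of_mult_by_vars:
  assumes "\<And>I. z I \<in> coord_space" "set us \<subseteq> {1..m}"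
  shows "kos (mulvar (Pow {1..m})) us z {} \<in> coord_space \<and>
    frag_of (of_coords (kos (mulvar (Pow {1..m})) us z {}), 1) \<in> tnull"
  using assms(2)
proof (induction us)
  case Nil
  have "of_coords 0 = \<zero>\<^bsub>M\<^esub>" using of_coords_coords[of "\<zero>\<^bsub>M\<^esub>"] coords_zero by simp
  then show ?case using frag_of_zero_in_tnull(1) monfun_0 by simp
next
  case (Cons u us)
  let ?f = "kos (mulvar (Pow {1..m})) us z {}" and ?g = "z {u}"
  let ?h = "mulvar (Pow {1..m}) u ?g"
  have u: "u \<in> {1..m}" and f: "?f \<in> coord_space" "frag_of (of_coords ?f, 1) \<in> tnull"
    using Cons by auto
  have h: "?h \<in> coord_space" by (rule monfun_mulvar[OF assms(1)])
  have g: "of_coords ?g \<in> carrier M" by (rule of_coords_closed[OF assms(1)])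
  have "frag_of (pvar u \<odot>\<^bsub>M\<^esub> of_coords ?g, 1) - frag_of (of_coords ?g, 0) \<in> tnull"
    using tnull_relators(3)[OF pvar_closed[OF u] g, of 1] lookup_pvar_mult[of u 1 0] by simp
  then have "frag_of (of_coords ?h, 1) \<in> tnull"
    using tnull_simps(2)[OF _ frag_of_zero_in_tnull(2)[OF g]]
    unfolding of_coords_mulvar[OF assms(1) u] by fastforce
  moreover have "frag_of (of_coords (?f + ?h), 1) - frag_of (of_coords ?f, 1) - frag_of (of_coords ?h, 1) \<in> tnull"
    unfolding of_coords_add[OF f(1) h] using f(1) h by (intro tnull_relators) (auto intro: of_coords_closed)
  ultimately have "frag_of (of_coords (?f + ?h), 1) \<in> tnull"
    using tnull_simps(2) f(2) by (metis diff_add_cancel)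
  then show ?case using f(1) h by (simp add: monfun_add)
qed

lemma constant_term_0_iff:
  assumes "x \<in> carrier M"
  shows "(\<forall>b. constant_term x b = 0) \<longleftrightarrow> coords x \<in> mult_by_vars (Pow {1..m}) [1..<Suc m] coord_space"
proof
  have set: "set [1..<Suc m] = {1..m}" by auto
  interpret mk: monfun_koszul "Pow {1..m}" "[1..<Suc m]"
    by standard (auto simp: subset_closed_def)
  assume "\<forall>b. constant_term x b = 0"
  then show "coords x \<in> mult_by_vars (Pow {1..m}) [1..<Suc m] coord_space"
    using mk.boundary_if_constant_term_0[OF coords_closed[OF assms]]
    unfolding constant_term_def mult_by_vars_def by blast
next
  assume "coords x \<in> mult_by_vars (Pow {1..m}) [1..<Suc m] coord_space"
  then obtain z where "coords x = kos (mulvar (Pow {1..m})) [1..<Suc m] z {}"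
    unfolding mult_by_vars_def by blast
  then show "\<forall>b. constant_term x b = 0"
    by (simp add: constant_term_def constant_term_kos del: upt_Suc)
qed

text \<open>Evaluation detects nonzero constant terms. Without constant terms \<open>x\<close> is a
  sum of multiples of variables, and a variable moved across the tensor sign acts by 0.\<close>

lemma frag_of_in_tnull_iff:
  assumes "x \<in> carrier M"
  shows "frag_of (x, 1) \<in> tnull \<longleftrightarrow> (\<forall>b. constant_term x b = 0)"
proof
  assume "frag_of (x, 1) \<in> tnull"
  then show "\<forall>b. constant_term x b = 0"
    using tensor_eval_tnull by (force simp: tensor_eval_simps)
next
  assume "\<forall>b. constant_term x b = 0"
  then obtain z where z: "\<And>I. z I \<in> coord_space" "coords x = kos (mulvar (Pow {1..m})) [1..<Suc m] z {}"
    using constant_term_0_iff[OF assms] unfolding mult_by_vars_def by blast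
  have "x = of_coords (kos (mulvar (Pow {1..m})) [1..<Suc m] z {})"
    using of_coords_coords[OF assms] z(2) by simp
  then show "frag_of (x, 1) \<in> tnull"
    using frag_of_mult_by_vars[of z "[1..<Suc m]"] z(1) by (metis atLeastLessThanSuc_atLeastAtMost set_upt subset_refl)
qed

end

section \<open>The tensor product as the group of all classes \<open>x \<otimes> 1\<close>\<close>

context based_module
begin

abbreviation tgroup :: "('f \<times> int \<Rightarrow>\<^sub>0 int) set monoid" where
  "tgroup \<equiv> tensor (Zpoly m) M Z_module"

abbreviation tcoset :: "('f \<times> int \<Rightarrow>\<^sub>0 int) \<Rightarrow> ('f \<times> int \<Rightarrow>\<^sub>0 int) set" where
  "tcoset c \<equiv> tnull #>\<^bsub>free_Abelian_group pairs\<^esub> c"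

definition cls :: "'f \<Rightarrow> ('f \<times> int \<Rightarrow>\<^sub>0 int) set" where
  "cls x = tcoset (frag_of (x, 1))"

lemma mem_tcoset_iff: "c' \<in> tcoset c \<longleftrightarrow> c' - c \<in> tnull"
proof -
  have "c' \<in> tcoset c \<longleftrightarrow> (\<exists>h\<in>tnull. c' = h + c)"
    by (simp add: r_coset_def)
  also have "\<dots> \<longleftrightarrow> c' - c \<in> tnull"
    by (metis add_diff_cancel_right' diff_add_cancel)
  finally show ?thesis .
qed

lemma tcoset_eq_iff: "tcoset c = tcoset c' \<longleftrightarrow> c - c' \<in> tnull"
proof
  assume "tcoset c = tcoset c'"
  then show "c - c' \<in> tnull"
    using mem_tcoset_iff[of c c] mem_tcoset_iff[of c c'] tnull_simps(1) by simp
next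
  assume *: "c - c' \<in> tnull"
  have "e - c \<in> tnull \<longleftrightarrow> e - c' \<in> tnull" for e
    using tnull_simps(2)[OF _ *, of "e - c"] tnull_simps(4)[OF _ *, of "e - c'"] by auto
  then show "tcoset c = tcoset c'"
    unfolding mem_tcoset_iff[symmetric] by blast
qed

lemma constant_term_minus:
  assumes "x \<in> carrier M" "y \<in> carrier M"
  shows "constant_term (x \<ominus>\<^bsub>M\<^esub> y) b = constant_term x b - constant_term y b"
proof -
  have "x = (x \<ominus>\<^bsub>M\<^esub> y) \<oplus>\<^bsub>M\<^esub> y" using assms by (simp add: M.minus_eq M.add.m_assoc M.l_neg)
  then have "constant_term x b = constant_term (x \<ominus>\<^bsub>M\<^esub> y) b + constant_term y b"
    using constant_term_add[of "x \<ominus>\<^bsub>M\<^esub> y" y b] assms by simp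
  then show ?thesis by simp
qed

lemma frag_of_minus_in_tnull:
  assumes "x \<in> carrier M" "y \<in> carrier M"
  shows "frag_of (x, z) - frag_of (y, z) - frag_of (x \<ominus>\<^bsub>M\<^esub> y, z) \<in> tnull"
proof -
  have "(x \<ominus>\<^bsub>M\<^esub> y) \<oplus>\<^bsub>M\<^esub> y = x" using assms by (simp add: M.minus_eq M.add.m_assoc M.l_neg)
  then show ?thesis
    using tnull_relators(1)[of "x \<ominus>\<^bsub>M\<^esub> y" y z] assms by (simp add: algebra_simps)
qed

lemma cls_eq_iff:
  assumes "x \<in> carrier M" "y \<in> carrier M"
  shows "cls x = cls y \<longleftrightarrow> (\<forall>b. constant_term x b = constant_term y b)"
proof -
  let ?c = "frag_of (x, 1) - frag_of (y, 1)" and ?r = "frag_of (x \<ominus>\<^bsub>M\<^esub> y, 1)"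
  have *: "?c - ?r \<in> tnull" by (rule frag_of_minus_in_tnull[OF assms])
  have "?c \<in> tnull \<longleftrightarrow> ?r \<in> tnull"
    using tnull_simps(2)[OF *, of ?r] tnull_simps(4)[OF _ *, of ?c] by auto
  then show ?thesis
    unfolding cls_def tcoset_eq_iff
    using frag_of_in_tnull_iff[of "x \<ominus>\<^bsub>M\<^esub> y"] assms by (simp add: constant_term_minus)
qed

text \<open>\<int> is generated by 1, so pure tensors with second entry 1 exhaust the tensor
  product. Homology can thus be discussed through elements of \<open>M\<close>.\<close>

lemma single_class:
  assumes "keys c \<subseteq> pairs"
  shows "\<exists>x\<in>carrier M. c - frag_of (x, 1) \<in> tnull"
  using assms
proof (induction c rule: frag_induction)
  case zero
  show ?case
    using tnull_simps(3)[OF frag_of_zero_in_tnull(1)[of 1]] by (intro bexI[of _ "\<zero>\<^bsub>M\<^esub>"]) simp_all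
next
  case (one p)
  then obtain x z where p: "p = (x, z)" "x \<in> carrier M" by auto
  \<comment> \<open>The constant polynomial \<open>z\<close> acts on \<int> as multiplication by
    \<open>z\<close>, so \<open>x \<otimes> z = z x \<otimes> 1\<close>.\<close>
  have c: "Poly_Mapping.single 0 z \<in> carrier (Zpoly m)"
    by (simp add: Zpoly_carrier_iff lookup_single when_def)
  then have "frag_of (Poly_Mapping.single 0 z \<odot>\<^bsub>M\<^esub> x, 1) - frag_of (x, z) \<in> tnull"
    using tnull_relators(3)[OF c p(2), of 1] by (simp add: lookup_single)
  then have "frag_of p - frag_of (Poly_Mapping.single 0 z \<odot>\<^bsub>M\<^esub> x, 1) \<in> tnull"
    using tnull_simps(3) p(1) by fastforce
  then show ?case using c p(2) by (intro bexI[OF _ M.smult_closed])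
next
  case (diff c c')
  then obtain x y where xy: "x \<in> carrier M" "c - frag_of (x, 1) \<in> tnull"
      "y \<in> carrier M" "c' - frag_of (y, 1) \<in> tnull" by auto
  have "(c - frag_of (x, 1)) - (c' - frag_of (y, 1)) +
      (frag_of (x, 1) - frag_of (y, 1) - frag_of (x \<ominus>\<^bsub>M\<^esub> y, 1)) \<in> tnull"
    by (intro tnull_simps(2) tnull_simps(4) frag_of_minus_in_tnull xy)
  then have "c - c' - frag_of (x \<ominus>\<^bsub>M\<^esub> y, 1) \<in> tnull" by (simp add: algebra_simps)
  then show ?case using xy by (intro bexI[OF _ M.minus_closed])
qed

lemma carrier_tgroup: "carrier tgroup = cls ` carrier M"
proof
  show "carrier tgroup \<subseteq> cls ` carrier M"
  proof
    fix C assume "C \<in> carrier tgroup"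
    then obtain c where c: "keys c \<subseteq> pairs" "C = tcoset c"
      unfolding tensor_def carrier_FactGroup by auto
    then obtain x where "x \<in> carrier M" "C = cls x"
      using single_class[OF c(1)] unfolding c(2) cls_def tcoset_eq_iff by blast
    then show "C \<in> cls ` carrier M" by blast
  qed
  show "cls ` carrier M \<subseteq> carrier tgroup"
    unfolding tensor_def carrier_FactGroup cls_def by (auto simp: keys_frag_of)
qed

lemma comm_group_tgroup: "comm_group tgroup"
  unfolding tensor_def
  by (rule comm_group.abelian_FactGroup[OF abelian_free_Abelian_group tnull_subgroup])

lemma cls_add:
  assumes "x \<in> carrier M" "y \<in> carrier M"
  shows "cls x \<otimes>\<^bsub>tgroup\<^esub> cls y = cls (x \<oplus>\<^bsub>M\<^esub> y)"
proof -
  interpret N: normal tnull "free_Abelian_group pairs"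
    by (rule comm_group.subgroup_imp_normal[OF abelian_free_Abelian_group tnull_subgroup])
  have "cls x \<otimes>\<^bsub>tgroup\<^esub> cls y = tcoset (frag_of (x, 1) + frag_of (y, 1))"
    using N.rcos_sum[of "frag_of (x, 1)" "frag_of (y, 1)"] assms
    by (simp add: tensor_def cls_def keys_frag_of)
  also have "\<dots> = cls (x \<oplus>\<^bsub>M\<^esub> y)"
    unfolding cls_def tcoset_eq_iff
    using tnull_simps(3)[OF tnull_relators(1)[OF assms, of 1]] by (simp add: algebra_simps)
  finally show ?thesis .
qed

lemma one_tgroup: "\<one>\<^bsub>tgroup\<^esub> = cls \<zero>\<^bsub>M\<^esub>"
proof -
  have "tcoset 0 = cls \<zero>\<^bsub>M\<^esub>"
    unfolding cls_def tcoset_eq_iff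
    using tnull_simps(3)[OF frag_of_zero_in_tnull(1)[of 1]] by simp
  then show ?thesis by (auto simp: tensor_def r_coset_def)
qed

lemma cls_closed: "x \<in> carrier M \<Longrightarrow> cls x \<in> carrier tgroup"
  by (simp add: carrier_tgroup)

lemma cls_pow:
  assumes "x \<in> carrier M"
  shows "cls x [^]\<^bsub>tgroup\<^esub> (k::nat) = cls (of_coords (scale k (coords x)))"
proof (induction k)
  case 0
  have "of_coords 0 = \<zero>\<^bsub>M\<^esub>" using of_coords_coords[of "\<zero>\<^bsub>M\<^esub>"] coords_zero by simp
  then show ?case by (simp add: scale_0 one_tgroup)
next
  case (Suc k)
  have s: "scale k (coords x) \<in> coord_space"
    by (rule submod_scale[OF submod_monfun coords_closed[OF assms]])
  have "of_coords (scale (Suc k) (coords x)) = x \<oplus>\<^bsub>M\<^esub> of_coords (scale k (coords x))"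
    using of_coords_add[OF coords_closed[OF assms] s] assms by (simp add: scale_Suc of_coords_coords)
  then show ?case
    using Suc s assms by (simp add: cls_add of_coords_closed M.add.m_comm)
qed

end

lemma tensor_map_cls:
  assumes M: "based_module m M B" and M': "based_module m M' B'" and d: "linear_map (Zpoly m) M M' d"
    and x: "x \<in> carrier M"
  shows "tensor_map (Zpoly m) M' Z_module d (based_module.cls m M x) = based_module.cls m M' (d x)"
proof -
  interpret M: based_module m M B by (rule M)
  interpret M': based_module m M' B' by (rule M')
  let ?h = "frag_extend (\<lambda>(x, y). frag_of (d x, y))"
  have closed: "\<And>x. x \<in> carrier M \<Longrightarrow> d x \<in> carrier M'"
    and add: "\<And>x y. x \<in> carrier M \<Longrightarrow> y \<in> carrier M \<Longrightarrow> d (x \<oplus>\<^bsub>M\<^esub> y) = d x \<oplus>\<^bsub>M'\<^esub> d y"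
    and smult: "\<And>r x. r \<in> carrier (Zpoly m) \<Longrightarrow> x \<in> carrier M \<Longrightarrow> d (r \<odot>\<^bsub>M\<^esub> x) = r \<odot>\<^bsub>M'\<^esub> d x"
    using d by (auto simp: linear_map_def)
  have rel: "?h r \<in> M'.tnull" if "r \<in> tensor_relators (Zpoly m) M Z_module" for r
    using that unfolding tensor_relators_def
    by (elim UnE CollectE exE conjE)
      (simp_all add: frag_extend_diff add smult closed M'.tnull_relators)
  have null: "?h c \<in> M'.tnull" if "c \<in> M.tnull" for c
    using that unfolding tensor_null_def[of _ M]
  proof (induction rule: generate.induct)
    case (inv r)
    then show ?case
      using rel[OF inv] M.relators_closed[OF inv]
      by (simp add: frag_extend_minus M'.tnull_simps(3))
  qed (simp_all add: M'.tnull_simps frag_extend_add rel)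
  have "M'.tcoset (?h c) = M'.cls (d x)" if "c \<in> M.cls x" for c
  proof -
    have "?h (c - frag_of (x, 1)) \<in> M'.tnull"
      using that null unfolding M.cls_def M.mem_tcoset_iff by blast
    then show ?thesis
      unfolding M'.cls_def M'.tcoset_eq_iff by (simp add: frag_extend_diff)
  qed
  \<comment> \<open>\<open>tensor_map\<close> is a union over the coset. All cosets in the union
    agree, so it only has to be nonempty.\<close>
  moreover have "M.cls x \<noteq> {}"
    using M.mem_tcoset_iff[of "frag_of (x, 1)" "frag_of (x, 1)"] M.tnull_simps(1)
    by (auto simp: M.cls_def)
  ultimately show ?thesis
    unfolding tensor_map_def by auto
qed

section \<open>A free resolution of \<int>[K] in coordinates\<close>

locale matroid_resolution =
  fixes m :: nat and K :: "nat set set"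
    and F :: "nat \<Rightarrow> (int_mpoly, 'f) module" and d :: "nat \<Rightarrow> 'f \<Rightarrow> 'f" and \<epsilon> :: "'f \<Rightarrow> int_mpoly set"
  assumes matroid: "matroid {1..m} K"
    and resolution: "free_resolution (Zpoly m) (SR_module m K) F d \<epsilon>"
begin

definition B :: "nat \<Rightarrow> 'f set" where
  "B n = (SOME B. module_basis (Zpoly m) (F n) B)"

sublocale F: based_module m "F n" "B n" for n
proof (rule based_module.intro)
  have free: "free_module (Zpoly m) (F n)"
    using resolution by (simp add: free_resolution_def)
  then show "module (Zpoly m) (F n)" by (simp add: free_module_def)
  have "\<exists>B. module_basis (Zpoly m) (F n) B"
    using free by (simp add: free_module_def)
  then show "module_basis (Zpoly m) (F n) (B n)"
    unfolding B_def by (rule someI_ex)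
qed

lemma d_linear: "linear_map (Zpoly m) (F (Suc n)) (F n) (d n)"
  using resolution by (simp add: free_resolution_def)

lemma d_simps:
  "x \<in> carrier (F (Suc n)) \<Longrightarrow> d n x \<in> carrier (F n)"
  "x \<in> carrier (F (Suc n)) \<Longrightarrow> y \<in> carrier (F (Suc n)) \<Longrightarrow>
    d n (x \<oplus>\<^bsub>F (Suc n)\<^esub> y) = d n x \<oplus>\<^bsub>F n\<^esub> d n y"
  "p \<in> carrier (Zpoly m) \<Longrightarrow> x \<in> carrier (F (Suc n)) \<Longrightarrow>
    d n (p \<odot>\<^bsub>F (Suc n)\<^esub> x) = p \<odot>\<^bsub>F n\<^esub> d n x"
  using d_linear[of n] by (auto simp: linear_map_def)

lemma d_exact_Suc: "d (Suc n) ` carrier (F (Suc (Suc n))) = {x \<in> carrier (F (Suc n)). d n x = \<zero>\<^bsub>F n\<^esub>}"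
  using resolution by (simp add: free_resolution_def)

lemma d_exact_0: "d 0 ` carrier (F (Suc 0)) = {x \<in> carrier (F 0). \<epsilon> x = \<zero>\<^bsub>SR_module m K\<^esub>}"
  using resolution by (simp add: free_resolution_def)

lemma eps_simps:
  "x \<in> carrier (F 0) \<Longrightarrow> \<epsilon> x \<in> carrier (SR_module m K)"
  "x \<in> carrier (F 0) \<Longrightarrow> y \<in> carrier (F 0) \<Longrightarrow>
    \<epsilon> (x \<oplus>\<^bsub>F 0\<^esub> y) = \<epsilon> x \<oplus>\<^bsub>SR_module m K\<^esub> \<epsilon> y"
  "p \<in> carrier (Zpoly m) \<Longrightarrow> x \<in> carrier (F 0) \<Longrightarrow>
    \<epsilon> (p \<odot>\<^bsub>F 0\<^esub> x) = p \<odot>\<^bsub>SR_module m K\<^esub> \<epsilon> x"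
  "\<epsilon> ` carrier (F 0) = carrier (SR_module m K)"
  using resolution by (auto simp: free_resolution_def linear_map_def)

lemma K: "subset_closed K" "K \<subseteq> Pow {1..m}"
  using matroid by (auto simp: matroid_def simplicial_complex_def subset_closed_def)

abbreviation vars :: "nat list" where "vars \<equiv> [1..<Suc m]"

lemma set_vars: "set vars = {1..m}"
  by auto

definition D :: "nat \<Rightarrow> ('f \<times> monomial \<Rightarrow> int) \<Rightarrow> 'f \<times> monomial \<Rightarrow> int" where
  "D n f = F.coords n (d n (F.of_coords (Suc n) f))"

definition E :: "('f \<times> monomial \<Rightarrow> int) \<Rightarrow> unit \<times> monomial \<Rightarrow> int" where
  "E f = SR_coords K (\<epsilon> (F.of_coords 0 f))"

lemma of_coords_image: "F.of_coords n ` F.coord_space n = carrier (F n)"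
proof (intro equalityI subsetI)
  fix x assume x: "x \<in> carrier (F n)"
  show "x \<in> F.of_coords n ` F.coord_space n"
    using imageI[OF F.coords_closed[OF x], of "F.of_coords n"] by (simp only: F.of_coords_coords[OF x])
qed (auto intro: F.of_coords_closed)

lemma coords_image: "F.coords n ` carrier (F n) = F.coord_space n"
proof (intro equalityI subsetI)
  fix f assume f: "f \<in> F.coord_space n"
  show "f \<in> F.coords n ` carrier (F n)"
    using imageI[OF F.of_coords_closed[OF f], of "F.coords n"] by (simp only: F.coords_of_coords[OF f])
qed (use F.coords_closed in blast)

lemma D_coords: "x \<in> carrier (F (Suc n)) \<Longrightarrow> D n (F.coords (Suc n) x) = F.coords n (d n x)"
  by (simp add: D_def F.of_coords_coords)

lemma D_image:
  "D n ` F.coord_space (Suc n) = F.coords n ` d n ` carrier (F (Suc n))"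
  unfolding of_coords_image[symmetric] by (simp add: D_def image_image)

lemma coords_kernel:
  assumes "\<And>x. x \<in> carrier (F n) \<Longrightarrow> P x \<longleftrightarrow> Q (F.coords n x)"
  shows "F.coords n ` {x \<in> carrier (F n). P x} = {f \<in> F.coord_space n. Q f}"
  unfolding coords_image[symmetric] using assms by auto

sublocale concrete_resolution "Pow {1..m}" K vars F.coord_space D E
proof
  show "subset_closed (Pow {1..m})" by (auto simp: subset_closed_def)
  show "distinct vars" by simp
  interpret S: monfun_koszul "Pow {1..m}" vars
    by standard (auto simp: subset_closed_def)
  interpret M: monfun_koszul K vars
    by standard (use K set_vars in auto)
  fix n j
  show "submod (Pow {1..m}) (F.coord_space n)" by (rule submod_monfun)
  show "koszul_acyclic (Pow {1..m}) vars (F.coord_space n)"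
    unfolding koszul_acyclic_def using S.exact_koszul set_vars by blast
  show "lin vars (Pow {1..m}) (F.coord_space (Suc n)) (Pow {1..m}) (D n)"
    unfolding lin_def set_vars
    by (simp add: D_def F.of_coords_add F.of_coords_mulvar F.coords_add F.coords_pvar d_simps
        F.of_coords_closed pvar_closed del: One_nat_def)
  show "lin vars (Pow {1..m}) (F.coord_space 0) K E"
    unfolding lin_def set_vars
    by (simp add: E_def F.of_coords_add F.of_coords_mulvar eps_simps SR_coords_add[OF K]
        SR_coords_pvar[OF K] F.of_coords_closed pvar_closed del: One_nat_def)
  have "E f = 0 \<longleftrightarrow> \<epsilon> (F.of_coords 0 f) = \<zero>\<^bsub>SR_module m K\<^esub>" if "f \<in> F.coord_space 0" for f
    using that by (simp add: E_def SR_coords_eq_0_iff[OF K] eps_simps F.of_coords_closed)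
  then show "D 0 ` F.coord_space (Suc 0) = {a \<in> F.coord_space 0. E a = 0}"
    unfolding D_image d_exact_0
    by (intro coords_kernel) (simp add: F.of_coords_coords F.coords_closed del: One_nat_def)
  show "D (Suc n) ` F.coord_space (Suc (Suc n)) = {a \<in> F.coord_space (Suc n). D n a = 0}"
    unfolding D_image d_exact_Suc
    by (intro coords_kernel) (simp add: D_coords F.coords_eq_0_iff d_simps)
  \<comment> \<open>The augmentation is onto, so its image in coordinates is all of \<int>[K], to
    which \<open>torsion_free_koszul\<close> applies in every degree.\<close>
  have "E ` F.coord_space 0 = SR_coords K ` \<epsilon> ` F.of_coords 0 ` F.coord_space 0"
    by (simp add: E_def image_image)
  then have E: "E ` F.coord_space 0 = monfun UNIV K"
    by (simp only: of_coords_image eps_simps(4) SR_coords_image[OF K])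
  show "koszul_torsion_free K vars (E ` F.coord_space 0) j"
    unfolding E koszul_torsion_free_def
  proof (intro allI impI)
    fix k :: nat and x y :: "nat set \<Rightarrow> unit \<times> monomial \<Rightarrow> int"
    assume k: "k > 0" and x: "\<forall>I. x I \<in> monfun UNIV K"
      and eq: "\<forall>I\<subseteq>set vars. card I = j \<longrightarrow> scale k (x I) = kos (mulvar K) vars y I"
    have "int k * x I p = kos (mulvar K) vars y I p" if "I \<subseteq> set vars" "card I = j" for I p
      using eq that unfolding scale_def by metis
    then show "\<exists>z. (\<forall>I. z I \<in> monfun UNIV K) \<and>
        (\<forall>I\<subseteq>set vars. card I = j \<longrightarrow> x I = kos (mulvar K) vars z I)"
      using M.torsion_free_koszul[OF matroid, of "int k" x UNIV j y] k x by simp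
  qed
qed

end

section \<open>Torsion in the homology of the tensored resolution\<close>

context matroid_resolution
begin

abbreviation T :: "nat \<Rightarrow> ('f \<times> int \<Rightarrow>\<^sub>0 int) set monoid" where
  "T n \<equiv> F.tgroup n"

abbreviation \<delta> :: "nat \<Rightarrow> ('f \<times> int \<Rightarrow>\<^sub>0 int) set \<Rightarrow> ('f \<times> int \<Rightarrow>\<^sub>0 int) set" where
  "\<delta> n \<equiv> tensor_map (Zpoly m) (F n) Z_module (d n)"

abbreviation cycles :: "nat \<Rightarrow> ('f \<times> int \<Rightarrow>\<^sub>0 int) set set" where
  "cycles \<equiv> Tor_cycles (Zpoly m) F d Z_module"

abbreviation boundaries :: "nat \<Rightarrow> ('f \<times> int \<Rightarrow>\<^sub>0 int) set set" where
  "boundaries \<equiv> Tor_boundaries (Zpoly m) F d Z_module"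

lemma \<delta>_cls: "x \<in> carrier (F (Suc n)) \<Longrightarrow> \<delta> n (F.cls (Suc n) x) = F.cls n (d n x)"
  by (rule tensor_map_cls[OF F.based_module_axioms F.based_module_axioms d_linear])

lemma \<delta>_hom: "group_hom (T (Suc n)) (T n) (\<delta> n)"
proof -
  have "\<delta> n \<in> hom (T (Suc n)) (T n)"
  proof (rule homI)
    fix C C' assume "C \<in> carrier (T (Suc n))" "C' \<in> carrier (T (Suc n))"
    then obtain x y where *: "x \<in> carrier (F (Suc n))" "C = F.cls (Suc n) x"
        "y \<in> carrier (F (Suc n))" "C' = F.cls (Suc n) y"
      unfolding F.carrier_tgroup by blast
    show "\<delta> n C \<in> carrier (T n)"
      unfolding *(2) \<delta>_cls[OF *(1)] by (intro F.cls_closed d_simps *)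
    show "\<delta> n (C \<otimes>\<^bsub>T (Suc n)\<^esub> C') = \<delta> n C \<otimes>\<^bsub>T n\<^esub> \<delta> n C'"
      unfolding *(2,4) F.cls_add[OF *(1,3)] \<delta>_cls[OF *(1)] \<delta>_cls[OF *(3)]
      using * by (subst \<delta>_cls) (simp_all add: d_simps F.cls_add)
  qed
  then show ?thesis
    using comm_group.axioms(2)[OF F.comm_group_tgroup] by (simp add: group_hom_def group_hom_axioms_def)
qed

lemma subgroup_cycles: "subgroup (cycles n) (T n)"
proof (cases n)
  case 0
  then show ?thesis
    using group.subgroup_self[OF comm_group.axioms(2)[OF F.comm_group_tgroup]] by simp
next
  case (Suc i)
  then show ?thesis using group_hom.subgroup_kernel[OF \<delta>_hom] by simp
qed

lemma subgroup_boundaries: "subgroup (boundaries n) (T n)"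
  unfolding Tor_boundaries_def by (rule group_hom.img_is_subgroup[OF \<delta>_hom])

lemma mem_boundaries_iff: "C \<in> boundaries n \<longleftrightarrow> (\<exists>y\<in>carrier (F (Suc n)). C = F.cls n (d n y))"
  unfolding Tor_boundaries_def F.carrier_tgroup image_image image_iff
  by (simp add: \<delta>_cls cong: bex_cong)

text \<open>Via \<open>constant_term_0_iff\<close>, cycles become the classes of those
  \<open>x\<close> that \<open>d n\<close> maps to sums of multiples of variables, the hypothesis of
  \<open>torsion_Suc\<close>.\<close>

lemma cls_mem_cycles_Suc_iff:
  assumes "x \<in> carrier (F (Suc n))"
  shows "F.cls (Suc n) x \<in> cycles (Suc n) \<longleftrightarrow> (\<forall>b. F.constant_term n (d n x) b = 0)"
proof -
  have "F.cls (Suc n) x \<in> cycles (Suc n) \<longleftrightarrow> F.cls n (d n x) = F.cls n \<zero>\<^bsub>F n\<^esub>"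
    using assms by (simp add: kernel_def \<delta>_cls F.one_tgroup F.cls_closed)
  also have "\<dots> \<longleftrightarrow> (\<forall>b. F.constant_term n (d n x) b = 0)"
    using F.cls_eq_iff[OF d_simps(1)[OF assms] F.M.zero_closed]
    by (simp add: F.constant_term_def[of n "\<zero>\<^bsub>F n\<^esub>"] F.coords_zero fun_arith_apply)
  finally show ?thesis .
qed

lemma boundaries_subset_cycles: "boundaries n \<subseteq> cycles n"
proof (cases n)
  case 0
  then show ?thesis using subgroup.subset[OF subgroup_boundaries[of 0]] by simp
next
  case (Suc i)
  show ?thesis
  proof
    fix C assume "C \<in> boundaries n"
    then obtain y where y: "y \<in> carrier (F (Suc n))" "C = F.cls n (d n y)"
      unfolding mem_boundaries_iff by blast
    have "d n y \<in> {x \<in> carrier (F (Suc i)). d i x = \<zero>\<^bsub>F i\<^esub>}"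
      unfolding d_exact_Suc[symmetric] using y(1) Suc by simp
    then have "F.cls (Suc i) (d n y) \<in> cycles (Suc i)"
      by (subst cls_mem_cycles_Suc_iff)
        (simp_all add: F.constant_term_def F.coords_zero fun_arith_apply)
    then show "C \<in> cycles n" using y(2) Suc by simp
  qed
qed

lemma boundary_if_multiple_boundary:
  assumes x: "x \<in> carrier (F n)" "F.cls n x \<in> cycles n" and k: "k > 0"
    and pow: "F.cls n x [^]\<^bsub>T n\<^esub> (k::nat) \<in> boundaries n"
  shows "F.cls n x \<in> boundaries n"
proof -
  let ?m = "mult_by_vars (Pow {1..m}) vars"
  obtain y where y: "y \<in> carrier (F (Suc n))" "F.cls n x [^]\<^bsub>T n\<^esub> k = F.cls n (d n y)"
    using pow unfolding mem_boundaries_iff by blast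
  define u where "u = F.of_coords n (scale k (F.coords n x))"
  have s: "scale k (F.coords n x) \<in> F.coord_space n"
    by (rule submod_scale[OF submod_monfun F.coords_closed[OF x(1)]])
  have u: "u \<in> carrier (F n)" "F.coords n u = scale k (F.coords n x)"
    unfolding u_def by (rule F.of_coords_closed[OF s], rule F.coords_of_coords[OF s])
  have dy: "d n y \<in> carrier (F n)" by (rule d_simps(1)[OF y(1)])
  \<comment> \<open>The classes of \<open>u\<close>, which is \<open>k\<close> times
    \<open>x\<close>, and of \<open>d n y\<close> agree. So \<open>w\<close> is a sum of multiples
    of variables and provides the error term of the torsion relation.\<close>
  define w where "w = u \<ominus>\<^bsub>F n\<^esub> d n y"
  have w: "w \<in> carrier (F n)" "u = d n y \<oplus>\<^bsub>F n\<^esub> w"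
    using u(1) dy by (simp_all add: w_def F.M.minus_eq F.M.add.m_lcomm F.M.r_neg)
  have "F.cls n u = F.cls n (d n y)"
    using y(2) F.cls_pow[OF x(1), of k] by (simp add: u_def)
  then have "\<forall>b. F.constant_term n w b = 0"
    using F.cls_eq_iff[OF u(1) dy] F.constant_term_minus[OF u(1) dy] by (simp add: w_def)
  then have wm: "F.coords n w \<in> ?m (F.coord_space n)"
    using F.constant_term_0_iff[OF w(1)] by blast
  have eq: "scale k (F.coords n x) = D n (F.coords (Suc n) y) + F.coords n w"
    unfolding u(2)[symmetric] w(2) F.coords_add[OF dy w(1)] D_coords[OF y(1)] ..
  have "\<exists>y' w'. y' \<in> F.coord_space (Suc n) \<and> w' \<in> ?m (F.coord_space n) \<and> F.coords n x = D n y' + w'"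
  proof (cases n)
    case 0
    note A = x(1)[unfolded 0] y(1)[unfolded 0] wm[unfolded 0] eq[unfolded 0]
    obtain y' w' where "y' \<in> F.coord_space (Suc 0)" "w' \<in> ?m (F.coord_space 0)"
      "F.coords 0 x = D 0 y' + w'"
      by (rule torsion_0[OF k F.coords_closed[OF A(1)] F.coords_closed[OF A(2)] A(3,4)])
    then show ?thesis unfolding 0 by (intro exI[of _ y'] exI[of _ w'] conjI)
  next
    case (Suc i)
    note A = x(1)[unfolded Suc] y(1)[unfolded Suc] wm[unfolded Suc] eq[unfolded Suc]
    have "\<forall>b. F.constant_term i (d i x) b = 0"
      using cls_mem_cycles_Suc_iff[of x i] x unfolding Suc by blast
    then have Dx: "D i (F.coords (Suc i) x) \<in> ?m (F.coord_space i)"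
      using F.constant_term_0_iff[OF d_simps(1)[OF A(1)]] unfolding D_coords[OF A(1)] by blast
    obtain y' w' where "y' \<in> F.coord_space (Suc (Suc i))" "w' \<in> ?m (F.coord_space (Suc i))"
      "F.coords (Suc i) x = D (Suc i) y' + w'"
      by (rule torsion_Suc[OF k F.coords_closed[OF A(1)] F.coords_closed[OF A(2)] A(3) Dx A(4)])
    then show ?thesis unfolding Suc by (intro exI[of _ y'] exI[of _ w'] conjI)
  qed
  then obtain y' w' where yw: "y' \<in> F.coord_space (Suc n)" "w' \<in> ?m (F.coord_space n)"
      "F.coords n x = D n y' + w'"
    by blast
  let ?y = "F.of_coords (Suc n) y'"
  have y': "?y \<in> carrier (F (Suc n))" by (rule F.of_coords_closed[OF yw(1)])
  obtain z where z: "w' = kos (mulvar (Pow {1..m})) vars z {}"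
    using yw(2) unfolding mult_by_vars_def by blast
  have "F.constant_term n x b = F.constant_term n (d n ?y) b" for b
    \<comment> \<open>\<open>w'\<close> has no constant terms, so it vanishes in the tensor
      product.\<close>
    unfolding F.constant_term_def yw(3) D_def z by (simp add: fun_arith_apply constant_term_kos del: upt_Suc)
  then have "F.cls n x = F.cls n (d n ?y)"
    using F.cls_eq_iff[OF x(1) d_simps(1)[OF y']] by blast
  then show ?thesis using y' mem_boundaries_iff by blast
qed

lemma Tor_deg_group: "group (Tor_deg (Zpoly m) F d Z_module n)"
  and Tor_deg_torsion_free: "torsion_free (Tor_deg (Zpoly m) F d Z_module n)"
proof -
  interpret T: comm_group "T n" by (rule F.comm_group_tgroup)
  let ?C = "(T n)\<lparr>carrier := cycles n\<rparr>"
  have group: "group ?C" by (rule subgroup.subgroup_is_group[OF subgroup_cycles T.is_group])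
  have sub: "cycles n \<subseteq> carrier (T n)" by (rule subgroup.subset[OF subgroup_cycles])
  interpret C: comm_group ?C
    by (rule group.group_comm_groupI[OF group]) (use sub T.m_comm in auto)
  have B: "subgroup (boundaries n) ?C"
    by (rule T.subgroup_incl[OF subgroup_boundaries subgroup_cycles boundaries_subset_cycles])
  show "group (Tor_deg (Zpoly m) F d Z_module n)"
    unfolding Tor_deg_def by (rule normal.factorgroup_is_group[OF C.subgroup_imp_normal[OF B]])
  show "torsion_free (Tor_deg (Zpoly m) F d Z_module n)"
    unfolding Tor_deg_def
  proof (rule C.torsion_free_FactGroup[OF B])
    fix C and k :: nat
    assume C: "C \<in> carrier ?C" and k: "k > 0" and pow: "C [^]\<^bsub>?C\<^esub> k \<in> boundaries n"
    have "C \<in> carrier (T n)" using C sub by auto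
    then obtain x where x: "x \<in> carrier (F n)" "C = F.cls n x"
      unfolding F.carrier_tgroup by blast
    have "C [^]\<^bsub>T n\<^esub> k \<in> boundaries n"
      using pow T.nat_pow_consistent[of C k "cycles n"] by simp
    then show "C \<in> boundaries n"
      using boundary_if_multiple_boundary[OF x(1) _ k] C unfolding x(2) by simp
  qed
qed

end

theorem corollary3p5:
  fixes m :: nat and K :: "nat set set"
    and F :: "nat \<Rightarrow> (int_mpoly, 'f) module" and d :: "nat \<Rightarrow> 'f \<Rightarrow> 'f"
    and \<epsilon> :: "'f \<Rightarrow> int_mpoly set"
  assumes "matroid {1..m} K"
    and "free_resolution (Zpoly m) (SR_module m K) F d \<epsilon>"
  shows "torsion_free (Tor (Zpoly m) F d Z_module)"
proof -
  interpret matroid_resolution m K F d \<epsilon>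
    by (rule matroid_resolution.intro[OF assms])
  show ?thesis
    unfolding Tor_def by (rule torsion_free_sum_group[OF Tor_deg_group Tor_deg_torsion_free])
qed

end
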